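(* Let $(\mathcal X,d)$ be a compact metric space, let $C:\mathcal X\times\mathcal X\to\mathbb R$ be a symmetric, $L$-Lipschitz cost function, and let $\alpha,\beta\in\mathcal P(\mathcal X)$. Let the step sizes $(\eta_t)_t$ and batch sizes $(n(t))_t$ be such that, for some constant $B>0$ and positive sequence $(w_t)_t$: for all $t>0$, $n(t)=\frac{B}{w_t^2}\in\mathbb N$ and $0\le\eta_t\le1$; $\sum_t w_t\eta_t<\infty$; and $\sum_t\eta_t=\infty$. Then the iterates $(\hat f_t,\hat g_t)_t$ of the online Sinkhorn algorithm with these step sizes and batch sizes converge almost surely: $$\|\hat f_t-f^\star\|_{\mathrm{var}}+\|\hat g_t-g^\star\|_{\mathrm{var}}\longrightarrow 0\quad\text{as }t\to\infty.$$
   Context: $\mathcal C(\mathcal X)$ is the set of continuous real functions on $\mathcal X$, $\mathcal P(\mathcal X)$ the set of Borel probability measures on $\mathcal X$. For $h\in\mathcal C(\mathcal X)$ and $\mu\in\mathcal P(\mathcal X)$ the soft $C$-transform is $T_\mu(h)(\cdot)=-\log\int_{\mathcal X}\exp(h(y)-C(\cdot,y))\,d\mu(y)$ (the regularization parameter is $\varepsilon=1$). The variation norm is $\|f\|_{\mathrm{var}}=\max_x f(x)-\min_x f(x)$ (functions are considered up to additive constants). Optimal potentials: $(f^\star,g^\star)\in\mathcal C(\mathcal X)^2$ is a solution of the dual entropic optimal transport problem $\max_{f,g\in\mathcal C(\mathcal X)}\int f\,d\alpha+\int g\,d\beta-\int\!\!\int e^{f(x)+g(y)-C(x,y)}d\alpha(x)d\beta(y)+1$,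 satisfying $f^\star=T_\beta(g^\star)$ and $g^\star=T_\alpha(f^\star)$ on all of $\mathcal X$; it is unique up to $(f^\star+c,g^\star-c)$, $c\in\mathbb R$. Online Sinkhorn algorithm with batch sizes $n(t)$: let $(x_i)_i$ be i.i.d. from $\alpha$ and $(y_i)_i$ i.i.d. from $\beta$, all independent; $n_0=0$, $n_{t+1}=n_t+n(t)$ ($n(0)$ a positive integer); $\hat\alpha_t=\frac1{n(t)}\sum_{i=n_t+1}^{n_{t+1}}\delta_{x_i}$, $\hat\beta_t=\frac1{n(t)}\sum_{i=n_t+1}^{n_{t+1}}\delta_{y_i}$. Initialize from the first batch with zero weights: $e^{-\hat f_1(\cdot)}=\sum_{i=1}^{n_1}e^{-C(\cdot,y_i)}$, $e^{-\hat g_1(\cdot)}=\sum_{i=1}^{n_1}e^{-C(x_i,\cdot)}$. For $t\ge1$, $$e^{-\hat f_{t+1}}=(1-\eta_t)e^{-\hat f_t}+\eta_t e^{-T_{\hat\beta_t}(\hat g_t)},\qquad e^{-\hat g_{t+1}}=(1-\eta_t)e^{-\hat g_t}+\eta_t e^{-T_{\hat\alpha_t}(\hat f_t)}.$$ *)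

theory Defs
  imports "HOL-Probability.Probability"
begin

definition soft_C_transform ::
  "('a::metric_space \<Rightarrow> 'a \<Rightarrow> real) \<Rightarrow> 'a measure \<Rightarrow> ('a \<Rightarrow> real) \<Rightarrow> 'a \<Rightarrow> real" where
  "soft_C_transform C \<mu> h x = - ln (\<integral>y. exp (h y - C x y) \<partial>\<mu>)"

(* For continuous f on a compact space the supremum and infimum are attained. On functions for
   which they are not finite the value is meaningless. *)
definition var_norm :: "('a \<Rightarrow> real) \<Rightarrow> real" where
  "var_norm f = (SUP x. f x) - (INF x. f x)"

definition entropic_dual ::
  "('a::metric_space \<Rightarrow> 'a \<Rightarrow> real) \<Rightarrow> 'a measure \<Rightarrow> 'a measure \<Rightarrow> ('a \<Rightarrow> real) \<Rightarrow> ('a \<Rightarrow> real) \<Rightarrow> real"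
where
  "entropic_dual C \<alpha> \<beta> f g =
     (\<integral>x. f x \<partial>\<alpha>) + (\<integral>y. g y \<partial>\<beta>)
       - (\<integral>y. (\<integral>x. exp (f x + g y - C x y) \<partial>\<alpha>) \<partial>\<beta>) + 1"

(* The maximisation determines the potentials (up to constants) only on the supports of the
   measures; the two fixed-point equations select the representative on the whole space. *)
definition optimal_potentials ::
  "('a::metric_space \<Rightarrow> 'a \<Rightarrow> real) \<Rightarrow> 'a measure \<Rightarrow> 'a measure \<Rightarrow> ('a \<Rightarrow> real) \<Rightarrow> ('a \<Rightarrow> real) \<Rightarrow> bool"
where
  "optimal_potentials C \<alpha> \<beta> f g \<longleftrightarrow>
     continuous_on UNIV f \<and> continuous_on UNIV g \<and>
     (\<forall>f' g'. continuous_on UNIV f' \<longrightarrow> continuous_on UNIV g' \<longrightarrow>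
        entropic_dual C \<alpha> \<beta> f' g' \<le> entropic_dual C \<alpha> \<beta> f g) \<and>
     f = soft_C_transform C \<beta> g \<and> g = soft_C_transform C \<alpha> f"

definition batch_start :: "(nat \<Rightarrow> nat) \<Rightarrow> nat \<Rightarrow> nat" where
  "batch_start n t = (\<Sum>s<t. n s)"

(* The average of the Dirac masses at the points z i, where i ranges over the batch
   batch_start n t + 1, ..., batch_start n (t + 1), as a Borel measure. *)
definition batch_measure ::
  "(nat \<Rightarrow> nat) \<Rightarrow> (nat \<Rightarrow> 'a::metric_space) \<Rightarrow> nat \<Rightarrow> 'a measure" where
  "batch_measure n z t =
     distr (uniform_count_measure {batch_start n t + 1 .. batch_start n (t + 1)}) borel z"

(* For fixed sample sequences x and y, indexed from 1, the equations determine f t and g t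
   for t \<ge> 1; the values f 0 and g 0 play no role. *)
definition online_sinkhorn ::
  "('a::metric_space \<Rightarrow> 'a \<Rightarrow> real) \<Rightarrow> (nat \<Rightarrow> nat) \<Rightarrow> (nat \<Rightarrow> real) \<Rightarrow> (nat \<Rightarrow> 'a) \<Rightarrow> (nat \<Rightarrow> 'a) \<Rightarrow>
     (nat \<Rightarrow> 'a \<Rightarrow> real) \<Rightarrow> (nat \<Rightarrow> 'a \<Rightarrow> real) \<Rightarrow> bool"
where
  "online_sinkhorn C n \<eta> x y f g \<longleftrightarrow>
     (\<forall>z. exp (- f 1 z) = (\<Sum>i = 1..batch_start n 1. exp (- C z (y i)))) \<and>
     (\<forall>z. exp (- g 1 z) = (\<Sum>i = 1..batch_start n 1. exp (- C (x i) z))) \<and>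
     (\<forall>t\<ge>1. \<forall>z. exp (- f (t + 1) z) =
        (1 - \<eta> t) * exp (- f t z)
          + \<eta> t * exp (- soft_C_transform C (batch_measure n y t) (g t) z)) \<and>
     (\<forall>t\<ge>1. \<forall>z. exp (- g (t + 1) z) =
        (1 - \<eta> t) * exp (- g t z)
          + \<eta> t * exp (- soft_C_transform C (batch_measure n x t) (f t) z))"

end

theory Submission imports Defs begin

text \<open>
  Write \<open>a = exp (- f)\<close>, \<open>b = exp (- g)\<close>, \<open>K = exp (- C)\<close>, let \<open>a*\<close>, \<open>b*\<close> be the exponentials of the
  optimal potentials, and pass to the ratios \<open>u = a / a*\<close> and \<open>v = b / b*\<close>. The variation distances
  to the optimum are the oscillations of \<open>ln u\<close> and \<open>ln v\<close>. The fixed-point equations say that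
  \<open>p z y = K z y / (a* z * b* y)\<close> has mean one in each variable, so that \<open>P \<phi> z = \<integral> p z y \<phi> y d\<beta>\<close> is an
  averaging operator with \<open>\<integral> P \<phi> d\<alpha> = \<integral> \<phi> d\<beta>\<close>. In these unknowns the algorithm reads
  \<open>u' = (1 - \<eta>) u + \<eta> P (1 / v) (1 + \<rho>)\<close>, and symmetrically for \<open>v\<close> with an error \<open>\<sigma>\<close>, where
  \<open>\<rho>\<close> and \<open>\<sigma>\<close> are the relative sampling errors of the batches.

  The noise is measured by the mean \<open>\<integral> \<bar>\<rho>\<bar> d\<alpha>\<close> and at single points, never by its supremum. At a
  given point of the space the conditional expectation of \<open>\<bar>\<rho>\<bar>\<close> is at most \<open>R / sqrt n\<close>, whereas the supremum over
  a general compact space need not obey a bound of this order. The Lyapunov function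
  must therefore be built from averages. Put \<open>s = \<integral> u d\<alpha>\<close>, \<open>1 / r = \<integral> (1 / v) d\<beta>\<close>,
  \<open>s' = \<integral> v d\<beta>\<close>, \<open>1 / r' = \<integral> (1 / u) d\<alpha>\<close>. Without noise, invariance of the means under \<open>P\<close>,
  Jensen's inequality and concavity of the harmonic mean give \<open>s \<mapsto> (1 - \<eta>) s + \<eta> / r\<close> as an upper
  bound and \<open>r \<mapsto> (1 - \<eta>) r + \<eta> / s\<close> as a lower bound for the new values. Hence \<open>max s (1 / r)\<close> and \<open>s / r\<close>
  do not increase, nor do the primed counterparts. The product
  \<open>W = (s / r) (s' / r') = (\<integral> u d\<alpha>) (\<integral> (1 / u) d\<alpha>) (\<integral> v d\<beta>) (\<integral> (1 / v) d\<beta>)\<close> is invariant under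
  \<open>(u, v) \<mapsto> (c u, v / c)\<close> and at least one, with equality only if \<open>u\<close> and \<open>v\<close> are almost everywhere
  constant. Since \<open>p\<close> is bounded below, Jensen's inequality has a quantitative gap (\<open>P_gap\<close>), and
  \<open>ln W\<close> contracts by a factor \<open>1 - \<gamma> \<eta>\<close> up to an error that is a multiple of
  \<open>\<eta> (\<integral> \<bar>\<rho>\<bar> d\<alpha> + \<integral> \<bar>\<sigma>\<bar> d\<beta>)\<close> (\<open>coupled_scales_converge\<close>). These errors are almost surely summable,
  because their expectations are bounded by multiples of \<open>\<eta> w\<close>.

  Once \<open>W\<close> tends to one, \<open>1 / v\<close> is close to its mean \<open>m\<close> in \<open>L\<^sup>1(\<beta>)\<close>, so \<open>P (1 / v)\<close> is close to \<open>m\<close>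
  at every point, also outside the supports. Both \<open>u z\<close> and \<open>s\<close> then relax towards the common target
  \<open>m\<close>, and their difference vanishes (\<open>pointwise_convergence\<close>). All logarithms involved share one
  Lipschitz constant, so convergence on a countable dense set is uniform.
\<close>

section \<open>Perturbed recursive inequalities\<close>

text \<open>From an index on at which \<open>\<xi>\<close> stays below \<open>\<epsilon>\<close>, the excess of \<open>x\<close> over \<open>\<epsilon>\<close> is multiplied by \<open>1 - h k\<close>
  up to the summable error. The product of these factors is at most \<open>exp (- (\<Sum> h))\<close> and tends to
  zero.\<close>

lemma affine_recursion_tendsto_zero:
  fixes x h \<xi> e :: "nat \<Rightarrow> real"
  assumes x: "\<And>k. 0 \<le> x k" and h: "\<And>k. 0 \<le> h k" "\<And>k. h k \<le> 1"
    and h_diverges: "filterlim (\<lambda>N. \<Sum>k<N. h k) at_top sequentially"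
    and \<xi>: "\<xi> \<longlonglongrightarrow> 0" and e: "\<And>k. 0 \<le> e k" "summable e"
    and step: "\<And>k. x (Suc k) \<le> (1 - h k) * x k + h k * \<xi> k + e k"
  shows "x \<longlonglongrightarrow> 0"
proof (rule LIMSEQ_I)
  fix r :: real assume "0 < r"
  define \<epsilon> where "\<epsilon> = r / 4"
  have \<epsilon>: "0 < \<epsilon>" using \<open>0 < r\<close> by (simp add: \<epsilon>_def)
  from LIMSEQ_D[OF \<xi> \<epsilon>] obtain T1 where T1': "\<forall>k\<ge>T1. norm (\<xi> k - 0) < \<epsilon>" by blast
  have T1: "\<xi> k \<le> \<epsilon>" if "k \<ge> T1" for k
    using T1'[rule_format, OF that] by simp
  from e(2)[unfolded summable_Cauchy, rule_format, OF \<epsilon>]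
  obtain T2 where "\<forall>m\<ge>T2. \<forall>n. norm (sum e {m..<n}) < \<epsilon>" by blast
  then have T2: "norm (sum e {m..<n}) < \<epsilon>" if "m \<ge> T2" for m n
    using that by blast
  define T where "T = max T1 T2"
  \<comment> \<open>Truncation at zero keeps the recursion for the excess valid when \<open>x\<close> drops below \<open>\<epsilon>\<close>.\<close>
  define y where "y = (\<lambda>k. max 0 (x k - \<epsilon>))"
  define H where "H = (\<lambda>N. \<Sum>k<N. h k)"
  have y_step: "y (Suc k) \<le> (1 - h k) * y k + e k" if "k \<ge> T" for k
  proof -
    have "x (Suc k) - \<epsilon> \<le> (1 - h k) * (x k - \<epsilon>) + h k * (\<xi> k - \<epsilon>) + e k"
      using step[of k] by (simp add: algebra_simps)
    also have "\<dots> \<le> (1 - h k) * y k + 0 + e k"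
      using h T1 that by (intro add_mono mult_left_mono mult_nonneg_nonpos)
        (auto simp: y_def T_def)
    finally show ?thesis using h[of k] e(1)[of k]
      by (auto simp: y_def max_def)
  qed
  have y_bound: "y (T + j) \<le> exp (- (H (T + j) - H T)) * y T + sum e {T..<T + j}" for j
  proof (induction j)
    case (Suc j)
    have "y (T + Suc j) \<le> (1 - h (T + j)) * y (T + j) + e (T + j)"
      using y_step[of "T + j"] by simp
    also have "(1 - h (T + j)) * y (T + j)
        \<le> (1 - h (T + j)) * (exp (- (H (T + j) - H T)) * y T + sum e {T..<T + j})"
      using Suc h by (intro mult_left_mono) auto
    also have "\<dots> \<le> exp (- h (T + j)) * (exp (- (H (T + j) - H T)) * y T)
        + 1 * sum e {T..<T + j}"
      unfolding distrib_left using h[of "T + j"] e exp_ge_add_one_self[of "- h (T + j)"]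
      by (intro add_mono mult_right_mono) (auto simp: y_def intro!: sum_nonneg)
    also have "exp (- h (T + j)) * (exp (- (H (T + j) - H T)) * y T) = exp (- (H (T + Suc j) - H T)) * y T"
      unfolding mult.assoc[symmetric] mult_exp_exp by (simp add: H_def)
    finally show ?case by simp
  qed simp
  have "filterlim (\<lambda>j. H (T + j) - H T) at_top sequentially"
    unfolding filterlim_at_top
  proof
    fix Z
    have "\<forall>\<^sub>F N in sequentially. Z + H T \<le> H N"
      using h_diverges unfolding filterlim_at_top H_def by blast
    then obtain N where "\<And>m. m \<ge> N \<Longrightarrow> Z + H T \<le> H m" by (auto simp: eventually_sequentially)
    then have "Z \<le> H (T + j) - H T" if "j \<ge> N" for j
      using \<open>\<And>m. m \<ge> N \<Longrightarrow> Z + H T \<le> H m\<close>[of "T + j"] that by linarith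
    then show "\<forall>\<^sub>F j in sequentially. Z \<le> H (T + j) - H T"
      by (auto simp: eventually_sequentially)
  qed
  then have "filterlim (\<lambda>j. - (H (T + j) - H T)) at_bot sequentially"
    by (rule filterlim_compose[OF filterlim_uminus_at_bot_at_top])
  then have "(\<lambda>j. exp (- (H (T + j) - H T))) \<longlonglongrightarrow> 0"
    by (rule filterlim_compose[OF exp_at_bot])
  from tendsto_mult[OF this tendsto_const[of "y T"]]
  have "(\<lambda>j. exp (- (H (T + j) - H T)) * y T) \<longlonglongrightarrow> 0" by simp
  from LIMSEQ_D[OF this \<epsilon>] obtain J
    where J': "\<forall>j\<ge>J. norm (exp (- (H (T + j) - H T)) * y T - 0) < \<epsilon>" by blast
  have J: "exp (- (H (T + j) - H T)) * y T < \<epsilon>" if "j \<ge> J" for j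
    using J'[rule_format, OF that] by (simp only: real_norm_def diff_0_right abs_less_iff)
  have "norm (x k - 0) < r" if "k \<ge> T + J" for k
  proof -
    define j where "j = k - T"
    have k: "k = T + j" "j \<ge> J" using that by (auto simp: j_def)
    have "sum e {T..<T + j} < \<epsilon>"
      using T2[of T "T + j"] by (simp only: T_def real_norm_def abs_less_iff max.cobounded2)
    with y_bound[of j] J[OF k(2)] have "y k \<le> \<epsilon> + \<epsilon>" unfolding k(1) by linarith
    moreover have "x k - \<epsilon> \<le> y k" by (simp add: y_def)
    ultimately show ?thesis using x[of k] \<open>0 < r\<close> by (simp add: \<epsilon>_def)
  qed
  then show "\<exists>no. \<forall>n\<ge>no. norm (x n - 0) < r" by blast
qed

lemma multiplicative_recursion_bound:
  fixes x e :: "nat \<Rightarrow> real"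
  assumes x: "\<And>k. 0 \<le> x k" and e: "\<And>k. 0 \<le> e k" "summable e"
    and step: "\<And>k. x (Suc k) \<le> (1 + e k) * x k"
  shows "x k \<le> exp (suminf e) * x 0"
proof -
  have "x k \<le> exp (\<Sum>j<k. e j) * x 0"
  proof (induction k)
    case (Suc k)
    have "x (Suc k) \<le> exp (e k) * (exp (\<Sum>j<k. e j) * x 0)"
      using x e exp_ge_add_one_self[of "e k"]
      by (intro order.trans[OF step] mult_mono Suc) auto
    then show ?case by (simp add: exp_add ac_simps)
  qed simp
  also have "\<dots> \<le> exp (suminf e) * x 0"
    using x e by (intro mult_right_mono) (auto intro!: sum_le_suminf)
  finally show ?thesis .
qed

text \<open>For \<open>\<nu> = 0\<close> the bound on the new \<open>s\<close> is an arithmetic average of \<open>s\<close> and \<open>1 / r\<close>, and the bound on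
  the new \<open>1 / r\<close> is a harmonic one. Hence \<open>max s (1 / r)\<close> cannot grow, and the noise inflates it by a
  factor of at most \<open>1 + \<eta> \<nu>\<close>. No bound in the opposite direction holds for a single pair; it
  comes from a second pair, in \<open>coupled_scales_converge\<close>.\<close>

lemma coupled_scales_bounded:
  fixes s r \<eta> \<nu> :: "nat \<Rightarrow> real"
  assumes pos: "\<And>k. 0 < s k" "\<And>k. 0 < r k"
    and \<eta>: "\<And>k. 0 \<le> \<eta> k" "\<And>k. \<eta> k \<le> 1"
    and \<nu>: "\<And>k. 0 \<le> \<nu> k" "summable (\<lambda>k. \<eta> k * \<nu> k)"
    and s_step: "\<And>k. s (Suc k) \<le> (1 - \<eta> k) * s k + \<eta> k * ((1 + \<nu> k) / r k)"
    and r_step: "\<And>k. (1 - \<eta> k) * r k + \<eta> k * (1 / (s k * (1 + \<nu> k))) \<le> r (Suc k)"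
  shows "\<exists>c\<ge>1. \<forall>k. s k \<le> c \<and> 1 / c \<le> r k"
proof -
  define E where "E = (\<lambda>k. max (s k) (1 / r k))"
  have "E (Suc k) \<le> (1 + \<eta> k * \<nu> k) * E k" for k
  proof -
    have E: "s k \<le> E k" "1 / r k \<le> E k" "0 < E k"
      using pos by (auto simp: E_def less_max_iff_disj)
    have "s (Suc k) \<le> (1 - \<eta> k) * E k + \<eta> k * ((1 + \<nu> k) * E k)"
      using s_step[of k] \<eta>[of k] \<nu>(1)[of k] E pos
        mult_left_mono[OF E(1), of "1 - \<eta> k"]
        mult_left_mono[OF mult_left_mono[OF E(2), of "1 + \<nu> k"], of "\<eta> k"]
      by auto
    then have 1: "s (Suc k) \<le> (1 + \<eta> k * \<nu> k) * E k" by (simp add: algebra_simps)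
    have q: "0 < 1 + \<nu> k" "0 < 1 + \<eta> k * \<nu> k"
      using \<eta>[of k] \<nu>(1)[of k] by (auto intro!: add_pos_nonneg)
    have rE: "1 / E k \<le> r k" "1 / E k \<le> 1 / s k"
      using E pos[of k] by (auto simp: field_simps)
    have "(1 - \<eta> k) * (1 / E k) + \<eta> k * ((1 / E k) / (1 + \<nu> k)) \<le> r (Suc k)"
      using r_step[of k] \<eta>[of k] q mult_left_mono[OF rE(1), of "1 - \<eta> k"]
        mult_left_mono[OF divide_right_mono[OF rE(2), of "1 + \<nu> k"], of "\<eta> k"] by auto
    moreover have "1 / (1 + \<eta> k * \<nu> k) \<le> (1 - \<eta> k) + \<eta> k / (1 + \<nu> k)"
    proof -
      have "1 + \<nu> k \<le> ((1 - \<eta> k) * (1 + \<nu> k) + \<eta> k) * (1 + \<eta> k * \<nu> k)"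
      proof -
        have "((1 - \<eta> k) * (1 + \<nu> k) + \<eta> k) * (1 + \<eta> k * \<nu> k) - (1 + \<nu> k)
            = \<eta> k * (1 - \<eta> k) * (\<nu> k * \<nu> k)" by (simp add: algebra_simps)
        moreover have "0 \<le> \<eta> k * (1 - \<eta> k) * (\<nu> k * \<nu> k)"
          using \<eta>[of k] \<nu>(1)[of k] by (intro mult_nonneg_nonneg) auto
        ultimately show ?thesis by linarith
      qed
      then show ?thesis using q by (simp add: field_simps)
    qed
    moreover have "(1 - \<eta> k) * (1 / E k) + \<eta> k * ((1 / E k) / (1 + \<nu> k))
        = (1 / E k) * ((1 - \<eta> k) + \<eta> k / (1 + \<nu> k))"
    proof -
      have "(1 - a) * i + a * (i / q) = i * ((1 - a) + a / q)" for a i q :: real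
        by (simp add: algebra_simps)
      then show ?thesis .
    qed
    ultimately have "(1 / E k) * (1 / (1 + \<eta> k * \<nu> k)) \<le> r (Suc k)"
      using mult_left_mono[of "1 / (1 + \<eta> k * \<nu> k)" "(1 - \<eta> k) + \<eta> k / (1 + \<nu> k)" "1 / E k"] E
      by simp
    then have "1 / r (Suc k) \<le> (1 + \<eta> k * \<nu> k) * E k"
    proof -
      define w where "w = 1 + \<eta> k * \<nu> k"
      have "w * E k * ((1 / E k) * (1 / w)) = 1" using q E by (simp add: w_def)
      moreover have "w * E k * ((1 / E k) * (1 / w)) \<le> w * E k * r (Suc k)"
        using \<open>(1 / E k) * (1 / (1 + \<eta> k * \<nu> k)) \<le> r (Suc k)\<close> q E
        by (intro mult_left_mono) (auto simp: w_def)
      ultimately show ?thesis using pos[of "Suc k"] by (simp add: divide_le_eq w_def)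
    qed
    with 1 show ?thesis by (simp add: E_def)
  qed
  then have E: "E k \<le> exp (\<Sum>k. \<eta> k * \<nu> k) * E 0" for k
    using \<eta> \<nu> pos by (intro multiplicative_recursion_bound) (auto simp: E_def le_max_iff_disj less_imp_le)
  define c where "c = max 1 (exp (\<Sum>k. \<eta> k * \<nu> k) * E 0)"
  have "s k \<le> c \<and> 1 / c \<le> r k" for k
  proof -
    have "s k \<le> c" "1 / r k \<le> c" using E[of k] by (auto simp: c_def E_def)
    moreover have "0 < c" by (simp add: c_def)
    ultimately show ?thesis using pos[of k] by (simp add: field_simps)
  qed
  then show ?thesis by (intro exI[of _ c]) (auto simp: c_def)
qed

text \<open>Multiplying the first recursion by \<open>r\<close> and the second by \<open>s\<close> compares both with
  \<open>X = (1 - \<eta>) s r + \<eta>\<close>: without noise, \<open>r s' \<le> X\<close> and \<open>s r' \<ge> X + \<eta> \<kappa> (h - 1)\<close>, so \<open>s / r\<close>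
  decreases by the factor \<open>X / (X + \<eta> \<kappa> (h - 1))\<close>. The bounds by \<open>c\<close> keep \<open>X\<close> between positive
  constants, which turns additive errors into relative ones.\<close>

lemma scale_ratio_step:
  fixes s r s' r' \<eta> \<nu> h c \<kappa> :: real
  assumes c: "1 \<le> c" and s: "1 / c \<le> s" "s \<le> c" and r: "1 / c \<le> r" "r \<le> c"
    and h: "1 \<le> h" "h \<le> c\<^sup>2" and \<kappa>: "0 < \<kappa>" "\<kappa> \<le> 1"
    and \<eta>: "0 \<le> \<eta>" "\<eta> \<le> 1" and \<nu>: "0 \<le> \<nu>" and "0 < r'"
    and s_step: "s' \<le> (1 - \<eta>) * s + \<eta> * ((1 + \<nu>) / r)"
    and r_step: "(1 - \<eta>) * r + \<eta> * ((1 + \<kappa> * (h - 1)) / (s * (1 + \<nu>))) \<le> r'"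
  shows "s' / r' \<le> (s / r) * exp (2 * c^4 * (\<eta> * \<nu>)) / (1 + \<eta> * \<kappa> * (h - 1) / c\<^sup>2)"
proof -
  define X where "X = (1 - \<eta>) * (s * r) + \<eta>"
  define Y where "Y = 1 + \<kappa> * (h - 1)"
  define Z where "Z = (1 - \<eta>) * (s * r) + \<eta> * Y"
  define Z' where "Z' = (1 - \<eta>) * (s * r) + \<eta> * (Y / (1 + \<nu>))"
  have c0: "0 < c" using c by simp
  have pos: "0 < s" "0 < r" using s r c0 by (auto intro: less_le_trans[of 0 "1 / c"])
  have sr: "1 / c\<^sup>2 \<le> s * r" "s * r \<le> c\<^sup>2"
    using mult_mono[OF s(1) r(1)] mult_mono[OF s(2) r(2)] c0 pos by (auto simp: power2_eq_square)
  have c2: "1 / c\<^sup>2 \<le> 1" "1 \<le> c\<^sup>2" using c by (auto simp: field_simps one_le_power)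
  have average_ge: "d \<le> (1 - \<eta>) * p + \<eta> * q" if "d \<le> p" "d \<le> q" for d p q
    using mult_left_mono[OF that(1), of "1 - \<eta>"] mult_left_mono[OF that(2), of \<eta>] \<eta>
    by (simp add: algebra_simps)
  have X: "1 / c\<^sup>2 \<le> X" "X \<le> c\<^sup>2"
    using average_ge[OF sr(1) c2(1)] convex_bound_le[OF sr(2) c2(2), of "1 - \<eta>" \<eta>] \<eta>
    by (auto simp: X_def)
  have Xpos: "0 < X" using X(1) c0 by (auto intro: less_le_trans[of 0 "1 / c\<^sup>2"])
  have Y: "1 \<le> Y" "Y \<le> c\<^sup>2"
    using h \<kappa> mult_right_mono[OF \<kappa>(2), of "h - 1"] by (auto simp: Y_def)
  have XZ: "X \<le> Z" using Y \<eta> mult_left_mono[OF Y(1), of \<eta>] by (auto simp: X_def Z_def)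
  then have Zpos: "0 < Z" using Xpos by simp
  have c4: "c\<^sup>2 \<le> c ^ 4" using c by (intro power_increasing) auto
  have "r * ((1 - \<eta>) * s + \<eta> * ((1 + \<nu>) / r)) = X + \<eta> * \<nu>"
    using pos by (simp add: X_def field_simps)
  then have "r * s' \<le> X + \<eta> * \<nu>"
    using mult_left_mono[OF s_step, of r] pos by simp
  also have "\<dots> \<le> X * (1 + c^4 * (\<eta> * \<nu>))"
  proof -
    have "1 \<le> X * c^4" using mult_mono[OF X(1) c4] c0 Xpos by (simp add: field_simps)
    from mult_right_mono[OF this, of "\<eta> * \<nu>"] \<eta> \<nu> show ?thesis by (simp add: algebra_simps)
  qed
  also have "\<dots> \<le> X * exp (c^4 * (\<eta> * \<nu>))"
    using Xpos by (intro mult_left_mono) auto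
  finally have 1: "r * s' \<le> X * exp (c^4 * (\<eta> * \<nu>))" .
  have 2: "Z \<le> s * r' * exp (c^4 * (\<eta> * \<nu>))"
  proof -
    have \<nu>1: "0 < 1 + \<nu>" using \<nu> by simp
    have "Y \<le> c^4 * Z"
    proof -
      have "1 \<le> c\<^sup>2 * X" using X(1) c0 by (simp add: field_simps)
      also have "\<dots> \<le> c\<^sup>2 * Z" using XZ by (intro mult_left_mono) auto
      finally have "1 \<le> c\<^sup>2 * Z" .
      from mult_mono[OF Y(2) this] show ?thesis using c0 by (simp add: power2_eq_square power4_eq_xxxx ac_simps)
    qed
    also have "\<dots> \<le> c^4 * (Z' * (1 + \<nu>))"
    proof (intro mult_left_mono)
      have "Z' * (1 + \<nu>) = Z + (1 - \<eta>) * (s * r) * \<nu>"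
      proof -
        have "Z' * (1 + \<nu>) = (1 - \<eta>) * (s * r) * (1 + \<nu>) + \<eta> * (Y / (1 + \<nu>) * (1 + \<nu>))"
          unfolding Z'_def by (simp only: distrib_right mult.assoc)
        also have "Y / (1 + \<nu>) * (1 + \<nu>) = Y" using \<nu>1 by simp
        finally show ?thesis by (simp add: Z_def algebra_simps)
      qed
      moreover have "0 \<le> (1 - \<eta>) * (s * r) * \<nu>"
        using \<eta> \<nu> pos by (intro mult_nonneg_nonneg) auto
      ultimately show "Z \<le> Z' * (1 + \<nu>)" by linarith
    qed (use c0 in auto)
    finally have "Y / (1 + \<nu>) \<le> c^4 * Z'" using \<nu>1 by (simp add: field_simps)
    then have "(\<eta> * \<nu>) * (Y / (1 + \<nu>)) \<le> (\<eta> * \<nu>) * (c^4 * Z')"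
      using \<eta> \<nu> by (intro mult_left_mono) auto
    moreover have "Z = Z' + (\<eta> * \<nu>) * (Y / (1 + \<nu>))"
    proof -
      have "Y = Y / (1 + \<nu>) * (1 + \<nu>)" using \<nu>1 by simp
      then have "Z = (1 - \<eta>) * (s * r) + \<eta> * (Y / (1 + \<nu>) * (1 + \<nu>))" by (simp add: Z_def)
      then show ?thesis unfolding Z'_def by (simp only: distrib_left distrib_right ac_simps mult_1_right)
    qed
    ultimately have "Z \<le> Z' * (1 + c^4 * (\<eta> * \<nu>))" by (simp add: algebra_simps)
    also have "\<dots> \<le> Z' * exp (c^4 * (\<eta> * \<nu>))"
      using \<eta> \<nu>1 pos Y by (intro mult_left_mono) (auto simp: Z'_def)
    also have "Z' \<le> s * r'"
    proof -
      have "s * ((1 - \<eta>) * r + \<eta> * ((1 + \<kappa> * (h - 1)) / (s * (1 + \<nu>)))) = Z'"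
      proof -
        have "s * ((1 - \<eta>) * r + \<eta> * (y / (s * q))) = (1 - \<eta>) * (s * r) + \<eta> * (y / q)"
          for y q using pos by (simp add: distrib_left)
        then show ?thesis by (simp add: Z'_def Y_def)
      qed
      then show ?thesis using mult_left_mono[OF r_step, of s] pos by simp
    qed
    finally show ?thesis by simp
  qed
  have 3: "1 + \<eta> * \<kappa> * (h - 1) / c\<^sup>2 \<le> Z / X"
  proof -
    have "\<eta> * \<kappa> * (h - 1) / c\<^sup>2 \<le> \<eta> * \<kappa> * (h - 1) / X"
      using X Xpos \<eta> \<kappa> h c0 by (intro divide_left_mono mult_nonneg_nonneg mult_pos_pos) auto
    moreover have "Z = X + \<eta> * \<kappa> * (h - 1)" by (simp add: Z_def X_def Y_def algebra_simps)
    ultimately show ?thesis using Xpos by (simp add: add_divide_distrib)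
  qed
  have "0 \<le> \<eta> * \<kappa> * (h - 1) / c\<^sup>2" using \<eta> \<kappa> h by auto
  then have q: "0 < 1 + \<eta> * \<kappa> * (h - 1) / c\<^sup>2" by linarith
  define e where "e = exp (c^4 * (\<eta> * \<nu>))"
  have e: "0 < e" "exp (2 * c^4 * (\<eta> * \<nu>)) = e * e"
    by (auto simp: e_def exp_add[symmetric])
  have "s' / r' \<le> (s / r) * (e * e) / (Z / X)"
  proof -
    have "(r * s') * Z \<le> (X * e) * Z" using 1 Zpos by (intro mult_right_mono) (auto simp: e_def)
    also have "\<dots> \<le> (X * e) * (s * r' * e)"
      using 2 Xpos e by (intro mult_left_mono) (auto simp: e_def)
    finally show ?thesis using pos \<open>0 < r'\<close> Zpos Xpos by (simp add: field_simps)
  qed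
  also have "\<dots> \<le> (s / r) * (e * e) / (1 + \<eta> * \<kappa> * (h - 1) / c\<^sup>2)"
    using 3 q pos e Zpos Xpos by (intro divide_left_mono) (auto intro!: mult_pos_pos divide_pos_pos)
  finally show ?thesis by (simp add: e)
qed

text \<open>The two pairs control each other: \<open>r \<le> s'\<close> and \<open>r' \<le> s\<close> supply the missing bounds, and the gap
  of each pair drives the decrease of the other. The logarithm of
  \<open>W = (s / r) (s' / r') = (s / r') (s' / r)\<close> loses, up to the noise, \<open>\<gamma> \<eta>\<close> times the sum of the gaps
  \<open>s / r' - 1\<close> and \<open>s' / r - 1\<close>, and that sum dominates \<open>ln W\<close> itself.\<close>

lemma coupled_scales_converge:
  fixes s r s' r' \<eta> \<nu> :: "nat \<Rightarrow> real" and \<kappa> :: real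
  assumes pos: "\<And>k. 0 < s k" "\<And>k. 0 < r k" "\<And>k. 0 < s' k" "\<And>k. 0 < r' k"
    and le: "\<And>k. r k \<le> s' k" "\<And>k. r' k \<le> s k"
    and \<eta>: "\<And>k. 0 \<le> \<eta> k" "\<And>k. \<eta> k \<le> 1"
    and \<eta>_diverges: "filterlim (\<lambda>N. \<Sum>k<N. \<eta> k) at_top sequentially"
    and \<nu>: "\<And>k. 0 \<le> \<nu> k" "summable (\<lambda>k. \<eta> k * \<nu> k)"
    and \<kappa>: "0 < \<kappa>" "\<kappa> \<le> 1"
    and s_step: "\<And>k. s (Suc k) \<le> (1 - \<eta> k) * s k + \<eta> k * ((1 + \<nu> k) / r k)"
    and r_step: "\<And>k. (1 - \<eta> k) * r k + \<eta> k * ((1 + \<kappa> * (s k / r' k - 1)) / (s k * (1 + \<nu> k))) \<le> r (Suc k)"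
    and s'_step: "\<And>k. s' (Suc k) \<le> (1 - \<eta> k) * s' k + \<eta> k * ((1 + \<nu> k) / r' k)"
    and r'_step: "\<And>k. (1 - \<eta> k) * r' k + \<eta> k * ((1 + \<kappa> * (s' k / r k - 1)) / (s' k * (1 + \<nu> k))) \<le> r' (Suc k)"
  shows "\<exists>c\<ge>1. \<forall>k. 1 / c \<le> s k \<and> s k \<le> c \<and> 1 / c \<le> r k \<and> r k \<le> c
            \<and> 1 / c \<le> s' k \<and> s' k \<le> c \<and> 1 / c \<le> r' k \<and> r' k \<le> c" (is ?bounds)
    and "(\<lambda>k. s k / r' k) \<longlonglongrightarrow> 1" "(\<lambda>k. s' k / r k) \<longlonglongrightarrow> 1"
proof -
  have weaken: "(1 - \<eta> k) * a + \<eta> k * (1 / (b * (1 + \<nu> k))) \<le> d"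
    if "(1 - \<eta> k) * a + \<eta> k * ((1 + \<kappa> * (g - 1)) / (b * (1 + \<nu> k))) \<le> d" "0 < b" "1 \<le> g" for a b d g k
  proof -
    have "0 < b * (1 + \<nu> k)" using that \<nu>(1)[of k] by (auto intro!: mult_pos_pos add_pos_nonneg)
    then have "1 / (b * (1 + \<nu> k)) \<le> (1 + \<kappa> * (g - 1)) / (b * (1 + \<nu> k))"
      using \<kappa> that by (intro divide_right_mono) auto
    from mult_left_mono[OF this, of "\<eta> k"] \<eta>[of k] that show ?thesis by simp
  qed
  have gh: "1 \<le> s k / r' k" "1 \<le> s' k / r k" for k
    using le[of k] pos by (auto simp: field_simps)
  obtain c1 where c1: "c1 \<ge> 1" "\<And>k. s k \<le> c1" "\<And>k. 1 / c1 \<le> r k"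
    using coupled_scales_bounded[of s r \<eta> \<nu>] pos \<eta> \<nu> s_step weaken[OF r_step pos(1) gh(1)] by blast
  obtain c2 where c2: "c2 \<ge> 1" "\<And>k. s' k \<le> c2" "\<And>k. 1 / c2 \<le> r' k"
    using coupled_scales_bounded[of s' r' \<eta> \<nu>] pos \<eta> \<nu> s'_step weaken[OF r'_step pos(3) gh(2)] by blast
  define c where "c = max c1 c2"
  have c: "c \<ge> 1" "c1 \<le> c" "c2 \<le> c" using c1 c2 by (auto simp: c_def)
  have ci: "1 / c \<le> 1 / c1" "1 / c \<le> 1 / c2" using c c1(1) c2(1) by (auto simp: field_simps)
  have b: "1 / c \<le> s k" "s k \<le> c" "1 / c \<le> r k" "r k \<le> c"
    "1 / c \<le> s' k" "s' k \<le> c" "1 / c \<le> r' k" "r' k \<le> c" for k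
    using c1(2,3)[of k] c2(2,3)[of k] ci c le[of k] by linarith+
  then show ?bounds using c by blast
  define W where "W = (\<lambda>k. (s k / r k) * (s' k / r' k))"
  define \<gamma> where "\<gamma> = \<kappa> / (2 * c\<^sup>2)"
  have c0: "0 < c" using c by simp
  have "1 \<le> c\<^sup>2" using c by (simp add: one_le_power)
  then have "\<kappa> \<le> 2 * c\<^sup>2" using \<kappa> by linarith
  then have \<gamma>: "0 < \<gamma>" "\<gamma> \<le> 1" using \<kappa> c by (auto simp: \<gamma>_def)
  have quot: "a / b \<le> c\<^sup>2" if "a \<le> c" "1 / c \<le> b" "0 < a" for a b
  proof -
    have "0 < b" using that c0 by (auto intro: less_le_trans[of 0 "1 / c"])
    then have "a / b \<le> c / (1 / c)" using that c0 by (intro frac_le) auto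
    then show ?thesis by (simp add: power2_eq_square)
  qed
  have Wpos: "0 < W k" for k using pos by (auto simp: W_def)
  have Wgh: "W k = (s k / r' k) * (s' k / r k)" for k by (simp add: W_def)
  have W1: "1 \<le> W k" for k using mult_mono[OF gh(1)[of k] gh(2)[of k]] gh[of k] by (simp add: Wgh)
  have ln_step: "ln (W (Suc k)) \<le> (1 - \<gamma> * \<eta> k) * ln (W k) + 0 + 4 * c^4 * (\<eta> k * \<nu> k)" for k
  proof -
    define g h where "g = s' k / r k" and "h = s k / r' k"
    have g: "1 \<le> g" "g \<le> c\<^sup>2" and h: "1 \<le> h" "h \<le> c\<^sup>2"
      using gh[of k] quot b pos by (auto simp: g_def h_def)
    define A where "A = (\<lambda>g. \<eta> k * \<kappa> * (g - 1) / c\<^sup>2)"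
    define e where "e = exp (2 * c^4 * (\<eta> k * \<nu> k))"
    have A: "0 \<le> A q" "A q \<le> 1" if "1 \<le> q" "q \<le> c\<^sup>2" for q
    proof -
      show "0 \<le> A q" using \<eta> \<kappa> that by (auto simp: A_def)
      have "\<eta> k * \<kappa> \<le> 1 * 1" using \<eta> \<kappa> by (intro mult_mono) auto
      from mult_mono[OF this, of "q - 1" "q - 1"] that have "\<eta> k * \<kappa> * (q - 1) \<le> c\<^sup>2" by auto
      then show "A q \<le> 1" using c0 by (simp add: A_def)
    qed
    have "s (Suc k) / r (Suc k) \<le> (s k / r k) * e / (1 + A h)"
      unfolding e_def A_def
      by (rule scale_ratio_step) (use b c h \<kappa> \<eta> \<nu> pos s_step[of k] r_step[of k] in \<open>auto simp: h_def\<close>)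
    moreover have "s' (Suc k) / r' (Suc k) \<le> (s' k / r' k) * e / (1 + A g)"
      unfolding e_def A_def
      by (rule scale_ratio_step) (use b c g \<kappa> \<eta> \<nu> pos s'_step[of k] r'_step[of k] in \<open>auto simp: g_def\<close>)
    ultimately have "W (Suc k) \<le> ((s k / r k) * e / (1 + A h)) * ((s' k / r' k) * e / (1 + A g))"
      unfolding W_def using pos[of "Suc k"] A[OF h] pos[of k]
      by (intro mult_mono) (auto simp: e_def less_imp_le)
    also have "\<dots> = W k * (e * e) / ((1 + A h) * (1 + A g))"
      by (simp only: W_def times_divide_eq_left times_divide_eq_right divide_divide_eq_left ac_simps)
    finally have "ln (W (Suc k)) \<le> ln (W k * (e * e) / ((1 + A h) * (1 + A g)))"
      using Wpos[of "Suc k"] by (intro ln_mono) auto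
    also have "\<dots> = ln (W k) + 4 * c^4 * (\<eta> k * \<nu> k) - ln (1 + A h) - ln (1 + A g)"
    proof -
      have "0 < 1 + A h" "0 < 1 + A g" "0 < e" using A[OF h] A[OF g] by (auto simp: e_def)
      then have "ln (W k * (e * e) / ((1 + A h) * (1 + A g)))
        = ln (W k) + (ln e + ln e) - (ln (1 + A h) + ln (1 + A g))"
        using Wpos[of k] by (simp add: ln_mult ln_div)
      then show ?thesis by (simp add: e_def)
    qed
    \<comment> \<open>\<open>A \<le> 1\<close>, so \<open>ln (1 + A)\<close> is at least half of \<open>A\<close>.\<close>
    also have "\<dots> \<le> ln (W k) + 4 * c^4 * (\<eta> k * \<nu> k) - (A h / 2 + A g / 2)"
    proof -
      have "A q / 2 \<le> ln (1 + A q)" if "1 \<le> q" "q \<le> c\<^sup>2" for q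
      proof -
        have a: "0 \<le> A q" "A q \<le> 1" using A[OF that] by auto
        have "- ln (1 + A q) = ln (1 / (1 + A q))" using a by (simp add: ln_div)
        also have "\<dots> \<le> 1 / (1 + A q) - 1" using a by (intro ln_le_minus_one) auto
        also have "\<dots> \<le> - (A q / 2)" using a mult_left_mono[OF a(2) a(1)] by (simp add: field_simps)
        finally show ?thesis by simp
      qed
      from this[OF g] this[OF h] show ?thesis by linarith
    qed
    also have "A h / 2 + A g / 2 = \<gamma> * \<eta> k * ((h - 1) + (g - 1))"
      using c0 by (simp add: A_def \<gamma>_def field_simps)
    finally have "ln (W (Suc k))
      \<le> ln (W k) + 4 * c^4 * (\<eta> k * \<nu> k) - \<gamma> * \<eta> k * ((h - 1) + (g - 1))" .
    moreover have "\<gamma> * \<eta> k * ln (W k) \<le> \<gamma> * \<eta> k * ((h - 1) + (g - 1))"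
    proof -
      have "W k = h * g" by (simp only: Wgh g_def h_def)
      then have "ln (W k) = ln h + ln g" using g(1) h(1) by (simp add: ln_mult)
      also have "\<dots> \<le> (h - 1) + (g - 1)" using g h by (intro add_mono ln_le_minus_one) auto
      finally show ?thesis using \<gamma> \<eta> by (intro mult_left_mono) auto
    qed
    ultimately show ?thesis by (simp add: algebra_simps)
  qed
  have "filterlim (\<lambda>N. \<gamma> * (\<Sum>k<N. \<eta> k)) at_top sequentially"
    using \<gamma> by (intro filterlim_tendsto_pos_mult_at_top[OF tendsto_const _ \<eta>_diverges])
  then have \<gamma>_diverges: "filterlim (\<lambda>N. \<Sum>k<N. \<gamma> * \<eta> k) at_top sequentially"
    by (simp add: sum_distrib_left)
  have lnW: "(\<lambda>k. ln (W k)) \<longlonglongrightarrow> 0"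
  proof (rule affine_recursion_tendsto_zero[where h = "\<lambda>k. \<gamma> * \<eta> k" and \<xi> = "\<lambda>_. 0"
          and e = "\<lambda>k. 4 * c^4 * (\<eta> k * \<nu> k)"])
    show "\<gamma> * \<eta> k \<le> 1" for k using \<gamma> \<eta>[of k] by (intro mult_le_one) auto
    show "0 \<le> ln (W k)" for k using W1 by (rule ln_ge_zero)
    show "summable (\<lambda>k. 4 * c^4 * (\<eta> k * \<nu> k))" by (rule summable_mult[OF \<nu>(2)])
    show "ln (W (Suc k)) \<le> (1 - \<gamma> * \<eta> k) * ln (W k) + \<gamma> * \<eta> k * 0 + 4 * c^4 * (\<eta> k * \<nu> k)" for k
      using ln_step[of k] by simp
  qed (use \<gamma> \<eta> \<nu>(1) \<gamma>_diverges in auto)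
  have "(\<lambda>k. exp (ln (W k))) \<longlonglongrightarrow> exp 0" using lnW by (intro tendsto_exp)
  then have W: "W \<longlonglongrightarrow> 1" using Wpos by simp
  have "s k / r' k \<le> W k" "s' k / r k \<le> W k" for k
    using mult_left_mono[OF gh(2)[of k], of "s k / r' k"] mult_right_mono[OF gh(1)[of k], of "s' k / r k"]
      gh[of k] unfolding Wgh by linarith+
  then show "(\<lambda>k. s k / r' k) \<longlonglongrightarrow> 1" "(\<lambda>k. s' k / r k) \<longlonglongrightarrow> 1"
    using gh by (blast intro: tendsto_sandwich[OF _ _ tendsto_const W] always_eventually)+
qed

section \<open>Log-Lipschitz functions and their means\<close>

text \<open>Positivity of \<open>h\<close> and an \<open>L\<close>-Lipschitz logarithm. In this multiplicative form the property passes to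
  positive combinations and integrals with the same \<open>L\<close>, hence from the kernel to all iterates, and
  on a bounded space it bounds \<open>h z / h z'\<close> independently of the size of \<open>h\<close>.\<close>

definition log_lipschitz :: "real \<Rightarrow> ('a::metric_space \<Rightarrow> real) \<Rightarrow> bool" where
  "log_lipschitz L h \<longleftrightarrow> (\<forall>z. 0 < h z) \<and> (\<forall>z z'. h z \<le> exp (L * dist z z') * h z')"

lemma log_lipschitzD:
  assumes "log_lipschitz L h"
  shows "0 < h z" "h z \<le> exp (L * dist z z') * h z'"
  using assms by (auto simp: log_lipschitz_def)

lemma log_lipschitz_ln_diff:
  assumes "log_lipschitz L h"
  shows "\<bar>ln (h z) - ln (h z')\<bar> \<le> L * dist z z'"
proof -
  have "ln (h z) \<le> L * dist z z' + ln (h z')" for z z'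
  proof -
    have "ln (h z) \<le> ln (exp (L * dist z z') * h z')"
      using log_lipschitzD[OF assms] by (intro ln_mono) auto
    also have "\<dots> = L * dist z z' + ln (h z')"
      using log_lipschitzD(1)[OF assms, of z'] by (subst ln_mult) auto
    finally show ?thesis .
  qed
  from this[of z z'] this[of z' z] show ?thesis by (simp add: dist_commute abs_le_iff)
qed

lemma log_lipschitz_continuous:
  assumes "log_lipschitz L h" "0 \<le> L"
  shows "continuous_on UNIV h"
proof -
  have "L-lipschitz_on UNIV (\<lambda>z. ln (h z))"
    using log_lipschitz_ln_diff[OF assms(1)] assms(2) by (auto intro!: lipschitz_onI simp: dist_real_def)
  then have "continuous_on UNIV (\<lambda>z. exp (ln (h z)))"
    by (intro continuous_on_exp lipschitz_on_continuous_on)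
  then show ?thesis using log_lipschitzD(1)[OF assms(1)] by simp
qed

lemma log_lipschitz_cmult:
  assumes "log_lipschitz L h" "0 < c"
  shows "log_lipschitz L (\<lambda>z. c * h z)"
  unfolding log_lipschitz_def
proof (intro conjI allI)
  fix z z'
  show "c * h z \<le> exp (L * dist z z') * (c * h z')"
    using mult_left_mono[OF log_lipschitzD(2)[OF assms(1), of z z'], of c] assms(2) by (simp add: ac_simps)
qed (use log_lipschitzD(1)[OF assms(1)] assms(2) in auto)

lemma log_lipschitz_add:
  assumes "log_lipschitz L h" "log_lipschitz L h'"
  shows "log_lipschitz L (\<lambda>z. h z + h' z)"
  unfolding log_lipschitz_def
proof (intro conjI allI)
  fix z z'
  show "h z + h' z \<le> exp (L * dist z z') * (h z' + h' z')"
    using log_lipschitzD(2)[OF assms(1), of z z'] log_lipschitzD(2)[OF assms(2), of z z']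
    unfolding distrib_left by linarith
qed (use log_lipschitzD(1) assms in \<open>auto intro: add_pos_pos\<close>)

lemma log_lipschitz_convex_combination:
  assumes "log_lipschitz L h" "log_lipschitz L h'" "0 \<le> t" "t \<le> 1"
  shows "log_lipschitz L (\<lambda>z. (1 - t) * h z + t * h' z)"
proof -
  consider "t = 0" | "t = 1" | "0 < t" "t < 1" using assms(3,4) by linarith
  then show ?thesis
  proof cases
    case 3
    then show ?thesis using assms by (intro log_lipschitz_add log_lipschitz_cmult) auto
  qed (use assms in auto)
qed

lemma log_lipschitz_sum:
  assumes "finite J" "J \<noteq> {}" "\<And>i. i \<in> J \<Longrightarrow> log_lipschitz L (h i)"
  shows "log_lipschitz L (\<lambda>z. \<Sum>i\<in>J. h i z)"
  using assms by (induction J rule: finite_ne_induct) (auto intro: log_lipschitz_add)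

lemma log_lipschitz_divide:
  assumes "log_lipschitz L h" "log_lipschitz L' h'"
  shows "log_lipschitz (L + L') (\<lambda>z. h z / h' z)"
  unfolding log_lipschitz_def
proof (intro conjI allI)
  fix z z'
  have pos: "0 < h z" "0 < h' z" "0 < h z'" "0 < h' z'" using log_lipschitzD(1) assms by auto
  have "h z * h' z' \<le> (exp (L * dist z z') * h z') * (exp (L' * dist z z') * h' z)"
    using log_lipschitzD(2)[OF assms(1), of z z'] log_lipschitzD(2)[OF assms(2), of z' z] pos
    by (intro mult_mono) (auto simp: dist_commute)
  also have "\<dots> = (exp ((L + L') * dist z z') * h z') * h' z"
    by (simp add: exp_add distrib_right)
  finally show "h z / h' z \<le> exp ((L + L') * dist z z') * (h z' / h' z')"
    using pos by (simp add: divide_simps)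
qed (use log_lipschitzD(1)[OF assms(1)] log_lipschitzD(1)[OF assms(2)] in auto)

lemma continuous_on_one_over_pos:
  fixes h :: "'a::topological_space \<Rightarrow> real"
  assumes "continuous_on UNIV h" "\<And>z. 0 < h z"
  shows "continuous_on UNIV (\<lambda>z. 1 / h z)"
proof (intro continuous_on_divide continuous_on_const assms(1) ballI)
  show "h z \<noteq> 0" for z using assms(2)[of z] by simp
qed

locale compact_prob_space = prob_space \<mu> for \<mu> :: "'a::metric_space measure" +
  assumes compact_UNIV: "compact (UNIV :: 'a set)"
    and sets_borel [measurable_cong]: "sets \<mu> = sets borel"
begin

lemma continuous_integrable:
  fixes h :: "'a \<Rightarrow> real"
  assumes "continuous_on UNIV h"
  shows "integrable \<mu> h"
proof -
  have "bounded (range h)"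
    using compact_continuous_image[OF assms compact_UNIV] by (rule compact_imp_bounded)
  then obtain c where "\<And>z. norm (h z) \<le> c" by (auto simp: bounded_iff)
  moreover have "h \<in> borel_measurable \<mu>"
    using borel_measurable_continuous_onI[OF assms] by (simp cong: measurable_cong_sets)
  ultimately show ?thesis by (intro integrable_const_bound[where B = c]) auto
qed

lemma integral_pos:
  fixes h :: "'a \<Rightarrow> real"
  assumes "continuous_on UNIV h" "\<And>z. 0 < h z"
  shows "0 < (\<integral>z. h z \<partial>\<mu>)"
proof -
  obtain z0 where z0: "\<And>z. h z0 \<le> h z"
    using continuous_attains_inf[OF compact_UNIV _ assms(1)] by auto
  have "0 < h z0" by (rule assms)
  also have "h z0 = (\<integral>z. h z0 \<partial>\<mu>)" by (simp add: prob_space)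
  also have "\<dots> \<le> (\<integral>z. h z \<partial>\<mu>)"
    using z0 by (intro integral_mono continuous_integrable assms) auto
  finally show ?thesis .
qed

text \<open>With \<open>m\<close> the mean of \<open>h\<close>, this is the integral of \<open>2 \<le> h / m + m / h\<close>.\<close>

lemma mean_times_mean_inverse:
  fixes h :: "'a \<Rightarrow> real"
  assumes "continuous_on UNIV h" "\<And>z. 0 < h z"
  shows "1 \<le> (\<integral>z. h z \<partial>\<mu>) * (\<integral>z. 1 / h z \<partial>\<mu>)"
proof -
  define m where "m = (\<integral>z. h z \<partial>\<mu>)"
  have m: "0 < m" unfolding m_def by (intro integral_pos assms)
  have int: "integrable \<mu> h" "integrable \<mu> (\<lambda>z. 1 / h z)"
    using assms by (auto intro!: continuous_integrable continuous_on_one_over_pos)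
  have "2 = (\<integral>z. (2::real) \<partial>\<mu>)" by (simp add: prob_space)
  also have "\<dots> \<le> (\<integral>z. h z / m + m * (1 / h z) \<partial>\<mu>)"
  proof (rule integral_mono)
    fix z
    have "0 \<le> (h z - m)\<^sup>2 / (h z * m)" using assms(2)[of z] m by simp
    then show "2 \<le> h z / m + m * (1 / h z)"
      using assms(2)[of z] m by (simp add: field_simps power2_eq_square)
  qed (intro Bochner_Integration.integrable_add integrable_divide integrable_mult_right int integrable_const)+
  also have "\<dots> = m / m + m * (\<integral>z. 1 / h z \<partial>\<mu>)"
  proof -
    have "(\<integral>z. h z / m + m * i z \<partial>\<mu>) = m / m + m * (\<integral>z. i z \<partial>\<mu>)"
      if "integrable \<mu> i" for i :: "'a \<Rightarrow> real"
      using that int(1) by (simp add: m_def)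
    from this[OF int(2)] show ?thesis .
  qed
  finally show ?thesis using m by (simp add: m_def)
qed

text \<open>The Cauchy-Schwarz inequality
  \<open>((1 - t) F + t G)\<^sup>2 \<le> ((1 - t) f + t h) ((1 - t) F\<^sup>2 / f + t G\<^sup>2 / h)\<close>, applied at each point with the
  harmonic means \<open>F\<close>, \<open>G\<close> of \<open>f\<close>, \<open>h\<close>, bounds the integrand by one whose integral is explicit.\<close>

lemma harmonic_mean_concave:
  fixes f h :: "'a \<Rightarrow> real"
  assumes "continuous_on UNIV f" "\<And>z. 0 < f z" "continuous_on UNIV h" "\<And>z. 0 < h z"
    and t: "0 \<le> t" "t \<le> 1"
  shows "(1 - t) * (1 / (\<integral>z. 1 / f z \<partial>\<mu>)) + t * (1 / (\<integral>z. 1 / h z \<partial>\<mu>))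
    \<le> 1 / (\<integral>z. 1 / ((1 - t) * f z + t * h z) \<partial>\<mu>)"
proof -
  define F where "F = 1 / (\<integral>z. 1 / f z \<partial>\<mu>)"
  define G where "G = 1 / (\<integral>z. 1 / h z \<partial>\<mu>)"
  define H where "H = (1 - t) * F + t * G"
  have cont: "continuous_on UNIV (\<lambda>z. 1 / f z)" "continuous_on UNIV (\<lambda>z. 1 / h z)"
    using assms by (auto intro!: continuous_on_one_over_pos)
  have FG: "0 < F" "0 < G" unfolding F_def G_def
    using assms integral_pos[OF cont(1)] integral_pos[OF cont(2)] by auto
  have comb: "0 < (1 - t) * a + t * b" if "0 < a" "0 < b" for a b :: real
  proof -
    have "0 < min a b" using that by simp
    also have "min a b = (1 - t) * min a b + t * min a b" by (simp add: algebra_simps)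
    also have "\<dots> \<le> (1 - t) * a + t * b" using t by (intro add_mono mult_left_mono) auto
    finally show ?thesis .
  qed
  have H: "0 < H" unfolding H_def by (rule comb[OF FG])
  have pos: "0 < (1 - t) * f z + t * h z" for z using comb assms by simp
  have cont3: "continuous_on UNIV (\<lambda>z. 1 / ((1 - t) * f z + t * h z))"
    using pos assms by (intro continuous_on_one_over_pos continuous_intros)
  have "(\<integral>z. 1 / ((1 - t) * f z + t * h z) \<partial>\<mu>)
      \<le> (\<integral>z. ((1 - t) * F\<^sup>2 * (1 / f z) + t * G\<^sup>2 * (1 / h z)) / H\<^sup>2 \<partial>\<mu>)"
  proof (rule integral_mono)
    fix z
    have fh: "0 < f z" "0 < h z" using assms by auto
    \<comment> \<open>Lagrange's identity behind Cauchy-Schwarz.\<close>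
    have "H\<^sup>2 + (1 - t) * t * ((F * h z - G * f z)\<^sup>2 / (f z * h z))
        = ((1 - t) * f z + t * h z) * ((1 - t) * F\<^sup>2 * (1 / f z) + t * G\<^sup>2 * (1 / h z))"
      using fh by (simp add: H_def field_simps power2_eq_square)
    moreover have "0 \<le> (1 - t) * t * ((F * h z - G * f z)\<^sup>2 / (f z * h z))"
      using t fh by simp
    ultimately have "H\<^sup>2 \<le> ((1 - t) * f z + t * h z) * ((1 - t) * F\<^sup>2 * (1 / f z) + t * G\<^sup>2 * (1 / h z))"
      by linarith
    then show "1 / ((1 - t) * f z + t * h z) \<le> ((1 - t) * F\<^sup>2 * (1 / f z) + t * G\<^sup>2 * (1 / h z)) / H\<^sup>2"
      using H pos[of z] by (simp add: divide_le_eq pos_le_divide_eq mult.commute)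
  qed (intro continuous_integrable cont3 continuous_intros cont; use H in simp)+
  also have "\<dots> = ((1 - t) * F\<^sup>2 * (\<integral>z. 1 / f z \<partial>\<mu>) + t * G\<^sup>2 * (\<integral>z. 1 / h z \<partial>\<mu>)) / H\<^sup>2"
  proof -
    have "(\<integral>z. ((1 - t) * F\<^sup>2 * i z + t * G\<^sup>2 * j z) / H\<^sup>2 \<partial>\<mu>)
        = ((1 - t) * F\<^sup>2 * (\<integral>z. i z \<partial>\<mu>) + t * G\<^sup>2 * (\<integral>z. j z \<partial>\<mu>)) / H\<^sup>2"
      if "integrable \<mu> i" "integrable \<mu> j" for i j :: "'a \<Rightarrow> real"
      using that by simp
    from this[OF continuous_integrable[OF cont(1)] continuous_integrable[OF cont(2)]] show ?thesis .
  qed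
  also have "(\<integral>z. 1 / f z \<partial>\<mu>) = 1 / F" by (simp add: F_def)
  also have "(\<integral>z. 1 / h z \<partial>\<mu>) = 1 / G" by (simp add: G_def)
  also have "((1 - t) * F\<^sup>2 * (1 / F) + t * G\<^sup>2 * (1 / G)) / H\<^sup>2 = 1 / H"
    using FG H by (simp add: H_def[symmetric] power2_eq_square)
  finally have "(\<integral>z. 1 / ((1 - t) * f z + t * h z) \<partial>\<mu>) \<le> 1 / H" .
  then show ?thesis unfolding F_def[symmetric] G_def[symmetric] H_def[symmetric]
    using H integral_pos[OF cont3] pos by (simp add: field_simps)
qed

text \<open>Cauchy-Schwarz for \<open>\<bar>h - m\<bar> = sqrt h * (\<bar>h - m\<bar> / sqrt h)\<close>, since the integral of \<open>(h - m)\<^sup>2 / h\<close> is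
  \<open>m (m \<integral> (1 / h) - 1)\<close>. So a product of the means of \<open>h\<close> and \<open>1 / h\<close> close to one forces \<open>h\<close> close to
  its mean.\<close>

lemma mean_absolute_deviation:
  fixes h :: "'a \<Rightarrow> real"
  assumes "continuous_on UNIV h" "\<And>z. 0 < h z"
  defines "m \<equiv> \<integral>z. h z \<partial>\<mu>"
  shows "(\<integral>z. \<bar>h z - m\<bar> \<partial>\<mu>) \<le> m * sqrt (m * (\<integral>z. 1 / h z \<partial>\<mu>) - 1)"
proof -
  have m: "0 < m" unfolding m_def by (intro integral_pos assms(1,2))
  have cont: "continuous_on UNIV (\<lambda>z. 1 / h z)" "continuous_on UNIV (\<lambda>z. \<bar>h z - m\<bar>)"
    using assms(1,2) by (auto intro!: continuous_on_one_over_pos continuous_intros)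
  note int = continuous_integrable[OF assms(1)] continuous_integrable[OF cont(1)] continuous_integrable[OF cont(2)]
  define q where "q = (\<integral>z. \<bar>h z - m\<bar> \<partial>\<mu>)"
  define I where "I = (\<integral>z. 1 / h z \<partial>\<mu>)"
  \<comment> \<open>The minimiser over \<open>t\<close> of the integral of \<open>h (\<bar>h - m\<bar> / h - t)\<^sup>2\<close>.\<close>
  define t where "t = q / m"
  have "0 \<le> (\<integral>z. h z * (\<bar>h z - m\<bar> / h z - t)\<^sup>2 \<partial>\<mu>)"
    using assms(2) by (intro Bochner_Integration.integral_nonneg) (auto simp: less_imp_le)
  also have "\<dots> = (\<integral>z. h z - 2 * m + m\<^sup>2 * (1 / h z) - 2 * t * \<bar>h z - m\<bar> + t\<^sup>2 * h z \<partial>\<mu>)"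
  proof (rule Bochner_Integration.integral_cong[OF refl])
    fix z
    define d where "d = \<bar>h z - m\<bar>"
    have "d * d = (h z - m) * (h z - m)" by (simp add: d_def)
    then have d: "d * d = h z * h z - 2 * m * h z + m * m" by (simp add: algebra_simps)
    have "h z * (d / h z - t)\<^sup>2 = d * d / h z - 2 * t * d + t\<^sup>2 * h z"
      using assms(2)[of z] by (simp add: field_simps power2_eq_square)
    then show "h z * (d / h z - t)\<^sup>2 = h z - 2 * m + m\<^sup>2 * (1 / h z) - 2 * t * d + t\<^sup>2 * h z"
      using assms(2)[of z] unfolding d by (simp add: field_simps power2_eq_square)
  qed
  also have "\<dots> = m - 2 * m + m\<^sup>2 * I - 2 * t * q + t\<^sup>2 * m"
  proof -
    have "(\<integral>z. h z - 2 * m + m\<^sup>2 * i z - 2 * t * d z + t\<^sup>2 * h z \<partial>\<mu>)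
        = m - 2 * m + m\<^sup>2 * (\<integral>z. i z \<partial>\<mu>) - 2 * t * (\<integral>z. d z \<partial>\<mu>) + t\<^sup>2 * m"
      if "integrable \<mu> i" "integrable \<mu> d" for i d
      using that int(1) by (simp add: m_def prob_space)
    from this[OF int(2,3)] show ?thesis unfolding q_def I_def .
  qed
  also have "\<dots> = m * (m * I - 1) - q\<^sup>2 / m"
    using m by (simp add: t_def field_simps power2_eq_square)
  finally have "q\<^sup>2 / m \<le> m * (m * I - 1)" by simp
  then have "q\<^sup>2 \<le> m\<^sup>2 * (m * I - 1)"
    using m by (simp add: divide_le_eq power2_eq_square ac_simps)
  then have "q \<le> sqrt (m\<^sup>2 * (m * I - 1))" by (rule real_le_rsqrt)
  then show ?thesis using m by (simp add: q_def I_def real_sqrt_mult)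
qed

end

lemma log_lipschitz_integral:
  assumes "compact_prob_space \<mu>" "\<And>y. log_lipschitz L (\<lambda>z. K z y)" "\<And>z. continuous_on UNIV (K z)"
  shows "log_lipschitz L (\<lambda>z. \<integral>y. K z y \<partial>\<mu>)"
proof -
  interpret compact_prob_space \<mu> by fact
  have "(\<integral>y. K z y \<partial>\<mu>) \<le> (\<integral>y. exp (L * dist z z') * K z' y \<partial>\<mu>)" for z z'
    using log_lipschitzD[OF assms(2)] assms(3)
    by (intro integral_mono continuous_integrable continuous_intros) auto
  then show ?thesis unfolding log_lipschitz_def
    using integral_pos[OF assms(3)] log_lipschitzD(1)[OF assms(2)] by auto
qed

section \<open>The Markov kernel of the optimal coupling\<close>

text \<open>\<open>K\<close> stands for \<open>exp (- C)\<close>, and \<open>astar\<close>, \<open>bstar\<close> for \<open>exp (- f)\<close>, \<open>exp (- g)\<close> at the optimal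
  potentials. The assumptions are invariant under exchanging \<open>\<alpha>\<close> with \<open>\<beta>\<close> and \<open>astar\<close> with \<open>bstar\<close>, so
  that each statement about the update of \<open>a\<close> also covers the update of \<open>b\<close>. \<open>R\<close> bounds the
  oscillation of every quotient of two \<open>L\<close>-log-Lipschitz functions.\<close>

locale sinkhorn_kernel = A: compact_prob_space \<alpha> + B: compact_prob_space \<beta>
  for \<alpha> \<beta> :: "'a::metric_space measure" +
  fixes K :: "'a \<Rightarrow> 'a \<Rightarrow> real" and astar bstar :: "'a \<Rightarrow> real" and L R :: real
  assumes L_nonneg: "0 \<le> L"
    and K_sym: "K z y = K y z"
    and K_log_lipschitz: "log_lipschitz L (\<lambda>z. K z y)"
    and K_measurable: "(\<lambda>(z, y). K z y) \<in> borel_measurable (borel \<Otimes>\<^sub>M borel)"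
    and astar_log_lipschitz: "log_lipschitz L astar"
    and bstar_log_lipschitz: "log_lipschitz L bstar"
    and astar_eq: "astar z = (\<integral>y. K z y / bstar y \<partial>\<beta>)"
    and bstar_eq: "bstar z = (\<integral>y. K z y / astar y \<partial>\<alpha>)"
    and R_bound: "exp (2 * L * dist z z') \<le> R"
begin

lemma swap: "sinkhorn_kernel \<beta> \<alpha> K bstar astar L R"
  by (intro sinkhorn_kernel.intro sinkhorn_kernel_axioms.intro A.compact_prob_space_axioms
      B.compact_prob_space_axioms L_nonneg K_sym K_log_lipschitz K_measurable
      astar_log_lipschitz bstar_log_lipschitz astar_eq bstar_eq R_bound)

lemma R_ge_1: "1 \<le> R"
  using R_bound[of undefined undefined] by simp

lemma oscillation_bound:
  fixes h :: "'a \<Rightarrow> real"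
  assumes "log_lipschitz (2 * L) h"
  shows "h z \<le> R * h z'"
proof -
  have "h z \<le> exp (2 * L * dist z z') * h z'" by (rule log_lipschitzD(2)[OF assms])
  also have "\<dots> \<le> R * h z'"
    using R_bound[of z z'] log_lipschitzD(1)[OF assms, of z'] by (intro mult_right_mono) auto
  finally show ?thesis .
qed

lemma continuous_2L: "log_lipschitz (2 * L) h \<Longrightarrow> continuous_on UNIV h"
  using L_nonneg by (auto intro: log_lipschitz_continuous[where L = "2 * L"])

lemma continuous_L: "log_lipschitz L h \<Longrightarrow> continuous_on UNIV h"
  using L_nonneg by (intro log_lipschitz_continuous) auto

lemma quotient_2L: "log_lipschitz L f \<Longrightarrow> log_lipschitz L h \<Longrightarrow> log_lipschitz (2 * L) (\<lambda>z. f z / h z)"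
  using log_lipschitz_divide[of L f L h] by simp

lemma mean_comparable:
  assumes "log_lipschitz (2 * L) h"
  shows "h z \<le> R * (\<integral>y. h y \<partial>\<beta>)" "(\<integral>y. h y \<partial>\<beta>) \<le> R * h z"
proof -
  have int: "integrable \<beta> h" by (intro B.continuous_integrable continuous_2L assms)
  have "h z = (\<integral>y. h z \<partial>\<beta>)" by (simp add: B.prob_space)
  also have "\<dots> \<le> (\<integral>y. R * h y \<partial>\<beta>)"
    using int by (intro integral_mono oscillation_bound assms) auto
  finally show "h z \<le> R * (\<integral>y. h y \<partial>\<beta>)" by simp
  have "(\<integral>y. h y \<partial>\<beta>) \<le> (\<integral>y. R * h z \<partial>\<beta>)"
    using int by (intro integral_mono oscillation_bound assms) auto
  then show "(\<integral>y. h y \<partial>\<beta>) \<le> R * h z" by (simp add: B.prob_space)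
qed

text \<open>The density of the optimal coupling with respect to \<open>\<alpha> \<Otimes>\<^sub>M \<beta>\<close>.\<close>

definition p :: "'a \<Rightarrow> 'a \<Rightarrow> real" where
  "p z y = K z y / (astar z * bstar y)"

text \<open>The conditional expectation of \<open>\<phi>\<close> at the second coordinate, given the first, under the optimal
  coupling.\<close>

definition P :: "('a \<Rightarrow> real) \<Rightarrow> 'a \<Rightarrow> real" where
  "P \<phi> z = (\<integral>y. p z y * \<phi> y \<partial>\<beta>)"

lemma star_pos: "0 < astar z" "0 < bstar z"
  using log_lipschitzD(1) astar_log_lipschitz bstar_log_lipschitz by auto

lemma p_pos: "0 < p z y"
  using log_lipschitzD(1)[OF K_log_lipschitz] star_pos by (simp add: p_def)

lemma p_log_lipschitz: "log_lipschitz (2 * L) (\<lambda>z. p z y)" "log_lipschitz (2 * L) (p z)"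
proof -
  have "log_lipschitz (2 * L) (\<lambda>z. (1 / bstar y) * (K z y / astar z))"
    using star_pos by (intro log_lipschitz_cmult quotient_2L K_log_lipschitz astar_log_lipschitz) auto
  then show "log_lipschitz (2 * L) (\<lambda>z. p z y)" by (simp add: p_def mult.commute)
  have "log_lipschitz (2 * L) (\<lambda>y. (1 / astar z) * (K y z / bstar y))"
    using star_pos by (intro log_lipschitz_cmult quotient_2L K_log_lipschitz bstar_log_lipschitz) auto
  then have "log_lipschitz (2 * L) (\<lambda>y. p z y)" by (simp add: p_def K_sym[of z])
  then show "log_lipschitz (2 * L) (p z)" .
qed

lemma p_mean_right: "(\<integral>y. p z y \<partial>\<beta>) = 1"
proof -
  have "(\<integral>y. p z y \<partial>\<beta>) = (\<integral>y. (1 / astar z) * (K z y / bstar y) \<partial>\<beta>)" by (simp add: p_def)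
  also have "\<dots> = (1 / astar z) * astar z" by (subst integral_mult_right_zero) (simp add: astar_eq[symmetric])
  finally show ?thesis using star_pos(1)[of z] by simp
qed

lemma p_mean_left: "(\<integral>z. p z y \<partial>\<alpha>) = 1"
proof -
  have "(\<integral>z. p z y \<partial>\<alpha>) = (\<integral>z. (1 / bstar y) * (K y z / astar z) \<partial>\<alpha>)"
    by (simp add: p_def K_sym[of y] mult.commute)
  also have "\<dots> = (1 / bstar y) * bstar y" by (subst integral_mult_right_zero) (simp add: bstar_eq[symmetric])
  finally show ?thesis using star_pos(2)[of y] by simp
qed

lemma p_bounds: "p z y \<le> R" "1 / R \<le> p z y"
  using mean_comparable[OF p_log_lipschitz(2), of z y] R_ge_1
  by (auto simp: p_mean_right divide_le_eq mult.commute)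

lemma p_phi_integrable: "continuous_on UNIV \<phi> \<Longrightarrow> integrable \<beta> (\<lambda>y. p z y * \<phi> y)"
  by (intro B.continuous_integrable continuous_intros continuous_2L[OF p_log_lipschitz(2)])

lemma P_pos_log_lipschitz:
  assumes "continuous_on UNIV \<phi>" "\<And>y. 0 < \<phi> y"
  shows "log_lipschitz (2 * L) (P \<phi>)"
proof -
  have "log_lipschitz (2 * L) (\<lambda>z. \<integral>y. \<phi> y * p z y \<partial>\<beta>)"
    using assms
    by (intro log_lipschitz_integral B.compact_prob_space_axioms log_lipschitz_cmult
        p_log_lipschitz continuous_intros continuous_2L[OF p_log_lipschitz(2)]) auto
  then show ?thesis by (simp add: P_def[abs_def] mult.commute)
qed

lemma P_pos: "continuous_on UNIV \<phi> \<Longrightarrow> (\<And>y. 0 < \<phi> y) \<Longrightarrow> 0 < P \<phi> z"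
  using log_lipschitzD(1)[OF P_pos_log_lipschitz] by auto

lemma P_bounds:
  assumes "continuous_on UNIV \<phi>" "\<And>y. 0 < \<phi> y"
  shows "P \<phi> z \<le> R * (\<integral>y. \<phi> y \<partial>\<beta>)" "(1 / R) * (\<integral>y. \<phi> y \<partial>\<beta>) \<le> P \<phi> z"
proof -
  have int: "integrable \<beta> \<phi>" "integrable \<beta> (\<lambda>y. p z y * \<phi> y)"
    using assms by (auto intro: B.continuous_integrable p_phi_integrable)
  have "P \<phi> z \<le> (\<integral>y. R * \<phi> y \<partial>\<beta>)" unfolding P_def
    using int p_bounds assms(2) by (intro integral_mono mult_right_mono) (auto intro: less_imp_le)
  then show "P \<phi> z \<le> R * (\<integral>y. \<phi> y \<partial>\<beta>)" by simp
  have "(\<integral>y. (1 / R) * \<phi> y \<partial>\<beta>) \<le> P \<phi> z" unfolding P_def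
    using int p_bounds assms(2) by (intro integral_mono mult_right_mono) (auto intro: less_imp_le)
  then show "(1 / R) * (\<integral>y. \<phi> y \<partial>\<beta>) \<le> P \<phi> z" by simp
qed

text \<open>A Markov operator with density at most \<open>R\<close> smooths: smallness of \<open>\<phi> - m\<close> in mean becomes smallness of
  \<open>P \<phi> - m\<close> at every point.\<close>

lemma P_deviation:
  assumes "continuous_on UNIV \<phi>" "\<And>y. 0 < \<phi> y"
  defines "m \<equiv> \<integral>y. \<phi> y \<partial>\<beta>"
  shows "\<bar>P \<phi> z - m\<bar> \<le> R * (m * sqrt (m * (\<integral>y. 1 / \<phi> y \<partial>\<beta>) - 1))"
proof -
  have int: "integrable \<beta> (\<lambda>y. \<bar>\<phi> y - m\<bar>)" "integrable \<beta> (\<lambda>y. p z y * \<bar>\<phi> y - m\<bar>)"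
    using assms(1) by (auto intro!: B.continuous_integrable p_phi_integrable continuous_intros)
  have pint: "integrable \<beta> (\<lambda>y. p z y)"
    by (intro B.continuous_integrable continuous_2L p_log_lipschitz)
  have "P \<phi> z - m = (\<integral>y. p z y * (\<phi> y - m) \<partial>\<beta>)"
    using p_phi_integrable[OF assms(1)] pint by (simp add: P_def right_diff_distrib p_mean_right)
  then have "\<bar>P \<phi> z - m\<bar> \<le> (\<integral>y. \<bar>p z y * (\<phi> y - m)\<bar> \<partial>\<beta>)"
    using integral_abs_bound by metis
  also have "\<dots> \<le> (\<integral>y. R * \<bar>\<phi> y - m\<bar> \<partial>\<beta>)"
  proof (rule integral_mono)
    fix y
    show "\<bar>p z y * (\<phi> y - m)\<bar> \<le> R * \<bar>\<phi> y - m\<bar>"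
      using p_bounds(1)[of z y] p_pos[of z y] by (simp add: abs_mult mult_right_mono)
  qed (use int p_pos in \<open>auto simp: abs_mult less_imp_le\<close>)
  also have "\<dots> \<le> R * (m * sqrt (m * (\<integral>y. 1 / \<phi> y \<partial>\<beta>) - 1))"
    using R_ge_1 B.mean_absolute_deviation[OF assms(1,2)] by (simp add: m_def)
  finally show ?thesis .
qed

text \<open>The first marginal of the optimal coupling is \<open>\<alpha>\<close> and the second is \<open>\<beta>\<close>.\<close>

lemma P_mean:
  assumes "continuous_on UNIV \<phi>" "\<And>y. 0 < \<phi> y"
  shows "(\<integral>z. P \<phi> z \<partial>\<alpha>) = (\<integral>y. \<phi> y \<partial>\<beta>)"
proof -
  interpret pair_prob_space \<alpha> \<beta> ..
  have [measurable]: "(\<lambda>x. K (fst x) (snd x)) \<in> borel_measurable (borel \<Otimes>\<^sub>M borel)"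
    using K_measurable by (simp add: case_prod_beta')
  have [measurable]: "astar \<in> borel_measurable borel" "bstar \<in> borel_measurable borel"
    "\<phi> \<in> borel_measurable borel"
    using assms(1) continuous_L astar_log_lipschitz bstar_log_lipschitz
    by (auto intro!: borel_measurable_continuous_onI)
  obtain c where c: "\<And>y. \<bar>\<phi> y\<bar> \<le> c"
    using compact_imp_bounded[OF compact_continuous_image[OF assms(1) A.compact_UNIV]]
    by (auto simp: bounded_iff)
  have "integrable (\<alpha> \<Otimes>\<^sub>M \<beta>) (\<lambda>(z, y). p z y * \<phi> y)"
  proof (rule P.integrable_const_bound[where B = "R * c"])
    show "AE x in \<alpha> \<Otimes>\<^sub>M \<beta>. norm (case x of (z, y) \<Rightarrow> p z y * \<phi> y) \<le> R * c"
      using p_bounds p_pos c R_ge_1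
      by (auto intro!: AE_I2 mult_mono simp: abs_mult less_imp_le)
    show "(\<lambda>(z, y). p z y * \<phi> y) \<in> borel_measurable (\<alpha> \<Otimes>\<^sub>M \<beta>)"
      unfolding p_def case_prod_beta' by measurable
  qed
  from Fubini_integral[OF this]
  have "(\<integral>z. P \<phi> z \<partial>\<alpha>) = (\<integral>y. (\<integral>z. p z y * \<phi> y \<partial>\<alpha>) \<partial>\<beta>)" by (simp add: P_def)
  also have "\<dots> = (\<integral>y. \<phi> y \<partial>\<beta>)" by (simp add: p_mean_left)
  finally show ?thesis .
qed

text \<open>A quantitative Jensen inequality. For every \<open>t > 0\<close> the function \<open>t \<phi> + 1 / (t \<phi>) - 2\<close> is nonnegative,
  so its average under \<open>p z\<close> is at least \<open>1 / R\<close> times its \<open>\<beta>\<close>-average. The best \<open>t\<close> yields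
  \<open>sqrt (P \<phi> P (1 / \<phi>)) - 1 \<ge> (sqrt (\<integral> \<phi> \<integral> (1 / \<phi>)) - 1) / R\<close>. This gap makes the
  Lyapunov function decrease.\<close>

lemma P_gap:
  assumes "continuous_on UNIV \<phi>" "\<And>y. 0 < \<phi> y"
  shows "1 + (1 / R\<^sup>2) * ((\<integral>y. \<phi> y \<partial>\<beta>) * (\<integral>y. 1 / \<phi> y \<partial>\<beta>) - 1)
    \<le> P \<phi> z * P (\<lambda>y. 1 / \<phi> y) z"
proof -
  define s where "s = (\<integral>y. \<phi> y \<partial>\<beta>)"
  define m where "m = (\<integral>y. 1 / \<phi> y \<partial>\<beta>)"
  define a where "a = P \<phi> z"
  define b where "b = P (\<lambda>y. 1 / \<phi> y) z"
  have cont: "continuous_on UNIV (\<lambda>y. 1 / \<phi> y)"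
    by (intro continuous_on_one_over_pos assms)
  have pos: "0 < s" "0 < m" "0 < a" "0 < b"
    unfolding s_def m_def a_def b_def using assms
    by (auto intro!: B.integral_pos P_pos cont)
  \<comment> \<open>The minimiser of \<open>t a + b / t\<close>, at which both terms equal \<open>sqrt (a b)\<close>.\<close>
  define t where "t = sqrt (b / a)"
  have t: "0 < t" using pos by (simp add: t_def)
  have int: "integrable \<beta> \<phi>" "integrable \<beta> (\<lambda>y. 1 / \<phi> y)" "integrable \<beta> (\<lambda>y. p z y)"
    "integrable \<beta> (\<lambda>y. p z y * \<phi> y)" "integrable \<beta> (\<lambda>y. p z y * (1 / \<phi> y))"
    by (intro B.continuous_integrable p_phi_integrable assms cont continuous_2L p_log_lipschitz)+
  have "(1 / R) * (t * s + m / t - 2) = (\<integral>y. (1 / R) * (t * \<phi> y + (1 / t) * (1 / \<phi> y) - 2) \<partial>\<beta>)"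
  proof -
    have "(\<integral>y. (1 / R) * (t * \<phi> y + (1 / t) * i y - 2) \<partial>\<beta>)
        = (1 / R) * (t * s + (1 / t) * (\<integral>y. i y \<partial>\<beta>) - 2)" if "integrable \<beta> i" for i :: "'a \<Rightarrow> real"
      using that int(1) by (simp add: s_def B.prob_space)
    from this[OF int(2)] show ?thesis unfolding m_def by (simp only: times_divide_eq_left mult_1_left)
  qed
  also have "\<dots> \<le> (\<integral>y. p z y * (t * \<phi> y + (1 / t) * (1 / \<phi> y) - 2) \<partial>\<beta>)"
  proof (rule integral_mono)
    fix y
    have "0 \<le> (t * \<phi> y - 1)\<^sup>2 / (t * \<phi> y)" using t assms(2)[of y] by simp
    also have "\<dots> = t * \<phi> y + (1 / t) * (1 / \<phi> y) - 2"
      using t assms(2)[of y] by (simp add: field_simps power2_eq_square)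
    finally show "(1 / R) * (t * \<phi> y + (1 / t) * (1 / \<phi> y) - 2)
        \<le> p z y * (t * \<phi> y + (1 / t) * (1 / \<phi> y) - 2)"
      by (intro mult_right_mono p_bounds)
  qed (intro B.continuous_integrable p_phi_integrable continuous_intros assms cont)+
  also have "\<dots> = t * a + b / t - 2"
  proof -
    have "(\<integral>y. p z y * (t * \<phi> y + (1 / t) * i y - 2) \<partial>\<beta>)
        = t * (\<integral>y. p z y * \<phi> y \<partial>\<beta>) + (1 / t) * (\<integral>y. p z y * i y \<partial>\<beta>) - 2"
      if "integrable \<beta> (\<lambda>y. p z y * i y)" for i :: "'a \<Rightarrow> real"
    proof -
      have "(\<integral>y. p z y * (t * \<phi> y + (1 / t) * i y - 2) \<partial>\<beta>)
        = (\<integral>y. t * (p z y * \<phi> y) + (1 / t) * (p z y * i y) - 2 * p z y \<partial>\<beta>)"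
        by (intro Bochner_Integration.integral_cong refl) (simp add: algebra_simps)
      then show ?thesis using that int(3,4) by (simp add: p_mean_right)
    qed
    from this[OF int(5)] show ?thesis by (simp add: a_def b_def P_def)
  qed
  finally have gap: "(1 / R) * (t * s + m / t - 2) \<le> t * a + b / t - 2" .
  define G where "G = sqrt (a * b)"
  define g where "g = sqrt (s * m)"
  have tt: "t * t = b / a" using pos by (simp add: t_def)
  have "t * a = G" "b / t = G"
  proof -
    show "t * a = G" unfolding G_def
      by (rule real_sqrt_unique[symmetric]) (use t pos tt in \<open>auto simp: power2_eq_square field_simps\<close>)
    then have "b / t * t = G * t" using t pos tt by (auto simp: field_simps)
    then show "b / t = G" using t by simp
  qed
  moreover have "2 * g \<le> t * s + m / t"
  proof -
    have "sqrt ((t * s) * (m / t)) \<le> (t * s + m / t) / 2"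
      using t pos by (intro arith_geo_mean_sqrt) auto
    then show ?thesis using t by (simp add: g_def)
  qed
  moreover from this have "(1 / R) * (2 * g - 2) \<le> (1 / R) * (t * s + m / t - 2)"
    using R_ge_1 by (intro mult_left_mono) auto
  ultimately have "(1 / R) * (2 * g - 2) \<le> 2 * G - 2"
    using gap by linarith
  then have "1 + (g - 1) / R \<le> G" by (simp add: diff_divide_distrib)
  moreover have "1 \<le> s * m" unfolding s_def m_def by (intro B.mean_times_mean_inverse assms)
  then have g: "1 \<le> g" "g\<^sup>2 = s * m" by (auto simp: g_def)
  ultimately have "(1 + (g - 1) / R)\<^sup>2 \<le> G\<^sup>2"
    using R_ge_1 by (intro power_mono) auto
  also have "\<dots> = a * b" using pos by (simp add: G_def)
  finally have 1: "(1 + (g - 1) / R)\<^sup>2 \<le> a * b" .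
  have "1 + (1 / R\<^sup>2) * (g\<^sup>2 - 1) \<le> (1 + (g - 1) / R)\<^sup>2"
  proof -
    have "(g - 1) / R\<^sup>2 \<le> (g - 1) / R"
      using R_ge_1 g by (intro divide_left_mono) (auto simp: power2_eq_square)
    moreover have "(1 + (g - 1) / R)\<^sup>2 = 1 + 2 * ((g - 1) / R) + (g - 1)\<^sup>2 / R\<^sup>2"
      by (simp add: power2_sum power_divide)
    moreover have "1 + (1 / R\<^sup>2) * (g\<^sup>2 - 1) = 1 + 2 * ((g - 1) / R\<^sup>2) + (g - 1)\<^sup>2 / R\<^sup>2"
      by (simp add: power2_eq_square algebra_simps diff_divide_distrib add_divide_distrib)
    ultimately show ?thesis by linarith
  qed
  with 1 g show ?thesis by (simp add: s_def m_def a_def b_def)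
qed

text \<open>Since \<open>P\<close> preserves means, the error is the mean of \<open>P (1 / v) \<rho>\<close>, and \<open>P (1 / v) \<le> R m\<close>.\<close>

lemma noisy_mean_step:
  assumes "continuous_on UNIV v" "\<And>y. 0 < v y" "continuous_on UNIV \<rho>"
  defines "m \<equiv> \<integral>y. 1 / v y \<partial>\<beta>"
  shows "\<bar>(\<integral>z. P (\<lambda>y. 1 / v y) z * (1 + \<rho> z) \<partial>\<alpha>) - m\<bar> \<le> R * m * (\<integral>z. \<bar>\<rho> z\<bar> \<partial>\<alpha>)"
proof -
  let ?\<phi> = "\<lambda>y. 1 / v y"
  have \<phi>: "continuous_on UNIV ?\<phi>" "\<And>y. 0 < ?\<phi> y"
    using continuous_on_one_over_pos[OF assms(1)] assms(2) by auto
  have Pcont: "continuous_on UNIV (P ?\<phi>)" by (intro continuous_2L P_pos_log_lipschitz \<phi>)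
  have int: "integrable \<alpha> (P ?\<phi>)" "integrable \<alpha> (\<lambda>z. P ?\<phi> z * \<rho> z)"
    "integrable \<alpha> (\<lambda>z. \<bar>P ?\<phi> z * \<rho> z\<bar>)" "integrable \<alpha> (\<lambda>z. R * m * \<bar>\<rho> z\<bar>)"
    by (intro A.continuous_integrable continuous_intros Pcont assms)+
  have "(\<integral>z. P ?\<phi> z * (1 + \<rho> z) \<partial>\<alpha>) = (\<integral>z. P ?\<phi> z \<partial>\<alpha>) + (\<integral>z. P ?\<phi> z * \<rho> z \<partial>\<alpha>)"
    unfolding distrib_left using int by simp
  then have "\<bar>(\<integral>z. P ?\<phi> z * (1 + \<rho> z) \<partial>\<alpha>) - m\<bar> = \<bar>\<integral>z. P ?\<phi> z * \<rho> z \<partial>\<alpha>\<bar>"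
    unfolding P_mean[OF \<phi>] m_def by simp
  also have "\<dots> \<le> (\<integral>z. \<bar>P ?\<phi> z * \<rho> z\<bar> \<partial>\<alpha>)" by (rule integral_abs_bound)
  also have "\<dots> \<le> (\<integral>z. R * m * \<bar>\<rho> z\<bar> \<partial>\<alpha>)"
  proof (rule integral_mono)
    fix z
    show "\<bar>P ?\<phi> z * \<rho> z\<bar> \<le> R * m * \<bar>\<rho> z\<bar>"
      using P_bounds(1)[OF \<phi>, of z] P_pos[OF \<phi>, of z]
      by (simp add: abs_mult m_def mult_right_mono)
  qed (use int in auto)
  finally show ?thesis by simp
qed

text \<open>For \<open>\<rho> = 0\<close>, \<open>P_gap\<close> bounds \<open>1 / P (1 / v)\<close> by \<open>P v\<close> divided by the gap factor, and \<open>P v\<close> has mean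
  \<open>s\<close>; concavity of the harmonic mean handles the combination with \<open>u\<close>. The lower bound on \<open>1 + \<rho>\<close>
  makes the perturbation of the reciprocal linear in \<open>\<bar>\<rho>\<bar>\<close>.\<close>

lemma noisy_harmonic_step:
  assumes "continuous_on UNIV v" "\<And>y. 0 < v y" "continuous_on UNIV u" "\<And>y. 0 < u y"
    and \<rho>: "continuous_on UNIV \<rho>" "\<And>z. 1 / R \<le> 1 + \<rho> z" and t: "0 \<le> t" "t \<le> 1"
  defines "m \<equiv> \<integral>y. 1 / v y \<partial>\<beta>" and "s \<equiv> \<integral>y. v y \<partial>\<beta>"
  shows "(1 - t) * (1 / (\<integral>z. 1 / u z \<partial>\<alpha>))
      + t * ((1 + (1 / R\<^sup>2) * (s * m - 1)) / (s * (1 + R\<^sup>2 * (\<integral>z. \<bar>\<rho> z\<bar> \<partial>\<alpha>))))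
    \<le> 1 / (\<integral>z. 1 / ((1 - t) * u z + t * (P (\<lambda>y. 1 / v y) z * (1 + \<rho> z))) \<partial>\<alpha>)"
proof -
  let ?\<phi> = "\<lambda>y. 1 / v y"
  define N where "N = (\<integral>z. \<bar>\<rho> z\<bar> \<partial>\<alpha>)"
  have \<phi>: "continuous_on UNIV ?\<phi>" "\<And>y. 0 < ?\<phi> y"
    using continuous_on_one_over_pos[OF assms(1)] assms(2) by auto
  have Pcont: "continuous_on UNIV (P ?\<phi>)" by (intro continuous_2L P_pos_log_lipschitz \<phi>)
  have \<rho>_pos: "0 < 1 + \<rho> z" for z
    using \<rho>(2)[of z] R_ge_1 by (auto intro: less_le_trans[of 0 "1 / R"])
  define h where "h = (\<lambda>z. P ?\<phi> z * (1 + \<rho> z))"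
  have h: "continuous_on UNIV h" "\<And>z. 0 < h z"
    using \<rho>_pos P_pos[OF \<phi>] by (auto simp: h_def intro!: continuous_intros Pcont \<rho>)
  have pos: "0 < m" "0 < s" unfolding m_def s_def using \<phi> assms(1,2) by (auto intro!: B.integral_pos)
  define \<Gamma> where "\<Gamma> = 1 + (1 / R\<^sup>2) * (s * m - 1)"
  have sm: "1 \<le> s * m" unfolding s_def m_def by (intro B.mean_times_mean_inverse assms)
  have R2: "1 \<le> R\<^sup>2" using R_ge_1 by (simp add: one_le_power)
  have \<Gamma>: "1 \<le> \<Gamma>" "\<Gamma> \<le> s * m"
  proof -
    show "1 \<le> \<Gamma>" using sm R2 by (simp add: \<Gamma>_def)
    have "(s * m - 1) / R\<^sup>2 \<le> (s * m - 1) / 1" using sm R2 by (intro divide_left_mono) auto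
    then show "\<Gamma> \<le> s * m" by (simp add: \<Gamma>_def)
  qed
  have N: "0 \<le> N" by (simp add: N_def)
  have cont: "continuous_on UNIV (\<lambda>z. 1 / h z)" by (intro continuous_on_one_over_pos h)
  have vcont: "continuous_on UNIV (P v)" by (intro continuous_2L P_pos_log_lipschitz assms)
  have "(\<integral>z. 1 / h z \<partial>\<alpha>) \<le> (\<integral>z. P v z / \<Gamma> + (R\<^sup>2 / m) * \<bar>\<rho> z\<bar> \<partial>\<alpha>)"
  proof (rule integral_mono)
    fix z
    have Pz: "0 < P ?\<phi> z" "0 < P v z" using P_pos[OF \<phi>] P_pos[OF assms(1,2)] by auto
    have "\<Gamma> \<le> P v z * P ?\<phi> z" unfolding \<Gamma>_def s_def m_def by (rule P_gap[OF assms(1,2)])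
    then have 1: "1 / P ?\<phi> z \<le> P v z / \<Gamma>" using Pz \<Gamma> by (simp add: divide_simps mult.commute)
    have 2: "1 / P ?\<phi> z \<le> R / m"
      using P_bounds(2)[OF \<phi>, of z] Pz pos R_ge_1 by (simp add: m_def divide_simps mult.commute)
    have "1 / (1 + \<rho> z) \<le> 1 + R * \<bar>\<rho> z\<bar>"
    proof -
      have "1 / (1 + \<rho> z) = 1 + (- \<rho> z) / (1 + \<rho> z)" using \<rho>_pos[of z] by (simp add: divide_simps)
      moreover have "(- \<rho> z) / (1 + \<rho> z) \<le> \<bar>\<rho> z\<bar> / (1 + \<rho> z)"
        using \<rho>_pos[of z] by (intro divide_right_mono) auto
      moreover have "\<bar>\<rho> z\<bar> / (1 + \<rho> z) \<le> \<bar>\<rho> z\<bar> / (1 / R)"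
        using \<rho>_pos[of z] \<rho>(2)[of z] R_ge_1 by (intro divide_left_mono) auto
      ultimately show ?thesis by (simp add: mult.commute)
    qed
    then have "1 / h z \<le> (1 / P ?\<phi> z) * (1 + R * \<bar>\<rho> z\<bar>)"
      unfolding h_def using Pz mult_left_mono[of "1 / (1 + \<rho> z)" "1 + R * \<bar>\<rho> z\<bar>" "1 / P ?\<phi> z"] by simp
    also have "\<dots> = 1 / P ?\<phi> z + (1 / P ?\<phi> z) * (R * \<bar>\<rho> z\<bar>)" by (simp add: distrib_left)
    also have "\<dots> \<le> P v z / \<Gamma> + (R / m) * (R * \<bar>\<rho> z\<bar>)"
      using 1 2 R_ge_1 by (intro add_mono mult_right_mono) auto
    finally show "1 / h z \<le> P v z / \<Gamma> + (R\<^sup>2 / m) * \<bar>\<rho> z\<bar>" by (simp add: power2_eq_square)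
  qed (intro A.continuous_integrable continuous_intros cont vcont \<rho>; use \<Gamma> in simp)+
  also have "\<dots> = s / \<Gamma> + (R\<^sup>2 / m) * N"
  proof -
    have "integrable \<alpha> (P v)" "integrable \<alpha> (\<lambda>z. \<bar>\<rho> z\<bar>)"
      by (intro A.continuous_integrable continuous_intros vcont \<rho>)+
    then show ?thesis using P_mean[OF assms(1,2)] by (simp add: s_def N_def)
  qed
  also have "\<dots> \<le> s / \<Gamma> + (R\<^sup>2 * N) * (s / \<Gamma>)"
  proof -
    have "1 / m \<le> s / \<Gamma>" using \<Gamma> pos by (simp add: divide_simps)
    from mult_left_mono[OF this, of "R\<^sup>2 * N"] N show ?thesis by simp
  qed
  also have "\<dots> = (s / \<Gamma>) * (1 + R\<^sup>2 * N)" by (simp add: algebra_simps)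
  finally have "(\<integral>z. 1 / h z \<partial>\<alpha>) \<le> (s / \<Gamma>) * (1 + R\<^sup>2 * N)" .
  moreover have "0 < (\<integral>z. 1 / h z \<partial>\<alpha>)" using h by (intro A.integral_pos cont) auto
  moreover have "0 < (s / \<Gamma>) * (1 + R\<^sup>2 * N)" using pos \<Gamma> N by (intro mult_pos_pos add_pos_nonneg) auto
  ultimately have "1 / ((s / \<Gamma>) * (1 + R\<^sup>2 * N)) \<le> 1 / (\<integral>z. 1 / h z \<partial>\<alpha>)"
    by - (rule divide_left_mono[OF _ zero_le_one mult_pos_pos])
  then have "\<Gamma> / (s * (1 + R\<^sup>2 * N)) \<le> 1 / (\<integral>z. 1 / h z \<partial>\<alpha>)" by simp
  then have "(1 - t) * (1 / (\<integral>z. 1 / u z \<partial>\<alpha>)) + t * (\<Gamma> / (s * (1 + R\<^sup>2 * N)))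
    \<le> (1 - t) * (1 / (\<integral>z. 1 / u z \<partial>\<alpha>)) + t * (1 / (\<integral>z. 1 / h z \<partial>\<alpha>))"
    using t by (intro add_left_mono mult_left_mono)
  also have "\<dots> \<le> 1 / (\<integral>z. 1 / ((1 - t) * u z + t * h z) \<partial>\<alpha>)"
    by (intro A.harmonic_mean_concave assms h)
  finally show ?thesis by (simp only: h_def \<Gamma>_def N_def)
qed

end

section \<open>Convergence under summable relative errors\<close>

lemma var_norm_le:
  assumes "\<And>z. \<bar>h z - c\<bar> \<le> e"
  shows "0 \<le> var_norm h" "var_norm h \<le> 2 * e"
proof -
  have b: "c - e \<le> h z" "h z \<le> c + e" for z using assms[of z] by (auto simp: abs_le_iff)
  have bdd: "bdd_above (range h)" "bdd_below (range h)"
    using b by (auto intro!: bdd_aboveI2[of _ h "c + e"] bdd_belowI2[of _ "c - e" h])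
  have "(INF x. h x) \<le> h undefined" "h undefined \<le> (SUP x. h x)"
    using bdd by (auto intro: cINF_lower cSUP_upper)
  then show "0 \<le> var_norm h" by (simp add: var_norm_def)
  have "(SUP x. h x) \<le> c + e" "c - e \<le> (INF x. h x)"
    using b by (auto intro: cSUP_least cINF_greatest)
  then show "var_norm h \<le> 2 * e" by (simp add: var_norm_def)
qed

text \<open>The functions \<open>ln (u k)\<close> share a Lipschitz constant and the space is compact, so closeness of
  \<open>ln (u k)\<close> to the number \<open>ln (s k)\<close> on a finite net inside \<open>D\<close> extends to all points.\<close>

lemma var_norm_ln_tendsto_zero:
  fixes u :: "nat \<Rightarrow> 'a::metric_space \<Rightarrow> real"
  assumes cpt: "compact (UNIV :: 'a set)" and dense: "\<And>z e. 0 < e \<Longrightarrow> \<exists>d\<in>D. dist z d < e"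
    and L: "0 \<le> L" and u: "\<And>k. log_lipschitz L (u k)"
    and conv: "\<And>d. d \<in> D \<Longrightarrow> (\<lambda>k. u k d / s k) \<longlonglongrightarrow> 1" and s: "\<And>k. 0 < s k"
  shows "(\<lambda>k. var_norm (\<lambda>z. ln (u k z))) \<longlonglongrightarrow> 0"
proof (rule LIMSEQ_I)
  fix r :: real assume r: "0 < r"
  define \<delta> where "\<delta> = r / (8 * (L + 1))"
  have \<delta>: "0 < \<delta>" "L * \<delta> \<le> r / 8"
    using r L by (auto simp: \<delta>_def field_simps)
  have "UNIV \<subseteq> (\<Union>d\<in>D. ball d \<delta>)" using dense[OF \<delta>(1)] by (auto simp: dist_commute)
  then obtain F where F: "F \<subseteq> D" "finite F" "UNIV \<subseteq> (\<Union>d\<in>F. ball d \<delta>)"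
    using compactE_image[OF cpt, of D "\<lambda>d. ball d \<delta>"] by auto
  have u0: "0 < u k z" for k z using log_lipschitzD(1)[OF u] .
  have "\<forall>\<^sub>F k in sequentially. \<forall>d\<in>F. \<bar>ln (u k d) - ln (s k)\<bar> < r / 8"
  proof (intro eventually_ball_finite F(2) ballI)
    fix d assume "d \<in> F"
    then have "(\<lambda>k. ln (u k d / s k)) \<longlonglongrightarrow> ln 1" using F(1) by (intro tendsto_ln conv) auto
    then have "(\<lambda>k. ln (u k d) - ln (s k)) \<longlonglongrightarrow> 0" by (simp only: ln_divide_pos[OF u0 s] ln_one)
    from tendstoD[OF this, of "r / 8"] r
    show "\<forall>\<^sub>F k in sequentially. \<bar>ln (u k d) - ln (s k)\<bar> < r / 8" by (simp add: dist_real_def)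
  qed
  then obtain T where T: "\<And>k d. k \<ge> T \<Longrightarrow> d \<in> F \<Longrightarrow> \<bar>ln (u k d) - ln (s k)\<bar> < r / 8"
    unfolding eventually_sequentially by blast
  have "norm (var_norm (\<lambda>z. ln (u k z)) - 0) < r" if "k \<ge> T" for k
  proof -
    have "\<bar>ln (u k z) - ln (s k)\<bar> \<le> r / 4" for z
    proof -
      obtain d where d: "d \<in> F" "dist z d < \<delta>" using subsetD[OF F(3) UNIV_I, of z] by (auto simp: dist_commute)
      have "\<bar>ln (u k z) - ln (u k d)\<bar> \<le> L * dist z d" by (rule log_lipschitz_ln_diff[OF u])
      also have "\<dots> \<le> L * \<delta>" using d L by (intro mult_left_mono) auto
      finally show ?thesis using T[OF that d(1)] \<delta>(2) by linarith
    qed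
    from var_norm_le[of "\<lambda>z. ln (u k z)", OF this] r show ?thesis by simp
  qed
  then show "\<exists>no. \<forall>k\<ge>no. norm (var_norm (\<lambda>z. ln (u k z)) - 0) < r" by blast
qed

context sinkhorn_kernel
begin

definition relative_error :: "('a \<Rightarrow> real) \<Rightarrow> ('a \<Rightarrow> real) \<Rightarrow> 'a \<Rightarrow> real" where
  "relative_error ahat b z = ahat z / (\<integral>y. K z y / b y \<partial>\<beta>) - 1"

lemma summand_log_lipschitz:
  assumes "log_lipschitz L b"
  shows "log_lipschitz (2 * L) (\<lambda>y. K z y / b y)"
  using quotient_2L[OF K_log_lipschitz[of z] assms] by (simp add: K_sym[of _ z])

text \<open>The exact soft transform is the operator \<open>P\<close> after division by the optimal functions.\<close>

lemma exact_step_P: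
  "(\<integral>y. K z y / b y \<partial>\<beta>) = astar z * P (\<lambda>y. 1 / (b y / bstar y)) z"
proof -
  have "K z y / b y = astar z * (p z y * (1 / (b y / bstar y)))" for y
    using star_pos(1)[of z] star_pos(2)[of y] by (simp add: p_def)
  then show ?thesis unfolding P_def by (subst integral_mult_right_zero[symmetric]) (simp only:)
qed

lemma exact_step_log_lipschitz:
  assumes "log_lipschitz L b"
  shows "log_lipschitz L (\<lambda>z. \<integral>y. K z y / b y \<partial>\<beta>)"
proof (rule log_lipschitz_integral[OF B.compact_prob_space_axioms])
  show "log_lipschitz L (\<lambda>z. K z y / b y)" for y
    using log_lipschitz_cmult[OF K_log_lipschitz, of "1 / b y" y] log_lipschitzD(1)[OF assms, of y]
    by simp
  show "continuous_on UNIV (\<lambda>y. K z y / b y)" for z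
    by (intro continuous_2L summand_log_lipschitz assms)
qed

lemma continuous_relative_error:
  assumes "log_lipschitz L ahat" "log_lipschitz L b"
  shows "continuous_on UNIV (relative_error ahat b)"
  unfolding relative_error_def
  by (intro continuous_intros continuous_2L quotient_2L exact_step_log_lipschitz assms)

text \<open>One update in the unknowns \<open>u\<close>, \<open>v\<close>. The first two parts are the recursions for \<open>\<integral> u d\<alpha>\<close> and for the
  harmonic mean of \<open>u\<close>; the last says that \<open>u z\<close> relaxes towards the same target \<open>m\<close> as
  \<open>\<integral> u d\<alpha>\<close> at every point, up to the deviation of \<open>1 / v\<close> from constancy.\<close>

lemma ratio_step:
  fixes a ahat b :: "'a \<Rightarrow> real" and t :: real
  assumes ll: "log_lipschitz L a" "log_lipschitz L b" "log_lipschitz L ahat"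
    and err: "\<And>z. 1 / R \<le> 1 + relative_error ahat b z" and t: "0 \<le> t" "t \<le> 1"
  defines "u \<equiv> \<lambda>z. a z / astar z" and "v \<equiv> \<lambda>y. b y / bstar y"
    and "u' \<equiv> \<lambda>z. ((1 - t) * a z + t * ahat z) / astar z"
    and "N \<equiv> \<integral>z. \<bar>relative_error ahat b z\<bar> \<partial>\<alpha>"
  defines "m \<equiv> \<integral>y. 1 / v y \<partial>\<beta>"
  shows "\<bar>(\<integral>z. u' z \<partial>\<alpha>) - ((1 - t) * (\<integral>z. u z \<partial>\<alpha>) + t * m)\<bar> \<le> t * (R * m * N)"
    and "(1 - t) * (1 / (\<integral>z. 1 / u z \<partial>\<alpha>))
      + t * ((1 + (1 / R\<^sup>2) * ((\<integral>y. v y \<partial>\<beta>) * m - 1)) / ((\<integral>y. v y \<partial>\<beta>) * (1 + R\<^sup>2 * N)))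
      \<le> 1 / (\<integral>z. 1 / u' z \<partial>\<alpha>)"
    and "\<bar>u' z - ((1 - t) * u z + t * m)\<bar>
      \<le> t * (R * (m * sqrt (m * (\<integral>y. v y \<partial>\<beta>) - 1)) + R * m * \<bar>relative_error ahat b z\<bar>)"
proof -
  define \<rho> where "\<rho> = relative_error ahat b"
  let ?\<phi> = "\<lambda>y. 1 / v y"
  have uv: "log_lipschitz (2 * L) u" "log_lipschitz (2 * L) v"
    unfolding u_def v_def by (intro quotient_2L ll astar_log_lipschitz bstar_log_lipschitz)+
  have u: "continuous_on UNIV u" "\<And>z. 0 < u z" and v: "continuous_on UNIV v" "\<And>z. 0 < v z"
    using uv continuous_2L log_lipschitzD(1) by auto
  have \<phi>: "continuous_on UNIV ?\<phi>" "\<And>y. 0 < ?\<phi> y"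
    using continuous_on_one_over_pos[OF v] v by auto
  have \<rho>: "continuous_on UNIV \<rho>" "\<And>z. 1 / R \<le> 1 + \<rho> z"
    unfolding \<rho>_def using err by (auto intro: continuous_relative_error ll)
  have u': "u' z = (1 - t) * u z + t * (P ?\<phi> z * (1 + \<rho> z))" for z
  proof -
    have "0 < P ?\<phi> z" by (rule P_pos[OF \<phi>])
    then have "ahat z = astar z * (P ?\<phi> z * (1 + \<rho> z))"
      using star_pos(1)[of z] by (simp add: \<rho>_def relative_error_def exact_step_P v_def)
    then show ?thesis using star_pos(1)[of z] by (simp add: u'_def u_def add_divide_distrib)
  qed
  have Pcont: "continuous_on UNIV (P ?\<phi>)" by (intro continuous_2L P_pos_log_lipschitz \<phi>)
  have "integrable \<alpha> u" "integrable \<alpha> (\<lambda>z. P ?\<phi> z * (1 + \<rho> z))"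
    by (intro A.continuous_integrable continuous_intros Pcont u \<rho>)+
  then have "(\<integral>z. u' z \<partial>\<alpha>) = (1 - t) * (\<integral>z. u z \<partial>\<alpha>) + t * (\<integral>z. P ?\<phi> z * (1 + \<rho> z) \<partial>\<alpha>)"
    unfolding u' by simp
  then have "(\<integral>z. u' z \<partial>\<alpha>) - ((1 - t) * (\<integral>z. u z \<partial>\<alpha>) + t * m)
      = t * ((\<integral>z. P ?\<phi> z * (1 + \<rho> z) \<partial>\<alpha>) - m)" by (simp add: algebra_simps)
  then show "\<bar>(\<integral>z. u' z \<partial>\<alpha>) - ((1 - t) * (\<integral>z. u z \<partial>\<alpha>) + t * m)\<bar> \<le> t * (R * m * N)"
    using noisy_mean_step[OF v \<rho>(1)] t
    by (simp only: abs_mult abs_of_nonneg[OF t(1)] m_def N_def \<rho>_def mult_left_mono)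
  show "(1 - t) * (1 / (\<integral>z. 1 / u z \<partial>\<alpha>))
      + t * ((1 + (1 / R\<^sup>2) * ((\<integral>y. v y \<partial>\<beta>) * m - 1)) / ((\<integral>y. v y \<partial>\<beta>) * (1 + R\<^sup>2 * N)))
      \<le> 1 / (\<integral>z. 1 / u' z \<partial>\<alpha>)"
    using noisy_harmonic_step[OF v u \<rho> t] unfolding u' m_def N_def \<rho>_def .
  have "u' z - ((1 - t) * u z + t * m) = t * ((P ?\<phi> z - m) + P ?\<phi> z * \<rho> z)"
    unfolding u' by (simp add: algebra_simps)
  also have "\<bar>\<dots>\<bar> \<le> t * (R * (m * sqrt (m * (\<integral>y. v y \<partial>\<beta>) - 1)) + R * m * \<bar>\<rho> z\<bar>)"
    unfolding abs_mult abs_of_nonneg[OF t(1)]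
  proof (intro mult_left_mono t order.trans[OF abs_triangle_ineq] add_mono)
    show "\<bar>P ?\<phi> z - m\<bar> \<le> R * (m * sqrt (m * (\<integral>y. v y \<partial>\<beta>) - 1))"
      using P_deviation[OF \<phi>, of z] by (simp add: m_def)
    show "\<bar>P ?\<phi> z * \<rho> z\<bar> \<le> R * m * \<bar>\<rho> z\<bar>"
      using P_bounds(1)[OF \<phi>, of z] P_pos[OF \<phi>, of z]
      by (simp add: abs_mult m_def mult_right_mono)
  qed
  finally show "\<bar>u' z - ((1 - t) * u z + t * m)\<bar>
      \<le> t * (R * (m * sqrt (m * (\<integral>y. v y \<partial>\<beta>) - 1)) + R * m * \<bar>relative_error ahat b z\<bar>)"
    by (simp only: \<rho>_def)
qed

text \<open>\<open>u z\<close> and \<open>\<integral> u d\<alpha>\<close> follow the same moving target \<open>m\<close>, so their difference satisfies an affine recursion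
  with vanishing forcing. Vanishing gaps of the means alone would give convergence of \<open>u\<close> only on
  the support of \<open>\<alpha>\<close>.\<close>

lemma pointwise_convergence:
  fixes a ahat b :: "nat \<Rightarrow> 'a \<Rightarrow> real" and \<eta> :: "nat \<Rightarrow> real"
  defines "u \<equiv> \<lambda>k z. a k z / astar z" and "v \<equiv> \<lambda>k y. b k y / bstar y"
    and "\<rho> \<equiv> \<lambda>k. relative_error (ahat k) (b k)"
  assumes ll: "\<And>k. log_lipschitz L (a k)" "\<And>k. log_lipschitz L (b k)" "\<And>k. log_lipschitz L (ahat k)"
    and step: "\<And>k z. a (Suc k) z = (1 - \<eta> k) * a k z + \<eta> k * ahat k z"
    and \<eta>: "\<And>k. 0 \<le> \<eta> k" "\<And>k. \<eta> k \<le> 1"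
    and \<eta>_diverges: "filterlim (\<lambda>N. \<Sum>k<N. \<eta> k) at_top sequentially"
    and err: "\<And>k z. 1 / R \<le> 1 + \<rho> k z"
    and N: "summable (\<lambda>k. \<eta> k * (\<integral>z. \<bar>\<rho> k z\<bar> \<partial>\<alpha>))"
    and Nz: "summable (\<lambda>k. \<eta> k * \<bar>\<rho> k z\<bar>)"
    and c: "1 \<le> c" "\<And>k. (\<integral>y. 1 / v k y \<partial>\<beta>) \<le> c" "\<And>k. 1 / c \<le> (\<integral>z. u k z \<partial>\<alpha>)"
    and gap: "(\<lambda>k. (\<integral>y. v k y \<partial>\<beta>) * (\<integral>y. 1 / v k y \<partial>\<beta>)) \<longlonglongrightarrow> 1"
  shows "(\<lambda>k. u k z / (\<integral>z. u k z \<partial>\<alpha>)) \<longlonglongrightarrow> 1"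
proof -
  define s where "s = (\<lambda>k. \<integral>z. u k z \<partial>\<alpha>)"
  define m where "m = (\<lambda>k. \<integral>y. 1 / v k y \<partial>\<beta>)"
  define g where "g = (\<lambda>k. (\<integral>y. v k y \<partial>\<beta>) * m k)"
  have v: "continuous_on UNIV (v k)" "0 < v k y" for k y
    using quotient_2L[OF ll(2)[of k] bstar_log_lipschitz] continuous_2L log_lipschitzD(1)
    unfolding v_def by blast+
  have m: "0 < m k" "m k \<le> c" for k
    using c(2) continuous_on_one_over_pos[OF v] v unfolding m_def
    by (auto intro!: B.integral_pos)
  have u_Suc: "u (Suc k) = (\<lambda>z. ((1 - \<eta> k) * a k z + \<eta> k * ahat k z) / astar z)" for k
    by (simp add: u_def step)
  have 1: "\<bar>s (Suc k) - ((1 - \<eta> k) * s k + \<eta> k * m k)\<bar> \<le> \<eta> k * (R * m k * (\<integral>z. \<bar>\<rho> k z\<bar> \<partial>\<alpha>))" for k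
    using ratio_step(1)[OF ll(1)[of k] ll(2)[of k] ll(3)[of k] err[unfolded \<rho>_def] \<eta>[of k]] unfolding s_def m_def u_Suc unfolding u_def v_def \<rho>_def .
  have 2: "\<bar>u (Suc k) z - ((1 - \<eta> k) * u k z + \<eta> k * m k)\<bar>
      \<le> \<eta> k * (R * (m k * sqrt (g k - 1)) + R * m k * \<bar>\<rho> k z\<bar>)" for k
    using ratio_step(3)[OF ll(1)[of k] ll(2)[of k] ll(3)[of k] err[unfolded \<rho>_def] \<eta>[of k]] unfolding g_def m_def u_Suc unfolding u_def v_def \<rho>_def
    by (simp only: mult.commute[of "integral\<^sup>L \<beta> (\<lambda>y. b k y / bstar y)"])
  define e where "e = (\<lambda>k. R * c * (\<eta> k * (\<integral>z. \<bar>\<rho> k z\<bar> \<partial>\<alpha>) + \<eta> k * \<bar>\<rho> k z\<bar>))"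
  define \<xi> where "\<xi> = (\<lambda>k. R * (c * sqrt (g k - 1)))"
  have g1: "1 \<le> g k" for k unfolding g_def m_def by (intro B.mean_times_mean_inverse v)
  have Rc: "0 \<le> R" using R_ge_1 by simp
  have "(\<lambda>k. \<bar>u k z - s k\<bar>) \<longlonglongrightarrow> 0"
  proof (rule affine_recursion_tendsto_zero[where h = \<eta> and \<xi> = \<xi> and e = e])
    have "\<xi> \<longlonglongrightarrow> R * (c * sqrt (1 - 1))"
      unfolding \<xi>_def using gap by (intro tendsto_intros) (simp add: g_def m_def)
    then show "\<xi> \<longlonglongrightarrow> 0" by simp
    show "summable e" unfolding e_def by (intro summable_mult summable_add N Nz)
    show "0 \<le> e k" for k unfolding e_def using Rc c(1) \<eta>
      by (intro mult_nonneg_nonneg add_nonneg_nonneg Bochner_Integration.integral_nonneg) auto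
    show "\<bar>u (Suc k) z - s (Suc k)\<bar> \<le> (1 - \<eta> k) * \<bar>u k z - s k\<bar> + \<eta> k * \<xi> k + e k" for k
    proof -
      define \<nu> where "\<nu> = (\<integral>z. \<bar>\<rho> k z\<bar> \<partial>\<alpha>)"
      have \<nu>: "0 \<le> \<nu>" by (simp add: \<nu>_def)
      define du where "du = u (Suc k) z - ((1 - \<eta> k) * u k z + \<eta> k * m k)"
      define ds where "ds = s (Suc k) - ((1 - \<eta> k) * s k + \<eta> k * m k)"
      have "u (Suc k) z - s (Suc k) = (1 - \<eta> k) * (u k z - s k) + du - ds"
        by (simp add: du_def ds_def algebra_simps)
      then have "\<bar>u (Suc k) z - s (Suc k)\<bar> \<le> \<bar>(1 - \<eta> k) * (u k z - s k)\<bar> + \<bar>du\<bar> + \<bar>ds\<bar>" by linarith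
      moreover have "\<bar>(1 - \<eta> k) * (u k z - s k)\<bar> = (1 - \<eta> k) * \<bar>u k z - s k\<bar>"
        using \<eta> by (simp add: abs_mult)
      moreover have "\<bar>ds\<bar> \<le> \<eta> k * (R * c * \<nu>)"
        using 1[of k] m[of k] \<nu> Rc \<eta>[of k] unfolding ds_def \<nu>_def[symmetric]
        by (elim order.trans) (intro mult_left_mono mult_right_mono, auto)
      moreover have "\<bar>du\<bar> \<le> \<eta> k * (R * (c * sqrt (g k - 1)) + R * c * \<bar>\<rho> k z\<bar>)"
        using 2[of k] m[of k] g1[of k] Rc \<eta>[of k] unfolding du_def
        by (elim order.trans) (intro mult_left_mono mult_right_mono add_mono, auto)
      ultimately show ?thesis by (simp add: \<xi>_def e_def \<nu>_def algebra_simps)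
    qed
  qed (use \<eta> \<eta>_diverges in auto)
  then have "(\<lambda>k. c * \<bar>u k z - s k\<bar>) \<longlonglongrightarrow> c * 0" by (intro tendsto_intros)
  then have lim: "(\<lambda>k. c * \<bar>u k z - s k\<bar>) \<longlonglongrightarrow> 0" by simp
  have "(\<lambda>k. u k z / s k - 1) \<longlonglongrightarrow> 0"
  proof (rule Lim_null_comparison[OF _ lim], intro always_eventually allI)
    fix k
    have s: "0 < s k" "1 / c \<le> s k" using c(1) c(3)[of k] by (auto simp: s_def intro: less_le_trans[of 0 "1 / c"])
    then have "norm (u k z / s k - 1) = \<bar>u k z - s k\<bar> / s k"
      by (simp add: divide_diff_eq_iff abs_div_pos[symmetric] diff_divide_distrib[symmetric])
    also have "\<dots> \<le> \<bar>u k z - s k\<bar> / (1 / c)"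
      using s c(1) by (intro divide_left_mono) auto
    finally show "norm (u k z / s k - 1) \<le> c * \<bar>u k z - s k\<bar>" by (simp add: mult.commute)
  qed
  then have "(\<lambda>k. u k z / s k - 1 + 1) \<longlonglongrightarrow> 0 + 1" by (intro tendsto_intros)
  then show ?thesis by (simp add: s_def)
qed

text \<open>This isolates what is needed of the samples: summability of \<open>\<eta>\<close> times the relative errors, in mean and
  on a dense set. The means of \<open>u\<close>, \<open>1 / u\<close>, \<open>v\<close>, \<open>1 / v\<close> form the two pairs of
  \<open>coupled_scales_converge\<close>.\<close>

theorem deterministic_convergence:
  fixes a b ahat bhat :: "nat \<Rightarrow> 'a \<Rightarrow> real" and \<eta> :: "nat \<Rightarrow> real" and D :: "'a set"
  defines "\<rho> \<equiv> \<lambda>k. relative_error (ahat k) (b k)"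
    and "\<sigma> \<equiv> \<lambda>k. sinkhorn_kernel.relative_error \<alpha> K (bhat k) (a k)"
  assumes ll: "\<And>k. log_lipschitz L (a k)" "\<And>k. log_lipschitz L (b k)"
      "\<And>k. log_lipschitz L (ahat k)" "\<And>k. log_lipschitz L (bhat k)"
    and a_step: "\<And>k z. a (Suc k) z = (1 - \<eta> k) * a k z + \<eta> k * ahat k z"
    and b_step: "\<And>k z. b (Suc k) z = (1 - \<eta> k) * b k z + \<eta> k * bhat k z"
    and \<eta>: "\<And>k. 0 \<le> \<eta> k" "\<And>k. \<eta> k \<le> 1"
    and \<eta>_diverges: "filterlim (\<lambda>N. \<Sum>k<N. \<eta> k) at_top sequentially"
    and err: "\<And>k z. 1 / R \<le> 1 + \<rho> k z" "\<And>k z. 1 / R \<le> 1 + \<sigma> k z"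
    and mean_err: "summable (\<lambda>k. \<eta> k * (\<integral>z. \<bar>\<rho> k z\<bar> \<partial>\<alpha>))" "summable (\<lambda>k. \<eta> k * (\<integral>z. \<bar>\<sigma> k z\<bar> \<partial>\<beta>))"
    and D: "\<And>z e. 0 < e \<Longrightarrow> \<exists>d\<in>D. dist z d < e"
    and D_err: "\<And>d. d \<in> D \<Longrightarrow> summable (\<lambda>k. \<eta> k * \<bar>\<rho> k d\<bar>)" "\<And>d. d \<in> D \<Longrightarrow> summable (\<lambda>k. \<eta> k * \<bar>\<sigma> k d\<bar>)"
  shows "(\<lambda>k. var_norm (\<lambda>z. ln (a k z / astar z))) \<longlonglongrightarrow> 0"
    and "(\<lambda>k. var_norm (\<lambda>z. ln (b k z / bstar z))) \<longlonglongrightarrow> 0"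
proof -
  interpret sw: sinkhorn_kernel \<beta> \<alpha> K bstar astar L R by (rule swap)
  define u where "u = (\<lambda>k z. a k z / astar z)"
  define v where "v = (\<lambda>k z. b k z / bstar z)"
  define s where "s = (\<lambda>k. \<integral>z. u k z \<partial>\<alpha>)"
  define s' where "s' = (\<lambda>k. \<integral>z. v k z \<partial>\<beta>)"
  define r where "r = (\<lambda>k. 1 / (\<integral>z. 1 / v k z \<partial>\<beta>))"
  define r' where "r' = (\<lambda>k. 1 / (\<integral>z. 1 / u k z \<partial>\<alpha>))"
  define N where "N = (\<lambda>k. \<integral>z. \<bar>\<rho> k z\<bar> \<partial>\<alpha>)"
  define N' where "N' = (\<lambda>k. \<integral>z. \<bar>\<sigma> k z\<bar> \<partial>\<beta>)"
  \<comment> \<open>One bound that dominates the noise terms of all four recursions.\<close>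
  define \<nu> where "\<nu> = (\<lambda>k. R\<^sup>2 * (N k + N' k))"
  have uv: "log_lipschitz (2 * L) (u k)" "log_lipschitz (2 * L) (v k)" for k
    unfolding u_def v_def by (intro quotient_2L ll astar_log_lipschitz bstar_log_lipschitz)+
  have u: "continuous_on UNIV (u k)" "0 < u k z" and v: "continuous_on UNIV (v k)" "0 < v k z" for k z
    using uv[of k] continuous_2L log_lipschitzD(1) by auto
  have iu: "continuous_on UNIV (\<lambda>z. 1 / u k z)" and iv: "continuous_on UNIV (\<lambda>z. 1 / v k z)" for k
    by (intro continuous_on_one_over_pos u v)+
  have pos: "0 < s k" "0 < r k" "0 < s' k" "0 < r' k" for k
    unfolding s_def r_def s'_def r'_def using A.integral_pos[OF u(1)[of k]] B.integral_pos[OF v(1)[of k]]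
      A.integral_pos[OF iu[of k]] B.integral_pos[OF iv[of k]] u(2) v(2) by auto
  have R1: "1 \<le> R" "R \<le> R\<^sup>2" using R_ge_1 by (auto simp: power2_eq_square)
  have NN: "0 \<le> N k" "0 \<le> N' k" for k by (auto simp: N_def N'_def)
  have \<nu>: "0 \<le> \<nu> k" "R * N k \<le> \<nu> k" "R\<^sup>2 * N k \<le> \<nu> k" "R * N' k \<le> \<nu> k" "R\<^sup>2 * N' k \<le> \<nu> k" for k
  proof -
    have "R * N k \<le> R\<^sup>2 * N k" "R * N' k \<le> R\<^sup>2 * N' k" using R1 NN by (auto intro: mult_right_mono)
    moreover have "\<nu> k = R\<^sup>2 * N k + R\<^sup>2 * N' k" by (simp add: \<nu>_def distrib_left)
    moreover have "0 \<le> R\<^sup>2 * N k" "0 \<le> R\<^sup>2 * N' k" using NN by auto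
    ultimately show "0 \<le> \<nu> k" "R * N k \<le> \<nu> k" "R\<^sup>2 * N k \<le> \<nu> k" "R * N' k \<le> \<nu> k" "R\<^sup>2 * N' k \<le> \<nu> k"
      by linarith+
  qed
  have u_Suc: "u (Suc k) = (\<lambda>z. ((1 - \<eta> k) * a k z + \<eta> k * ahat k z) / astar z)"
    and v_Suc: "v (Suc k) = (\<lambda>z. ((1 - \<eta> k) * b k z + \<eta> k * bhat k z) / bstar z)" for k
    by (simp_all add: u_def v_def a_step b_step)
  have mean_step: "x' \<le> (1 - \<eta> k) * x + \<eta> k * ((1 + \<nu> k) / y)"
    if "\<bar>x' - ((1 - \<eta> k) * x + \<eta> k * (1 / y))\<bar> \<le> \<eta> k * (R * (1 / y) * n)" "R * n \<le> \<nu> k" "0 < y" for x x' y n k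
  proof -
    have "R * (1 / y) * n \<le> \<nu> k / y" using that by (simp add: divide_right_mono)
    from mult_left_mono[OF this \<eta>(1)[of k]] that(1)
    have "x' \<le> (1 - \<eta> k) * x + \<eta> k * (1 / y) + \<eta> k * (\<nu> k / y)" by linarith
    then show ?thesis by (simp add: add_divide_distrib distrib_left)
  qed
  have harmonic_step: "(1 - \<eta> k) * x + \<eta> k * (q / (y * (1 + \<nu> k))) \<le> x'"
    if "(1 - \<eta> k) * x + \<eta> k * (q / (y * (1 + n))) \<le> x'" "n \<le> \<nu> k" "0 \<le> n" "0 < y" "0 \<le> q" for x x' y q n k
  proof -
    have "q / (y * (1 + \<nu> k)) \<le> q / (y * (1 + n))"
      using that \<nu>(1)[of k] by (intro divide_left_mono mult_pos_pos mult_left_mono) auto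
    from mult_left_mono[OF this \<eta>(1)[of k]] that(1) show ?thesis by linarith
  qed
  have le: "r k \<le> s' k" "r' k \<le> s k" for k
    using A.mean_times_mean_inverse[OF u(1)[of k] u(2)] B.mean_times_mean_inverse[OF v(1)[of k] v(2)] pos[of k]
    by (auto simp: r_def s_def r'_def s'_def divide_le_eq mult.commute)
  have \<kappa>: "0 < 1 / R\<^sup>2" "1 / R\<^sup>2 \<le> 1" using R1 by (auto simp: divide_le_eq)
  have gap0: "0 \<le> 1 + (1 / R\<^sup>2) * (x / y - 1)" if "y \<le> x" "0 < y" for x y
    using that \<kappa> by (intro add_nonneg_nonneg mult_nonneg_nonneg) auto
  have s_step: "s (Suc k) \<le> (1 - \<eta> k) * s k + \<eta> k * ((1 + \<nu> k) / r k)" for k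
  proof (rule mean_step[OF _ \<nu>(2)[of k] pos(2)])
    show "\<bar>s (Suc k) - ((1 - \<eta> k) * s k + \<eta> k * (1 / r k))\<bar> \<le> \<eta> k * (R * (1 / r k) * N k)"
      using ratio_step(1)[OF ll(1)[of k] ll(2)[of k] ll(3)[of k] err(1)[of k, unfolded \<rho>_def] \<eta>[of k]]
      unfolding s_def r_def N_def \<rho>_def u_Suc unfolding u_def v_def by simp
  qed
  have s'_step: "s' (Suc k) \<le> (1 - \<eta> k) * s' k + \<eta> k * ((1 + \<nu> k) / r' k)" for k
  proof (rule mean_step[OF _ \<nu>(4)[of k] pos(4)])
    show "\<bar>s' (Suc k) - ((1 - \<eta> k) * s' k + \<eta> k * (1 / r' k))\<bar> \<le> \<eta> k * (R * (1 / r' k) * N' k)"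
      using sw.ratio_step(1)[OF ll(2)[of k] ll(1)[of k] ll(4)[of k] err(2)[of k, unfolded \<sigma>_def] \<eta>[of k]]
      unfolding s'_def r'_def N'_def \<sigma>_def v_Suc unfolding u_def v_def by simp
  qed
  have r'_step: "(1 - \<eta> k) * r' k + \<eta> k * ((1 + (1 / R\<^sup>2) * (s' k / r k - 1)) / (s' k * (1 + \<nu> k))) \<le> r' (Suc k)" for k
  proof (rule harmonic_step[OF _ \<nu>(3)[of k] _ pos(3) gap0[OF le(1) pos(2)]])
    show "(1 - \<eta> k) * r' k + \<eta> k * ((1 + (1 / R\<^sup>2) * (s' k / r k - 1)) / (s' k * (1 + R\<^sup>2 * N k))) \<le> r' (Suc k)"
      using ratio_step(2)[OF ll(1)[of k] ll(2)[of k] ll(3)[of k] err(1)[of k, unfolded \<rho>_def] \<eta>[of k]]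
      unfolding s'_def r_def r'_def N_def \<rho>_def u_Suc unfolding u_def v_def by simp
  qed (use NN in auto)
  have r_step: "(1 - \<eta> k) * r k + \<eta> k * ((1 + (1 / R\<^sup>2) * (s k / r' k - 1)) / (s k * (1 + \<nu> k))) \<le> r (Suc k)" for k
  proof (rule harmonic_step[OF _ \<nu>(5)[of k] _ pos(1) gap0[OF le(2) pos(4)]])
    show "(1 - \<eta> k) * r k + \<eta> k * ((1 + (1 / R\<^sup>2) * (s k / r' k - 1)) / (s k * (1 + R\<^sup>2 * N' k))) \<le> r (Suc k)"
      using sw.ratio_step(2)[OF ll(2)[of k] ll(1)[of k] ll(4)[of k] err(2)[of k, unfolded \<sigma>_def] \<eta>[of k]]
      unfolding s_def r_def r'_def N'_def \<sigma>_def v_Suc unfolding u_def v_def by simp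
  qed (use NN in auto)
  have "summable (\<lambda>k. R\<^sup>2 * (\<eta> k * N k + \<eta> k * N' k))"
    using mean_err unfolding N_def N'_def by (intro summable_mult summable_add)
  then have \<nu>_summable: "summable (\<lambda>k. \<eta> k * \<nu> k)" by (simp add: \<nu>_def algebra_simps)
  note conv = coupled_scales_converge[OF pos le \<eta> \<eta>_diverges \<nu>(1) \<nu>_summable \<kappa> s_step r_step s'_step r'_step]
  from conv(1) obtain c where c: "1 \<le> c" "\<And>k. 1 / c \<le> s k" "\<And>k. 1 / c \<le> r k" "\<And>k. 1 / c \<le> s' k" "\<And>k. 1 / c \<le> r' k"
    by blast
  have inv: "1 / x \<le> c" if "1 / c \<le> x" "0 < x" for x using that c(1) by (simp add: divide_le_eq mult.commute)
  have ua: "(\<lambda>k. u k d / s k) \<longlonglongrightarrow> 1" if "d \<in> D" for d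
    unfolding u_def s_def
  proof (rule pointwise_convergence[OF ll(1) ll(2) ll(3) a_step \<eta> \<eta>_diverges _ _ _ c(1)])
    show "(\<integral>y. 1 / (b k y / bstar y) \<partial>\<beta>) \<le> c" for k
      using inv[OF c(3) pos(2), of k] by (simp add: r_def v_def)
    show "1 / c \<le> (\<integral>z. a k z / astar z \<partial>\<alpha>)" for k using c(2)[of k] by (simp add: s_def u_def)
    show "(\<lambda>k. (\<integral>y. b k y / bstar y \<partial>\<beta>) * (\<integral>y. 1 / (b k y / bstar y) \<partial>\<beta>)) \<longlonglongrightarrow> 1"
      using conv(3) by (simp add: r_def s'_def v_def)
  qed (use err(1) mean_err(1) D_err(1)[OF that] in \<open>simp_all add: \<rho>_def\<close>)
  have vb: "(\<lambda>k. v k d / s' k) \<longlonglongrightarrow> 1" if "d \<in> D" for d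
    unfolding v_def s'_def
  proof (rule sw.pointwise_convergence[OF ll(2) ll(1) ll(4) b_step \<eta> \<eta>_diverges _ _ _ c(1)])
    show "(\<integral>y. 1 / (a k y / astar y) \<partial>\<alpha>) \<le> c" for k
      using inv[OF c(5) pos(4), of k] by (simp add: r'_def u_def)
    show "1 / c \<le> (\<integral>z. b k z / bstar z \<partial>\<beta>)" for k using c(4)[of k] by (simp add: s'_def v_def)
    show "(\<lambda>k. (\<integral>y. a k y / astar y \<partial>\<alpha>) * (\<integral>y. 1 / (a k y / astar y) \<partial>\<alpha>)) \<longlonglongrightarrow> 1"
      using conv(2) by (simp add: r'_def s_def u_def)
  qed (use err(2) mean_err(2) D_err(2)[OF that] in \<open>simp_all add: \<sigma>_def\<close>)
  show "(\<lambda>k. var_norm (\<lambda>z. ln (a k z / astar z))) \<longlonglongrightarrow> 0"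
    using var_norm_ln_tendsto_zero[OF A.compact_UNIV D _ uv(1) ua pos(1)] L_nonneg by (simp add: u_def)
  show "(\<lambda>k. var_norm (\<lambda>z. ln (b k z / bstar z))) \<longlonglongrightarrow> 0"
    using var_norm_ln_tendsto_zero[OF A.compact_UNIV D _ uv(2) vb pos(3)] L_nonneg by (simp add: v_def)
qed

end

section \<open>Batches independent of the past\<close>

text \<open>\<open>C u v\<close> is the infimum of \<open>C d v + L * dist u d\<close> over \<open>d \<in> D\<close>, a countable infimum of sums of functions
  of one variable each. This gives measurability for the product \<open>\<sigma>\<close>-algebra, which is what
  Fubini's theorem requires.\<close>

lemma Lipschitz_measurable_pair:
  fixes C :: "'a::metric_space \<Rightarrow> 'a \<Rightarrow> real" and D :: "'a set"
  assumes D: "countable D" "\<And>z e. 0 < e \<Longrightarrow> \<exists>d\<in>D. dist z d < e" and L: "0 \<le> L"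
    and C: "\<And>u u' v. \<bar>C u v - C u' v\<bar> \<le> L * dist u u'" "\<And>u. continuous_on UNIV (C u)"
  shows "(\<lambda>(u, v). C u v) \<in> borel_measurable (borel \<Otimes>\<^sub>M borel)"
proof -
  define G where "G = (\<lambda>u v. INF d\<in>D. C d v + L * dist u d)"
  have "C u v = G u v" for u v
    unfolding G_def
  proof (rule antisym)
    have D0: "D \<noteq> {}" using D(2)[OF zero_less_one, of u] by blast
    have le: "C u v \<le> C d v + L * dist u d" for d using C(1)[of u v d] unfolding abs_le_iff by linarith
    show "C u v \<le> (INF d\<in>D. C d v + L * dist u d)" by (rule cINF_greatest[OF D0 le])
    have bdd: "bdd_below ((\<lambda>d. C d v + L * dist u d) ` D)" by (rule bdd_belowI2[of D "C u v"]) (rule le)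
    show "(INF d\<in>D. C d v + L * dist u d) \<le> C u v"
    proof (rule field_le_epsilon)
      fix e :: real assume "0 < e"
      then have "0 < e / (2 * L + 1)" using L by simp
      then obtain d where d: "d \<in> D" "dist u d < e / (2 * L + 1)" using D(2) by blast
      have "(INF d\<in>D. C d v + L * dist u d) \<le> C d v + L * dist u d" by (rule cINF_lower[OF bdd d(1)])
      also have "\<dots> \<le> C u v + 2 * L * dist u d" using C(1)[of u v d] unfolding abs_le_iff by linarith
      also have "2 * L * dist u d \<le> 2 * L * (e / (2 * L + 1))" using d L by (intro mult_left_mono) auto
      also have "\<dots> \<le> e" using L \<open>0 < e\<close> by (simp add: divide_simps)
      finally show "(INF d\<in>D. C d v + L * dist u d) \<le> C u v + e" by simp
    qed
  qed
  then have "C = G" by (intro ext)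
  moreover have "(\<lambda>(u, v). G u v) \<in> borel_measurable (borel \<Otimes>\<^sub>M borel)"
    unfolding case_prod_beta' G_def
  proof (intro borel_measurable_cINF_real D(1) borel_measurable_add borel_measurable_times borel_measurable_const)
    fix d
    have "C d \<in> borel_measurable borel" by (intro borel_measurable_continuous_onI C)
    then show "(\<lambda>x. C d (snd x)) \<in> borel_measurable (borel \<Otimes>\<^sub>M borel)"
      by (rule measurable_compose[OF measurable_snd])
    have "(\<lambda>u. dist u d) \<in> borel_measurable borel"
      by (intro borel_measurable_continuous_onI continuous_intros)
    then show "(\<lambda>x. dist (fst x) d) \<in> borel_measurable (borel \<Otimes>\<^sub>M borel)"
      by (rule measurable_compose[OF measurable_fst])
  qed
  ultimately show ?thesis by simp
qed

lemma compact_countable_dense: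
  assumes "compact (UNIV :: 'a::metric_space set)"
  shows "\<exists>D :: 'a set. countable D \<and> (\<forall>z e. 0 < e \<longrightarrow> (\<exists>d\<in>D. dist z d < e))"
proof -
  have "\<exists>k. finite k \<and> UNIV \<subseteq> (\<Union>x\<in>k. ball (x :: 'a) (1 / Suc i))" for i :: nat
    using seq_compact_imp_totally_bounded[OF compact_imp_seq_compact[OF assms]] by simp
  then have "\<exists>F. \<forall>i. finite (F i) \<and> UNIV \<subseteq> (\<Union>x\<in>F i. ball (x :: 'a) (1 / Suc i))"
    by (intro choice allI)
  then obtain F where F: "\<And>i. finite (F i)" "\<And>i. UNIV \<subseteq> (\<Union>x\<in>F i. ball (x :: 'a) (1 / Suc i))"
    by blast
  have "\<exists>d\<in>(\<Union>i. F i). dist z d < e" if e: "0 < e" for z e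
  proof -
    obtain i where i: "1 / real (Suc i) < e"
      using reals_Archimedean[OF e] unfolding inverse_eq_divide by blast
    obtain d where d: "d \<in> F i" "dist d z < 1 / real (Suc i)"
      using subsetD[OF F(2) UNIV_I, of z i] unfolding UN_iff mem_ball by blast
    from d(2) i have "dist z d < e" unfolding dist_commute[of d z] by linarith
    with d(1) show ?thesis by blast
  qed
  moreover have "countable (\<Union>i. F i)" using F(1) by (intro countable_UN) (auto intro: countable_finite)
  ultimately show ?thesis by blast
qed

context prob_space
begin

text \<open>Independence removes the covariances, so the second moment of the sum is at most \<open>card J * R\<^sup>2\<close>;
  the first absolute moment is bounded by the root of the second.\<close>

lemma expectation_abs_mean_le:
  fixes Z :: "'i \<Rightarrow> 'a \<Rightarrow> real"
  assumes J: "finite J" "J \<noteq> {}" and indep: "indep_vars (\<lambda>_. borel) Z J"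
    and bound: "\<And>j \<omega>. j \<in> J \<Longrightarrow> \<bar>Z j \<omega>\<bar> \<le> R" and mean: "\<And>j. j \<in> J \<Longrightarrow> expectation (Z j) = 0"
  shows "expectation (\<lambda>\<omega>. \<bar>(\<Sum>j\<in>J. Z j \<omega>) / card J\<bar>) \<le> R / sqrt (card J)"
proof -
  have meas: "Z j \<in> borel_measurable M" if "j \<in> J" for j
    using indep that by (auto simp: indep_vars_def)
  have R: "0 \<le> R" proof -
    obtain j where "j \<in> J" using J(2) by blast
    from bound[OF this, of undefined] show ?thesis by linarith
  qed
  have int1: "integrable M (Z j)" if "j \<in> J" for j
    by (rule integrable_const_bound[OF AE_I2 meas[OF that], where B = R]) (simp add: bound[OF that])
  have int2: "integrable M (\<lambda>\<omega>. Z i \<omega> * Z j \<omega>)" if "i \<in> J" "j \<in> J" for i j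
  proof (rule integrable_const_bound[OF AE_I2, where B = "R * R"])
    show "norm (Z i \<omega> * Z j \<omega>) \<le> R * R" for \<omega>
      unfolding real_norm_def abs_mult by (intro mult_mono bound that R abs_ge_zero)
  qed (intro borel_measurable_times meas that)
  have cov: "expectation (\<lambda>\<omega>. Z i \<omega> * Z j \<omega>) \<le> (if i = j then R\<^sup>2 else 0)" if ij: "i \<in> J" "j \<in> J" for i j
  proof (cases "i = j")
    case True
    have "expectation (\<lambda>\<omega>. Z i \<omega> * Z j \<omega>) \<le> expectation (\<lambda>\<omega>. R\<^sup>2)"
    proof (rule integral_mono[OF int2[OF ij]])
      fix \<omega> show "Z i \<omega> * Z j \<omega> \<le> R\<^sup>2"
        using power_mono[OF bound[OF ij(1)], of \<omega> 2] True by (simp add: power2_eq_square)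
    qed simp
    then show ?thesis using True by (simp add: prob_space)
  next
    case False
    have "indep_vars (\<lambda>_. borel) Z {i, j}" by (rule indep_vars_subset[OF indep]) (use ij in auto)
    then have "expectation (\<lambda>\<omega>. \<Prod>k\<in>{i, j}. Z k \<omega>) = (\<Prod>k\<in>{i, j}. expectation (Z k))"
      by (rule indep_vars_lebesgue_integral[rotated]) (use ij in \<open>auto intro: int1\<close>)
    then show ?thesis using False mean ij by simp
  qed
  define S where "S = (\<lambda>\<omega>. \<Sum>j\<in>J. Z j \<omega>)"
  have S2: "(S \<omega>)\<^sup>2 = (\<Sum>i\<in>J. \<Sum>j\<in>J. Z i \<omega> * Z j \<omega>)" for \<omega>
    by (simp add: S_def power2_eq_square sum_product)
  have intS: "integrable M (\<lambda>\<omega>. \<bar>S \<omega>\<bar>)" "integrable M (\<lambda>\<omega>. (\<bar>S \<omega>\<bar>)\<^sup>2)"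
    subgoal unfolding S_def by (intro integrable_abs Bochner_Integration.integrable_sum int1)
    subgoal unfolding power2_abs S2 by (intro Bochner_Integration.integrable_sum int2)
    done
  have "expectation (\<lambda>\<omega>. (S \<omega>)\<^sup>2) = (\<Sum>i\<in>J. \<Sum>j\<in>J. expectation (\<lambda>\<omega>. Z i \<omega> * Z j \<omega>))"
    unfolding S2
    by (subst Bochner_Integration.integral_sum)
      (auto intro!: sum.cong Bochner_Integration.integral_sum Bochner_Integration.integrable_sum int2)
  also have "\<dots> \<le> (\<Sum>i\<in>J. \<Sum>j\<in>J. if i = j then R\<^sup>2 else 0)" by (intro sum_mono cov)
  also have "\<dots> = card J * R\<^sup>2" using J by simp
  finally have "expectation (\<lambda>\<omega>. (S \<omega>)\<^sup>2) \<le> card J * R\<^sup>2" .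
  moreover have "(expectation (\<lambda>\<omega>. \<bar>S \<omega>\<bar>))\<^sup>2 \<le> expectation (\<lambda>\<omega>. (S \<omega>)\<^sup>2)"
    using variance_eq[OF intS] variance_positive[of "\<lambda>\<omega>. \<bar>S \<omega>\<bar>"] by simp
  ultimately have "(expectation (\<lambda>\<omega>. \<bar>S \<omega>\<bar>))\<^sup>2 \<le> (R * sqrt (card J))\<^sup>2"
    unfolding power_mult_distrib real_sqrt_pow2[OF of_nat_0_le_iff] by (simp only: mult.commute)
  then have "expectation (\<lambda>\<omega>. \<bar>S \<omega>\<bar>) \<le> R * sqrt (card J)"
    by (rule power2_le_imp_le) (simp add: R)
  then have "expectation (\<lambda>\<omega>. \<bar>S \<omega>\<bar>) / card J \<le> R * sqrt (card J) / card J"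
    by (rule divide_right_mono) simp
  also have "\<dots> = R * (sqrt (card J) / card J)" by (rule times_divide_eq_right[symmetric])
  also have "sqrt (card J) / card J = 1 / sqrt (card J)" by (simp add: sqrt_divide_self_eq inverse_eq_divide)
  finally show ?thesis by (simp add: S_def)
qed

text \<open>Here \<open>A\<close> indexes the past and \<open>B\<close> the new batch, while \<open>F\<close> is a test function that may depend on the
  past. The joint law of past and batch is a product, so by Fubini the past may be held fixed, and
  then \<open>expectation_abs_mean_le\<close> applies to the centred values of one fixed function.\<close>

lemma fresh_batch_mean_error:
  fixes Z :: "'i \<Rightarrow> 'a \<Rightarrow> 's" and N :: "'s measure"
  assumes indep: "indep_vars (\<lambda>_. N) Z I" and AB: "A \<inter> B = {}" "A \<subseteq> I" "B \<subseteq> I" "finite B" "B \<noteq> {}"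
    and law: "\<And>j. j \<in> B \<Longrightarrow> distr M N (Z j) = \<beta>"
    and F: "(\<lambda>(s, y). F s y) \<in> borel_measurable (PiM A (\<lambda>_. N) \<Otimes>\<^sub>M N)"
    and F_bounds: "\<And>s y. 0 \<le> F s y" "\<And>s y. F s y \<le> R" and R: "1 \<le> R"
    and F_mean: "\<And>s. s \<in> space (PiM A (\<lambda>_. N)) \<Longrightarrow> (\<integral>y. F s y \<partial>\<beta>) = 1"
  shows "(\<integral>\<^sup>+\<omega>. ennreal \<bar>(\<Sum>j\<in>B. F (restrict (\<lambda>i. Z i \<omega>) A) (Z j \<omega>)) / card B - 1\<bar> \<partial>M)
    \<le> ennreal (R / sqrt (card B))"
proof -
  let ?S = "PiM A (\<lambda>_. N)" and ?T = "PiM B (\<lambda>_. N)"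
  let ?X = "\<lambda>\<omega>. restrict (\<lambda>i. Z i \<omega>) A" and ?Y = "\<lambda>\<omega>. restrict (\<lambda>i. Z i \<omega>) B"
  define G where "G = (\<lambda>(s, b). ennreal \<bar>(\<Sum>j\<in>B. F s (b j)) / card B - 1\<bar>)"
  have XY: "?X \<in> measurable M ?S" "?Y \<in> measurable M ?T"
    and joint: "distr M ?S ?X \<Otimes>\<^sub>M distr M ?T ?Y = distr M (?S \<Otimes>\<^sub>M ?T) (\<lambda>\<omega>. (?X \<omega>, ?Y \<omega>))"
    using indep_var_restrict[OF indep AB(1-3)] unfolding indep_var_distribution_eq by auto
  have Z: "Z j \<in> measurable M N" if "j \<in> B" for j using indep AB(3) that by (auto simp: indep_vars_def)
  have G: "G \<in> borel_measurable (?S \<Otimes>\<^sub>M ?T)"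
  proof -
    have "(\<lambda>x. F (fst x) (snd x j)) \<in> borel_measurable (?S \<Otimes>\<^sub>M ?T)" if "j \<in> B" for j
    proof -
      have "(\<lambda>x. (fst x, snd x j)) \<in> measurable (?S \<Otimes>\<^sub>M ?T) (?S \<Otimes>\<^sub>M N)"
        using that by measurable
      from measurable_compose[OF this F] show ?thesis by simp
    qed
    then show ?thesis unfolding G_def case_prod_beta' by measurable
  qed
  interpret PX: prob_space "distr M ?S ?X" by (rule prob_space_distr[OF XY(1)])
  interpret PY: prob_space "distr M ?T ?Y" by (rule prob_space_distr[OF XY(2)])
  have Ys: "?Y \<omega> j = Z j \<omega>" if "j \<in> B" for \<omega> j using that by simp
  have "(\<integral>\<^sup>+\<omega>. ennreal \<bar>(\<Sum>j\<in>B. F (?X \<omega>) (Z j \<omega>)) / card B - 1\<bar> \<partial>M) = (\<integral>\<^sup>+\<omega>. G (?X \<omega>, ?Y \<omega>) \<partial>M)"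
    by (simp add: G_def)
  also have "\<dots> = (\<integral>\<^sup>+x. G x \<partial>(distr M ?S ?X \<Otimes>\<^sub>M distr M ?T ?Y))"
    unfolding joint using XY G by (subst nn_integral_distr) auto
  also have "\<dots> = (\<integral>\<^sup>+s. \<integral>\<^sup>+b. G (s, b) \<partial>distr M ?T ?Y \<partial>distr M ?S ?X)"
    using G by (intro PY.nn_integral_fst[symmetric]) (simp cong: measurable_cong_sets)
  also have "\<dots> \<le> (\<integral>\<^sup>+s. ennreal (R / sqrt (card B)) \<partial>distr M ?S ?X)"
  proof (rule nn_integral_mono)
    fix s assume "s \<in> space (distr M ?S ?X)"
    then have s: "s \<in> space ?S" by simp
    have Fs: "F s \<in> borel_measurable N" using measurable_Pair2[OF F s] by simp
    have "indep_vars (\<lambda>_. borel) (\<lambda>j \<omega>. F s (Z j \<omega>) - 1) B"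
      by (intro indep_vars_compose2[OF indep_vars_subset[OF indep AB(3)]] borel_measurable_diff Fs borel_measurable_const)
    moreover have "\<bar>F s (Z j \<omega>) - 1\<bar> \<le> R" for j \<omega> using F_bounds[of s "Z j \<omega>"] R by (simp add: abs_le_iff)
    moreover have "expectation (\<lambda>\<omega>. F s (Z j \<omega>) - 1) = 0" if j: "j \<in> B" for j
    proof -
      have "integrable M (\<lambda>\<omega>. F s (Z j \<omega>))"
        using F_bounds measurable_compose[OF Z[OF j] Fs] by (intro integrable_const_bound[where B = R]) auto
      moreover have "expectation (\<lambda>\<omega>. F s (Z j \<omega>)) = 1"
        using integral_distr[OF Z[OF j] Fs] F_mean[OF s] law[OF j] by simp
      ultimately show ?thesis by (simp add: prob_space)
    qed
    ultimately have E: "expectation (\<lambda>\<omega>. \<bar>(\<Sum>j\<in>B. F s (Z j \<omega>) - 1) / card B\<bar>) \<le> R / sqrt (card B)"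
      by (intro expectation_abs_mean_le AB) auto
    have centre: "(\<Sum>j\<in>B. F s (Z j \<omega>) - 1) / card B = (\<Sum>j\<in>B. F s (Z j \<omega>)) / card B - 1" for \<omega>
      using AB(4,5) by (simp add: sum_subtractf diff_divide_distrib)
    have sumb: "\<bar>(\<Sum>j\<in>B. F s (Z j \<omega>)) / card B - 1\<bar> \<le> (\<Sum>j\<in>B. R) + 1" for \<omega>
    proof -
      have 1: "0 \<le> (\<Sum>j\<in>B. F s (Z j \<omega>))" "(\<Sum>j\<in>B. F s (Z j \<omega>)) \<le> (\<Sum>j\<in>B. R)"
        by (intro sum_nonneg sum_mono F_bounds)+
      moreover have "1 \<le> real (card B)" using AB(4,5) by (simp add: Suc_le_eq card_gt_0_iff)
      then have "(\<Sum>j\<in>B. F s (Z j \<omega>)) / card B \<le> (\<Sum>j\<in>B. F s (Z j \<omega>)) / 1"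
        using 1(1) by (intro divide_left_mono) auto
      ultimately have "0 \<le> (\<Sum>j\<in>B. F s (Z j \<omega>)) / card B" "(\<Sum>j\<in>B. F s (Z j \<omega>)) / card B \<le> (\<Sum>j\<in>B. R)"
        by (auto simp del: sum_constant)
      then show ?thesis by (simp add: abs_le_iff)
    qed
    have "(\<integral>\<^sup>+b. G (s, b) \<partial>distr M ?T ?Y) = (\<integral>\<^sup>+\<omega>. G (s, ?Y \<omega>) \<partial>M)"
      using G s XY(2) by (intro nn_integral_distr measurable_Pair2[OF G]) auto
    also have "\<dots> = (\<integral>\<^sup>+\<omega>. ennreal \<bar>(\<Sum>j\<in>B. F s (Z j \<omega>)) / card B - 1\<bar> \<partial>M)" by (simp add: G_def)
    also have "\<dots> = ennreal (expectation (\<lambda>\<omega>. \<bar>(\<Sum>j\<in>B. F s (Z j \<omega>)) / card B - 1\<bar>))"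
      using measurable_compose[OF Z Fs] sumb
      by (intro nn_integral_eq_integral integrable_const_bound[where B = "(\<Sum>j\<in>B. R) + 1"]) auto
    also have "\<dots> \<le> ennreal (R / sqrt (card B))" using E unfolding centre by (rule ennreal_leI)
    finally show "(\<integral>\<^sup>+b. G (s, b) \<partial>distr M ?T ?Y) \<le> ennreal (R / sqrt (card B))" .
  qed
  also have "\<dots> = ennreal (R / sqrt (card B))" by (simp add: PX.emeasure_space_1[simplified])
  finally show ?thesis .
qed

end

section \<open>The iterates as functions of the samples\<close>

definition batch :: "(nat \<Rightarrow> nat) \<Rightarrow> nat \<Rightarrow> nat set" where
  "batch n t = {batch_start n t + 1..batch_start n (t + 1)}"

definition batch_average :: "(nat \<Rightarrow> nat) \<Rightarrow> (nat \<Rightarrow> 'a) \<Rightarrow> nat \<Rightarrow> ('a \<Rightarrow> real) \<Rightarrow> real" where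
  "batch_average n Y t h = (\<Sum>i\<in>batch n t. h (Y i)) / real (n t)"

text \<open>Index \<open>k\<close> belongs to time \<open>k + 1\<close>. For \<open>exp (- f)\<close> the arguments are the samples \<open>Y\<close> of \<open>\<beta>\<close> followed by the
  samples \<open>X\<close> of \<open>\<alpha>\<close>; exchanging them gives \<open>exp (- g)\<close>, because the two updates mirror each other.
  Having the iterates as functions of finitely many samples is what makes the new batch
  independent of them and gives joint measurability.\<close>

fun sinkhorn_weight ::
  "('a \<Rightarrow> 'a \<Rightarrow> real) \<Rightarrow> (nat \<Rightarrow> nat) \<Rightarrow> (nat \<Rightarrow> real) \<Rightarrow> nat \<Rightarrow> (nat \<Rightarrow> 'a) \<Rightarrow> (nat \<Rightarrow> 'a) \<Rightarrow> 'a \<Rightarrow> real"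
where
  "sinkhorn_weight K n \<eta> 0 Y X z = (\<Sum>i = 1..batch_start n 1. K z (Y i))"
| "sinkhorn_weight K n \<eta> (Suc k) Y X z =
     (1 - \<eta> (Suc k)) * sinkhorn_weight K n \<eta> k Y X z
       + \<eta> (Suc k) * batch_average n Y (Suc k) (\<lambda>y. K z y / sinkhorn_weight K n \<eta> k X Y y)"

lemma batch_start_Suc: "batch_start n (Suc t) = batch_start n t + n t"
  by (simp add: batch_start_def)

lemma card_batch: "card (batch n t) = n t"
  by (simp add: batch_def batch_start_Suc)

lemma finite_batch: "finite (batch n t)"
  by (simp add: batch_def)

lemma batch_nonempty: "0 < n t \<Longrightarrow> batch n t \<noteq> {}"
  using card_batch[of n t] by force

lemma batch_subset: "batch n t \<subseteq> {1..batch_start n (Suc t)}"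
  by (auto simp: batch_def)

lemma sinkhorn_weight_cong:
  assumes "\<And>i. i \<in> {1..batch_start n (Suc k)} \<Longrightarrow> Y i = Y' i"
    and "\<And>i. i \<in> {1..batch_start n (Suc k)} \<Longrightarrow> X i = X' i"
  shows "sinkhorn_weight K n \<eta> k Y X z = sinkhorn_weight K n \<eta> k Y' X' z"
  using assms
proof (induction k arbitrary: Y X Y' X' z)
  case 0
  then show ?case by (auto intro!: sum.cong)
next
  case (Suc k)
  have sub: "{1..batch_start n (Suc k)} \<subseteq> {1..batch_start n (Suc (Suc k))}"
    using batch_start_Suc[of n "Suc k"] by auto
  have "sinkhorn_weight K n \<eta> k Y X z = sinkhorn_weight K n \<eta> k Y' X' z" for z
    by (rule Suc.IH) (use Suc.prems sub in blast)+
  moreover have "sinkhorn_weight K n \<eta> k X Y z = sinkhorn_weight K n \<eta> k X' Y' z" for z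
    by (rule Suc.IH) (use Suc.prems sub in blast)+
  moreover have "Y i = Y' i" if "i \<in> batch n (Suc k)" for i
    using that batch_subset Suc.prems(1) by blast
  ultimately show ?case by (simp add: batch_average_def cong: sum.cong)
qed

lemma batch_average_log_lipschitz:
  assumes "\<And>y. log_lipschitz L (\<lambda>z. K z y)" "\<And>y. 0 < h y" "0 < n t"
  shows "log_lipschitz L (\<lambda>z. batch_average n Y t (\<lambda>y. K z y / h y))"
proof -
  have "log_lipschitz L (\<lambda>z. (1 / real (n t)) * (\<Sum>i\<in>batch n t. (1 / h (Y i)) * K z (Y i)))"
    using assms by (intro log_lipschitz_cmult log_lipschitz_sum finite_batch batch_nonempty) auto
  then show ?thesis by (simp add: batch_average_def)
qed

lemma sinkhorn_weight_log_lipschitz: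
  assumes K: "\<And>y. log_lipschitz L (\<lambda>z. K z y)" and n: "\<And>t. 0 < n t"
    and \<eta>: "\<And>t. 1 \<le> t \<Longrightarrow> 0 \<le> \<eta> t \<and> \<eta> t \<le> 1"
  shows "log_lipschitz L (sinkhorn_weight K n \<eta> k Y X)"
proof (induction k arbitrary: Y X)
  case 0
  have "1 \<le> batch_start n 1" using n[of 0] by (simp add: batch_start_def)
  then have "log_lipschitz L (\<lambda>z. \<Sum>i = 1..batch_start n 1. K z (Y i))"
    by (intro log_lipschitz_sum K) auto
  then show ?case by (simp add: sinkhorn_weight.simps(1)[abs_def])
next
  case (Suc k)
  have "log_lipschitz L (\<lambda>z. (1 - \<eta> (Suc k)) * sinkhorn_weight K n \<eta> k Y X z
      + \<eta> (Suc k) * batch_average n Y (Suc k) (\<lambda>y. K z y / sinkhorn_weight K n \<eta> k X Y y))"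
    using \<eta>[of "Suc k"]
    by (intro log_lipschitz_convex_combination Suc batch_average_log_lipschitz K n log_lipschitzD(1)[OF Suc]) auto
  then show ?case by (simp add: sinkhorn_weight.simps(2)[abs_def])
qed

lemma integral_batch_measure:
  assumes "h \<in> borel_measurable borel"
  shows "(\<integral>y. h y \<partial>batch_measure n Y t) = batch_average n Y t h"
proof -
  have "(\<integral>y. h y \<partial>batch_measure n Y t)
      = (\<integral>i. h (Y i) \<partial>uniform_count_measure (batch n t))"
    unfolding batch_measure_def batch_def[symmetric]
    by (intro integral_distr assms) (simp add: measurable_def)
  then show ?thesis
    by (simp add: integral_uniform_count_measure finite_batch card_batch batch_average_def)
qed

lemma exp_soft_C_transform:
  assumes "0 < (\<integral>y. exp (h y - C z y) \<partial>\<mu>)"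
  shows "exp (- soft_C_transform C \<mu> h z) = (\<integral>y. exp (- C z y) / exp (- h y) \<partial>\<mu>)"
  using assms by (simp add: soft_C_transform_def exp_diff exp_minus divide_inverse mult.commute)

text \<open>The logarithm in the soft transform cancels as soon as the batch average is positive. Continuity of the
  previous iterate, from its log-Lipschitz bound, lets the integral against the empirical measure be
  evaluated as that average.\<close>

lemma online_sinkhorn_weights:
  fixes C :: "'a::metric_space \<Rightarrow> 'a \<Rightarrow> real"
  defines "K \<equiv> \<lambda>z y. exp (- C z y)"
  assumes os: "online_sinkhorn C n \<eta> X Y f g" and sym: "\<And>u v. C u v = C v u"
    and K: "\<And>y. log_lipschitz L (\<lambda>z. K z y)" and L: "0 \<le> L" and n: "\<And>t. 0 < n t"
    and \<eta>: "\<And>t. 1 \<le> t \<Longrightarrow> 0 \<le> \<eta> t \<and> \<eta> t \<le> 1"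
  shows "exp (- f (Suc k) z) = sinkhorn_weight K n \<eta> k Y X z
    \<and> exp (- g (Suc k) z) = sinkhorn_weight K n \<eta> k X Y z"
proof (induction k arbitrary: z)
  case 0
  show ?case using os sym by (simp add: online_sinkhorn_def K_def)
next
  case (Suc k)
  have transform: "exp (- soft_C_transform C (batch_measure n V (Suc k)) h z)
      = batch_average n V (Suc k) (\<lambda>y. K z y / sinkhorn_weight K n \<eta> k U V y)"
    if h: "\<And>y. exp (- h y) = sinkhorn_weight K n \<eta> k U V y" for U V h
  proof -
    have ll: "log_lipschitz L (sinkhorn_weight K n \<eta> k U V)"
      by (rule sinkhorn_weight_log_lipschitz[OF K n \<eta>])
    have Ksym: "K z y = K y z" for y using sym by (simp add: K_def)
    have eq: "exp (h y - C z y) = K z y / sinkhorn_weight K n \<eta> k U V y" for y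
      unfolding h[symmetric] by (simp add: K_def exp_diff exp_minus divide_inverse mult.commute)
    have "log_lipschitz (L + L) (\<lambda>y. K z y / sinkhorn_weight K n \<eta> k U V y)"
      unfolding Ksym by (intro log_lipschitz_divide K ll)
    then have "(\<lambda>y. exp (h y - C z y)) \<in> borel_measurable borel"
      unfolding eq using L by (intro borel_measurable_continuous_onI log_lipschitz_continuous[where L = "L + L"]) auto
    from integral_batch_measure[OF this]
    have int: "(\<integral>y. exp (h y - C z y) \<partial>batch_measure n V (Suc k))
        = batch_average n V (Suc k) (\<lambda>y. K z y / sinkhorn_weight K n \<eta> k U V y)"
      unfolding eq .
    also have "0 < \<dots>"
      using log_lipschitzD(1)[OF batch_average_log_lipschitz[where K = K and h = "sinkhorn_weight K n \<eta> k U V" and n = n and t = "Suc k", OF K log_lipschitzD(1)[OF ll] n]] .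
    finally show ?thesis using int by (simp add: soft_C_transform_def)
  qed
  have "exp (- f (Suc (Suc k)) z) = (1 - \<eta> (Suc k)) * exp (- f (Suc k) z)
      + \<eta> (Suc k) * exp (- soft_C_transform C (batch_measure n Y (Suc k)) (g (Suc k)) z)"
    "exp (- g (Suc (Suc k)) z) = (1 - \<eta> (Suc k)) * exp (- g (Suc k) z)
      + \<eta> (Suc k) * exp (- soft_C_transform C (batch_measure n X (Suc k)) (f (Suc k)) z)"
    using os unfolding online_sinkhorn_def by (metis Suc_eq_plus1 le_add2)+
  then show ?case using transform[of "g (Suc k)" X Y] transform[of "f (Suc k)" Y X] Suc by simp
qed

context sinkhorn_kernel
begin

lemma K_compose_measurable:
  assumes "f \<in> measurable N borel" "h \<in> measurable N borel"
  shows "(\<lambda>\<omega>. K (f \<omega>) (h \<omega>)) \<in> borel_measurable N"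
  using measurable_compose[OF measurable_Pair[OF assms] K_measurable] by simp

lemma sinkhorn_weight_measurable:
  assumes "\<And>i. i \<in> {1..batch_start n (Suc k)} \<Longrightarrow> Y i \<in> measurable N borel"
    and "\<And>i. i \<in> {1..batch_start n (Suc k)} \<Longrightarrow> X i \<in> measurable N borel"
    and "V \<in> measurable N borel"
  shows "(\<lambda>\<omega>. sinkhorn_weight K n \<eta> k (\<lambda>i. Y i \<omega>) (\<lambda>i. X i \<omega>) (V \<omega>)) \<in> borel_measurable N"
  using assms
proof (induction k arbitrary: Y X V)
  case 0
  then show ?case by (auto intro!: borel_measurable_sum K_compose_measurable)
next
  case (Suc k)
  have sub: "{1..batch_start n (Suc k)} \<subseteq> {1..batch_start n (Suc (Suc k))}"
    using batch_start_Suc[of n "Suc k"] by auto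
  have "(\<lambda>\<omega>. sinkhorn_weight K n \<eta> k (\<lambda>i. Y i \<omega>) (\<lambda>i. X i \<omega>) (V \<omega>)) \<in> borel_measurable N"
    by (rule Suc.IH) (use Suc.prems sub in blast)+
  moreover have "(\<lambda>\<omega>. K (V \<omega>) (Y i \<omega>) / sinkhorn_weight K n \<eta> k (\<lambda>i. X i \<omega>) (\<lambda>i. Y i \<omega>) (Y i \<omega>))
      \<in> borel_measurable N" if "i \<in> batch n (Suc k)" for i
  proof -
    have Yi: "Y i \<in> measurable N borel" using that batch_subset Suc.prems(1) by blast
    have "(\<lambda>\<omega>. sinkhorn_weight K n \<eta> k (\<lambda>i. X i \<omega>) (\<lambda>i. Y i \<omega>) (Y i \<omega>)) \<in> borel_measurable N"
      by (rule Suc.IH) (use Suc.prems sub Yi in blast)+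
    then show ?thesis by (intro borel_measurable_divide K_compose_measurable Suc.prems(3) Yi)
  qed
  then have "(\<lambda>\<omega>. batch_average n (\<lambda>i. Y i \<omega>) (Suc k)
      (\<lambda>y. K (V \<omega>) y / sinkhorn_weight K n \<eta> k (\<lambda>i. X i \<omega>) (\<lambda>i. Y i \<omega>) y)) \<in> borel_measurable N"
    unfolding batch_average_def by (intro borel_measurable_divide[OF borel_measurable_sum borel_measurable_const])
  ultimately show ?case
    unfolding sinkhorn_weight.simps
    by (intro borel_measurable_add borel_measurable_times borel_measurable_const)
qed

text \<open>The summands of a batch average, normalised to mean one, lie in \<open>[1 / R, R]\<close> whatever the size of \<open>b\<close>.
  So the relative errors are controlled before any bound on the iterates is known.\<close>

lemma summand_bounds:
  assumes "log_lipschitz L b"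
  shows "0 < (\<integral>y. K z y / b y \<partial>\<beta>)"
    and "K z y / b y / (\<integral>y. K z y / b y \<partial>\<beta>) \<le> R" and "1 / R \<le> K z y / b y / (\<integral>y. K z y / b y \<partial>\<beta>)"
    and "(\<integral>y. K z y / b y / (\<integral>y. K z y / b y \<partial>\<beta>) \<partial>\<beta>) = 1"
proof -
  have ll: "log_lipschitz (2 * L) (\<lambda>y. K z y / b y)" by (rule summand_log_lipschitz[OF assms])
  show pos: "0 < (\<integral>y. K z y / b y \<partial>\<beta>)"
    using log_lipschitzD(1)[OF exact_step_log_lipschitz[OF assms]] .
  show "K z y / b y / (\<integral>y. K z y / b y \<partial>\<beta>) \<le> R" "1 / R \<le> K z y / b y / (\<integral>y. K z y / b y \<partial>\<beta>)"
  proof -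
    define c where "c = K z y / b y"
    have "c \<le> R * (\<integral>y. K z y / b y \<partial>\<beta>)" "(\<integral>y. K z y / b y \<partial>\<beta>) \<le> R * c"
      using mean_comparable[OF ll, of y] by (simp_all only: c_def)
    then show "c / (\<integral>y. K z y / b y \<partial>\<beta>) \<le> R" "1 / R \<le> c / (\<integral>y. K z y / b y \<partial>\<beta>)"
      using pos R_ge_1 by (simp_all add: pos_divide_le_eq pos_le_divide_eq mult.commute)
  qed
  show "(\<integral>y. K z y / b y / (\<integral>y. K z y / b y \<partial>\<beta>) \<partial>\<beta>) = 1"
    by (subst integral_divide_zero) (use pos in simp)
qed

lemma relative_error_batch:
  "relative_error (\<lambda>z. batch_average n Y t (\<lambda>y. K z y / b y)) b z
    = (\<Sum>i\<in>batch n t. K z (Y i) / b (Y i) / (\<integral>y. K z y / b y \<partial>\<beta>)) / real (n t) - 1"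
  unfolding relative_error_def batch_average_def sum_divide_distrib[symmetric]
  by (simp only: divide_divide_eq_left mult.commute)

lemma relative_error_ge:
  assumes "log_lipschitz L b" "0 < n t"
  shows "1 / R \<le> 1 + relative_error (\<lambda>z. batch_average n Y t (\<lambda>y. K z y / b y)) b z"
proof -
  have "real (n t) * (1 / R) = (\<Sum>i\<in>batch n t. 1 / R)" by (simp add: card_batch)
  also have "\<dots> \<le> (\<Sum>i\<in>batch n t. K z (Y i) / b (Y i) / (\<integral>y. K z y / b y \<partial>\<beta>))"
    by (intro sum_mono summand_bounds assms)
  finally show ?thesis using assms(2) unfolding relative_error_batch
    by (simp add: le_divide_eq mult.commute del: sum_divide_distrib[symmetric])
qed

end

section \<open>Summability of the sampling errors\<close>

context sinkhorn_kernel
begin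

text \<open>The relative deviation of the batch average that enters the update at time \<open>k + 1\<close> from its conditional
  expectation given the earlier samples.\<close>

definition sampling_error ::
  "(nat \<Rightarrow> nat) \<Rightarrow> (nat \<Rightarrow> real) \<Rightarrow> nat \<Rightarrow> (nat \<Rightarrow> 'a) \<Rightarrow> (nat \<Rightarrow> 'a) \<Rightarrow> 'a \<Rightarrow> real" where
  "sampling_error n \<eta> k X Y = relative_error
     (\<lambda>z. batch_average n Y (Suc k) (\<lambda>y. K z y / sinkhorn_weight K n \<eta> k X Y y))
     (sinkhorn_weight K n \<eta> k X Y)"

lemma sampling_error_measurable:
  assumes Y: "\<And>i. 1 \<le> i \<Longrightarrow> Y i \<in> measurable N borel"
    and X: "\<And>i. 1 \<le> i \<Longrightarrow> X i \<in> measurable N borel" and V: "V \<in> measurable N borel"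
  shows "(\<lambda>\<omega>. sampling_error n \<eta> k (\<lambda>i. X i \<omega>) (\<lambda>i. Y i \<omega>) (V \<omega>)) \<in> borel_measurable N"
proof -
  have W: "(\<lambda>\<omega>. sinkhorn_weight K n \<eta> k (\<lambda>i. X i (g \<omega>)) (\<lambda>i. Y i (g \<omega>)) (U \<omega>)) \<in> borel_measurable N'"
    if "g \<in> measurable N' N" "U \<in> measurable N' borel" for g N' and U :: "'c \<Rightarrow> 'a"
    by (intro sinkhorn_weight_measurable measurable_compose[OF that(1)] X Y that(2)) auto
  have int: "(\<lambda>\<omega>. \<integral>y. K (V \<omega>) y / sinkhorn_weight K n \<eta> k (\<lambda>i. X i \<omega>) (\<lambda>i. Y i \<omega>) y \<partial>\<beta>) \<in> borel_measurable N"
  proof (rule B.borel_measurable_lebesgue_integral)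
    have snd: "snd \<in> measurable (N \<Otimes>\<^sub>M \<beta>) borel"
      using measurable_snd[of N \<beta>] B.sets_borel by (simp cong: measurable_cong_sets)
    have "(\<lambda>x. K (V (fst x)) (snd x) / sinkhorn_weight K n \<eta> k (\<lambda>i. X i (fst x)) (\<lambda>i. Y i (fst x)) (snd x))
        \<in> borel_measurable (N \<Otimes>\<^sub>M \<beta>)"
      by (intro borel_measurable_divide K_compose_measurable measurable_compose[OF measurable_fst V] snd
          W[OF measurable_fst])
    then show "(\<lambda>(\<omega>, y). K (V \<omega>) y / sinkhorn_weight K n \<eta> k (\<lambda>i. X i \<omega>) (\<lambda>i. Y i \<omega>) y)
        \<in> borel_measurable (N \<Otimes>\<^sub>M \<beta>)" by (simp add: case_prod_beta')
  qed
  have "(\<lambda>\<omega>. K (V \<omega>) (Y i \<omega>) / sinkhorn_weight K n \<eta> k (\<lambda>i. X i \<omega>) (\<lambda>i. Y i \<omega>) (Y i \<omega>)) \<in> borel_measurable N"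
    if "i \<in> batch n (Suc k)" for i
  proof -
    have Yi: "Y i \<in> measurable N borel" using that by (intro Y) (simp add: batch_def)
    show ?thesis by (intro borel_measurable_divide K_compose_measurable V Yi W[OF measurable_ident, simplified])
  qed
  then have avg: "(\<lambda>\<omega>. batch_average n (\<lambda>i. Y i \<omega>) (Suc k)
      (\<lambda>y. K (V \<omega>) y / sinkhorn_weight K n \<eta> k (\<lambda>i. X i \<omega>) (\<lambda>i. Y i \<omega>) y)) \<in> borel_measurable N"
    unfolding batch_average_def by (intro borel_measurable_divide[OF borel_measurable_sum borel_measurable_const])
  show ?thesis unfolding sampling_error_def relative_error_def
    by (intro borel_measurable_diff borel_measurable_divide[OF avg int] borel_measurable_const)
qed

lemma expected_sampling_error:
  fixes M :: "'w measure" and Z :: "'i \<Rightarrow> 'w \<Rightarrow> 'a" and ix iy :: "nat \<Rightarrow> 'i"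
  assumes M: "prob_space M" and indep: "prob_space.indep_vars M (\<lambda>_. borel) Z I"
    and idx: "\<And>i. 1 \<le> i \<Longrightarrow> ix i \<in> I" "\<And>i. 1 \<le> i \<Longrightarrow> iy i \<in> I" "inj ix" "inj iy" "\<And>i j. ix i \<noteq> iy j"
    and law: "\<And>i. 1 \<le> i \<Longrightarrow> distr M borel (Z (iy i)) = \<beta>"
    and n: "\<And>t. 0 < n t" and \<eta>: "\<And>t. 1 \<le> t \<Longrightarrow> 0 \<le> \<eta> t \<and> \<eta> t \<le> 1"
  shows "(\<integral>\<^sup>+\<omega>. ennreal \<bar>sampling_error n \<eta> k (\<lambda>i. Z (ix i) \<omega>) (\<lambda>i. Z (iy i) \<omega>) z\<bar> \<partial>M)
    \<le> ennreal (R / sqrt (n (Suc k)))"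
proof -
  interpret M: prob_space M by fact
  let ?m = "batch_start n (Suc k)"
  define A where "A = ix ` {1..?m} \<union> iy ` {1..?m}"
  define W where "W = (\<lambda>s. sinkhorn_weight K n \<eta> k (\<lambda>i. s (ix i)) (\<lambda>i. s (iy i)))"
  define F where "F = (\<lambda>s y. K z y / W s y / (\<integral>y. K z y / W s y \<partial>\<beta>))"
  have W_ll: "log_lipschitz L (W s)" for s
    unfolding W_def by (intro sinkhorn_weight_log_lipschitz K_log_lipschitz n \<eta>)
  have F_meas: "(\<lambda>(s, y). F s y) \<in> borel_measurable (PiM A (\<lambda>_. borel) \<Otimes>\<^sub>M borel)"
  proof -
    let ?S = "PiM A (\<lambda>_. borel :: 'a measure)"
    have coord: "(\<lambda>s. s (ix i)) \<in> measurable ?S borel" "(\<lambda>s. s (iy i)) \<in> measurable ?S borel"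
      if "i \<in> {1..?m}" for i
      using that by (auto simp: A_def intro!: measurable_component_singleton)
    have Wm: "(\<lambda>x. W (fst x) (snd x)) \<in> borel_measurable (?S \<Otimes>\<^sub>M N)" if "sets N = sets borel" for N
    proof -
      have "snd \<in> measurable (?S \<Otimes>\<^sub>M N) borel"
        using measurable_snd[of ?S N] that by (simp cong: measurable_cong_sets)
      then show ?thesis unfolding W_def
        by (intro sinkhorn_weight_measurable measurable_compose[OF measurable_fst coord(1)]
            measurable_compose[OF measurable_fst coord(2)])
    qed
    have Km: "(\<lambda>x. K z (snd x)) \<in> borel_measurable (?S \<Otimes>\<^sub>M N)" if "sets N = sets borel" for N
    proof -
      have "snd \<in> measurable (?S \<Otimes>\<^sub>M N) borel"
        using measurable_snd[of ?S N] that by (simp cong: measurable_cong_sets)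
      then show ?thesis by (intro K_compose_measurable measurable_const) auto
    qed
    have "(\<lambda>s. \<integral>y. K z y / W s y \<partial>\<beta>) \<in> borel_measurable ?S"
      using borel_measurable_divide[OF Km[OF B.sets_borel] Wm[OF B.sets_borel]]
      by (intro B.borel_measurable_lebesgue_integral) (simp add: case_prod_beta')
    from borel_measurable_divide[OF borel_measurable_divide[OF Km[OF refl] Wm[OF refl]] measurable_compose[OF measurable_fst this]]
    show ?thesis unfolding F_def case_prod_beta' .
  qed
  have "sampling_error n \<eta> k (\<lambda>i. Z (ix i) \<omega>) (\<lambda>i. Z (iy i) \<omega>) z
      = (\<Sum>j\<in>iy ` batch n (Suc k). F (restrict (\<lambda>i. Z i \<omega>) A) (Z j \<omega>)) / card (iy ` batch n (Suc k)) - 1" for \<omega>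
  proof -
    have "W (restrict (\<lambda>i. Z i \<omega>) A) y
        = sinkhorn_weight K n \<eta> k (\<lambda>i. Z (ix i) \<omega>) (\<lambda>i. Z (iy i) \<omega>) y" for y
      unfolding W_def by (rule sinkhorn_weight_cong) (auto simp: A_def)
    moreover have "inj_on iy (batch n (Suc k))" using idx(4) by (rule inj_on_subset) simp
    ultimately show ?thesis
      unfolding sampling_error_def relative_error_batch F_def
      by (simp add: sum.reindex card_image card_batch)
  qed
  moreover have "(\<integral>\<^sup>+\<omega>. ennreal \<bar>(\<Sum>j\<in>iy ` batch n (Suc k). F (restrict (\<lambda>i. Z i \<omega>) A) (Z j \<omega>)) / card (iy ` batch n (Suc k)) - 1\<bar> \<partial>M)
      \<le> ennreal (R / sqrt (card (iy ` batch n (Suc k))))"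
  proof (rule M.fresh_batch_mean_error[OF indep _ _ _ _ _ _ F_meas])
    show "A \<inter> iy ` batch n (Suc k) = {}"
      using idx(4) idx(5) idx(5)[symmetric] by (auto simp: A_def batch_def dest: injD)
    show "A \<subseteq> I" "iy ` batch n (Suc k) \<subseteq> I" using idx(1,2) by (auto simp: A_def batch_def)
    show "finite (iy ` batch n (Suc k))" "iy ` batch n (Suc k) \<noteq> {}"
      using finite_batch batch_nonempty[where n = n and t = "Suc k", OF n] by auto
    show "distr M borel (Z j) = \<beta>" if "j \<in> iy ` batch n (Suc k)" for j
      using that law by (auto simp: batch_def)
    show "F s y \<le> R" for s y unfolding F_def by (rule summand_bounds[OF W_ll])
    have "1 / R \<le> F s y" for s y unfolding F_def by (rule summand_bounds[OF W_ll])
    moreover have "0 \<le> 1 / R" using R_ge_1 by simp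
    ultimately show "0 \<le> F s y" for s y using order.trans by blast
    show "1 \<le> R" by (rule R_ge_1)
    show "(\<integral>y. F s y \<partial>\<beta>) = 1" for s unfolding F_def by (rule summand_bounds[OF W_ll])
  qed
  moreover have "card (iy ` batch n (Suc k)) = n (Suc k)"
    using inj_on_subset[OF idx(4)] by (simp add: card_image card_batch)
  ultimately show ?thesis by simp
qed

text \<open>Tonelli's theorem moves the expectation inside the sum and the \<open>\<nu>\<close>-integral. The measure \<open>\<nu>\<close> is
  left open because two choices matter: \<open>\<nu> = \<alpha>\<close> controls the means, and point masses control
  the errors at single points.\<close>

lemma sampling_errors_summable:
  fixes M :: "'w measure" and Z :: "'i \<Rightarrow> 'w \<Rightarrow> 'a" and ix iy :: "nat \<Rightarrow> 'i" and \<nu> :: "'a measure"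
  assumes M: "prob_space M" and indep: "prob_space.indep_vars M (\<lambda>_. borel) Z I"
    and idx: "\<And>i. 1 \<le> i \<Longrightarrow> ix i \<in> I" "\<And>i. 1 \<le> i \<Longrightarrow> iy i \<in> I" "inj ix" "inj iy" "\<And>i j. ix i \<noteq> iy j"
    and law: "\<And>i. 1 \<le> i \<Longrightarrow> distr M borel (Z (iy i)) = \<beta>"
    and n: "\<And>t. 0 < n t" and \<eta>: "\<And>t. 1 \<le> t \<Longrightarrow> 0 \<le> \<eta> t \<and> \<eta> t \<le> 1"
    and sum: "summable (\<lambda>k. \<eta> (Suc k) * (R / sqrt (n (Suc k))))"
    and \<nu>: "prob_space \<nu>" "sets \<nu> = sets borel"
  shows "AE \<omega> in M. summable (\<lambda>k. \<eta> (Suc k) *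
    (\<integral>z. \<bar>sampling_error n \<eta> k (\<lambda>i. Z (ix i) \<omega>) (\<lambda>i. Z (iy i) \<omega>) z\<bar> \<partial>\<nu>))"
proof -
  interpret M: prob_space M by fact
  interpret \<nu>: compact_prob_space \<nu>
    by (intro compact_prob_space.intro \<nu> compact_prob_space_axioms.intro A.compact_UNIV)
  interpret pair_sigma_finite M \<nu> ..
  define e where "e = (\<lambda>k \<omega> z. sampling_error n \<eta> k (\<lambda>i. Z (ix i) \<omega>) (\<lambda>i. Z (iy i) \<omega>) z)"
  have Zm: "Z j \<in> measurable M borel" if "j \<in> I" for j
    using indep that by (auto simp: M.indep_vars_def)
  have e_meas: "(\<lambda>(\<omega>, z). e k \<omega> z) \<in> borel_measurable (M \<Otimes>\<^sub>M \<nu>)" for k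
  proof -
    have "snd \<in> measurable (M \<Otimes>\<^sub>M \<nu>) borel"
      using measurable_snd[of M \<nu>] \<nu>(2) by (simp cong: measurable_cong_sets)
    then show ?thesis unfolding e_def case_prod_beta'
      by (intro sampling_error_measurable measurable_compose[OF measurable_fst Zm] idx)
  qed
  then have abs_meas: "(\<lambda>(\<omega>, z). ennreal \<bar>e k \<omega> z\<bar>) \<in> borel_measurable (M \<Otimes>\<^sub>M \<nu>)" for k
    unfolding case_prod_beta' by measurable
  define h where "h = (\<lambda>k \<omega>. \<integral>\<^sup>+z. ennreal \<bar>e k \<omega> z\<bar> \<partial>\<nu>)"
  have h_meas: "h k \<in> borel_measurable M" for k
    unfolding h_def using \<nu>.borel_measurable_nn_integral[OF abs_meas] by simp
  have h_le: "(\<integral>\<^sup>+\<omega>. h k \<omega> \<partial>M) \<le> ennreal (R / sqrt (n (Suc k)))" for k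
  proof -
    have "(\<integral>\<^sup>+\<omega>. h k \<omega> \<partial>M) = (\<integral>\<^sup>+z. \<integral>\<^sup>+\<omega>. ennreal \<bar>e k \<omega> z\<bar> \<partial>M \<partial>\<nu>)"
      unfolding h_def by (rule Fubini'[OF abs_meas, symmetric])
    also have "\<dots> \<le> (\<integral>\<^sup>+z. ennreal (R / sqrt (n (Suc k))) \<partial>\<nu>)"
      unfolding e_def by (intro nn_integral_mono expected_sampling_error[OF M indep idx law n \<eta>])
    also have "\<dots> = ennreal (R / sqrt (n (Suc k)))" by (simp add: \<nu>.emeasure_space_1)
    finally show ?thesis .
  qed
  have \<eta>0: "0 \<le> \<eta> (Suc k)" for k using \<eta>[of "Suc k"] by simp
  have "(\<integral>\<^sup>+\<omega>. (\<Sum>k. ennreal (\<eta> (Suc k)) * h k \<omega>) \<partial>M) = (\<Sum>k. ennreal (\<eta> (Suc k)) * (\<integral>\<^sup>+\<omega>. h k \<omega> \<partial>M))"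
    using h_meas by (simp add: nn_integral_suminf nn_integral_cmult)
  also have "\<dots> \<le> (\<Sum>k. ennreal (\<eta> (Suc k) * (R / sqrt (n (Suc k)))))"
  proof (intro suminf_le summableI)
    show "ennreal (\<eta> (Suc k)) * (\<integral>\<^sup>+\<omega>. h k \<omega> \<partial>M) \<le> ennreal (\<eta> (Suc k) * (R / sqrt (n (Suc k))))" for k
      unfolding ennreal_mult'[OF \<eta>0] by (rule mult_left_mono[OF h_le]) simp
  qed
  also have "\<dots> = ennreal (\<Sum>k. \<eta> (Suc k) * (R / sqrt (n (Suc k))))"
    using \<eta>0 R_ge_1 sum by (intro suminf_ennreal2) auto
  also have "\<dots> < \<infinity>" by simp
  finally have "(\<integral>\<^sup>+\<omega>. (\<Sum>k. ennreal (\<eta> (Suc k)) * h k \<omega>) \<partial>M) \<noteq> \<infinity>" by simp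
  then have "AE \<omega> in M. (\<Sum>k. ennreal (\<eta> (Suc k)) * h k \<omega>) \<noteq> \<infinity>"
    using h_meas by (intro nn_integral_noteq_infinite) auto
  then show ?thesis
  proof (rule AE_mp, intro AE_I2 impI)
    fix \<omega> assume fin: "(\<Sum>k. ennreal (\<eta> (Suc k)) * h k \<omega>) \<noteq> \<infinity>"
    have "ennreal (\<eta> (Suc k)) * h k \<omega> = ennreal (\<eta> (Suc k) * (\<integral>z. \<bar>e k \<omega> z\<bar> \<partial>\<nu>))" for k
    proof -
      have w: "log_lipschitz L (sinkhorn_weight K n \<eta> k X Y)" for X Y
        by (intro sinkhorn_weight_log_lipschitz K_log_lipschitz n \<eta>)
      have "continuous_on UNIV (e k \<omega>)"
        unfolding e_def sampling_error_def
        by (intro continuous_relative_error batch_average_log_lipschitz K_log_lipschitz log_lipschitzD(1)[OF w] n w)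
      then have "integrable \<nu> (\<lambda>z. \<bar>e k \<omega> z\<bar>)" by (intro \<nu>.continuous_integrable continuous_intros)
      then have "h k \<omega> = ennreal (\<integral>z. \<bar>e k \<omega> z\<bar> \<partial>\<nu>)" unfolding h_def by (intro nn_integral_eq_integral) auto
      then show ?thesis using \<eta>0 by (simp add: ennreal_mult')
    qed
    with fin have "(\<Sum>k. ennreal (\<eta> (Suc k) * (\<integral>z. \<bar>e k \<omega> z\<bar> \<partial>\<nu>))) \<noteq> top" by simp
    with \<eta>0 have "summable (\<lambda>k. \<eta> (Suc k) * (\<integral>z. \<bar>e k \<omega> z\<bar> \<partial>\<nu>))"
      by (intro summable_suminf_not_top) auto
    then show "summable (\<lambda>k. \<eta> (Suc k) *
        (\<integral>z. \<bar>sampling_error n \<eta> k (\<lambda>i. Z (ix i) \<omega>) (\<lambda>i. Z (iy i) \<omega>) z\<bar> \<partial>\<nu>))"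
      unfolding e_def .
  qed
qed

end

section \<open>Almost sure convergence\<close>

lemma var_norm_uminus: "var_norm (\<lambda>z. - h z) = var_norm h"
proof -
  have "(SUP z. - h z) = - (INF z. h z)" "(INF z. - h z) = - (SUP z. h z)"
    by (simp_all add: Inf_real_def image_image)
  then show ?thesis by (simp add: var_norm_def)
qed

lemma Gibbs_kernel_log_lipschitz:
  assumes "L-lipschitz_on UNIV (\<lambda>(u, v). C u v)"
  shows "\<bar>C u v - C u' v\<bar> \<le> L * dist u u'" and "log_lipschitz L (\<lambda>z. exp (- C z y))"
proof -
  have C: "\<bar>C u v - C u' v\<bar> \<le> L * dist u u'" for u u' v
    using lipschitz_onD[OF assms, of "(u, v)" "(u', v)"] by (simp add: dist_Pair_Pair dist_real_def)
  then show "\<bar>C u v - C u' v\<bar> \<le> L * dist u u'" .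
  have "exp (- C z y) \<le> exp (L * dist z z') * exp (- C z' y)" for z z'
    unfolding mult_exp_exp using C[of z y z'] by (simp add: abs_le_iff)
  then show "log_lipschitz L (\<lambda>z. exp (- C z y))" by (simp add: log_lipschitz_def)
qed

text \<open>The equations \<open>f = T\<^sub>\<beta> g\<close> and \<open>g = T\<^sub>\<alpha> f\<close> hold on the whole space, so both exponentials are
  mixtures of the functions \<open>\<lambda>z. exp (- C z y)\<close> and inherit their log-Lipschitz constant.\<close>

lemma sinkhorn_kernel_of_potentials:
  fixes C :: "'a::metric_space \<Rightarrow> 'a \<Rightarrow> real"
  assumes cpt: "compact (UNIV :: 'a set)" and sym: "\<And>u v. C u v = C v u"
    and lip: "L-lipschitz_on UNIV (\<lambda>(u, v). C u v)"
    and alpha: "prob_space \<alpha>" "sets \<alpha> = sets borel" and beta: "prob_space \<beta>" "sets \<beta> = sets borel"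
    and pot: "continuous_on UNIV f" "continuous_on UNIV g"
      "f = soft_C_transform C \<beta> g" "g = soft_C_transform C \<alpha> f"
  shows "sinkhorn_kernel \<alpha> \<beta> (\<lambda>z y. exp (- C z y)) (\<lambda>z. exp (- f z)) (\<lambda>z. exp (- g z)) L
    (exp (2 * L * diameter (UNIV :: 'a set)))"
proof -
  have L: "0 \<le> L" using lip by (rule lipschitz_on_nonneg)
  note K_ll = Gibbs_kernel_log_lipschitz(2)[OF lip]
  have K_cont: "continuous_on UNIV (\<lambda>y. exp (- C z y))" for z
    using log_lipschitz_continuous[OF K_ll L, of z] by (simp add: sym[of _ z])
  have C_cont: "continuous_on UNIV (C z)" for z
  proof -
    have "continuous_on UNIV (\<lambda>y. - ln (exp (- C z y)))" by (intro continuous_intros K_cont) auto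
    then show ?thesis by simp
  qed
  have fixed_point: "exp (- h z) = (\<integral>y. exp (- C z y) / exp (- h' y) \<partial>\<mu>)"
    "log_lipschitz L (\<lambda>z. exp (- h z))"
    if \<mu>: "prob_space \<mu>" "sets \<mu> = sets borel" and h: "continuous_on UNIV h'" "h = soft_C_transform C \<mu> h'"
    for h h' \<mu> z
  proof -
    interpret compact_prob_space \<mu>
      by (intro compact_prob_space.intro compact_prob_space_axioms.intro \<mu> cpt)
    have cont: "continuous_on UNIV (\<lambda>y. exp (- C z y) / exp (- h' y))" for z
      by (intro continuous_intros K_cont h(1)) auto
    have "0 < (\<integral>y. exp (h' y - C z y) \<partial>\<mu>)" for z
      by (intro integral_pos continuous_intros h(1) C_cont) auto
    from exp_soft_C_transform[OF this]
    have eq: "exp (- h z) = (\<integral>y. exp (- C z y) / exp (- h' y) \<partial>\<mu>)" for z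
      unfolding h(2) by simp
    then show "exp (- h z) = (\<integral>y. exp (- C z y) / exp (- h' y) \<partial>\<mu>)" .
    have "log_lipschitz L (\<lambda>z. exp (- C z y) / exp (- h' y))" for y
      using log_lipschitz_cmult[OF K_ll, of "1 / exp (- h' y)" y] by simp
    then show "log_lipschitz L (\<lambda>z. exp (- h z))"
      unfolding eq by (intro log_lipschitz_integral compact_prob_space_axioms cont)
  qed
  obtain D :: "'a set" where D: "countable D" "\<And>z e. 0 < e \<Longrightarrow> \<exists>d\<in>D. dist z d < e"
    using compact_countable_dense[OF cpt] by blast
  have "(\<lambda>(z, y). C z y) \<in> borel_measurable (borel \<Otimes>\<^sub>M borel)"
    by (rule Lipschitz_measurable_pair[OF D L Gibbs_kernel_log_lipschitz(1)[OF lip] C_cont])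
  then have K_meas: "(\<lambda>(z, y). exp (- C z y)) \<in> borel_measurable (borel \<Otimes>\<^sub>M borel)"
    unfolding case_prod_beta' by measurable
  show ?thesis
  proof (intro sinkhorn_kernel.intro sinkhorn_kernel_axioms.intro compact_prob_space.intro
      compact_prob_space_axioms.intro alpha beta cpt L K_ll K_meas)
    show "exp (- C z y) = exp (- C y z)" for z y by (simp add: sym[of z])
    show "log_lipschitz L (\<lambda>z. exp (- f z))" by (rule fixed_point(2)[OF beta pot(2,3)])
    show "log_lipschitz L (\<lambda>z. exp (- g z))" by (rule fixed_point(2)[OF alpha pot(1,4)])
    show "exp (- f z) = (\<integral>y. exp (- C z y) / exp (- g y) \<partial>\<beta>)" for z by (rule fixed_point(1)[OF beta pot(2,3)])
    show "exp (- g z) = (\<integral>y. exp (- C z y) / exp (- f y) \<partial>\<alpha>)" for z by (rule fixed_point(1)[OF alpha pot(1,4)])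
    have "dist z z' \<le> diameter (UNIV :: 'a set)" for z z' :: 'a
      using diameter_bounded_bound[OF compact_imp_bounded[OF cpt]] by simp
    then show "exp (2 * L * dist z z') \<le> exp (2 * L * diameter (UNIV :: 'a set))" for z z' :: 'a
      using L by (simp add: mult_left_mono)
  qed
qed

theorem proposition3:
  fixes C :: "'a::metric_space \<Rightarrow> 'a \<Rightarrow> real"
    and L B :: real
    and \<alpha> \<beta> :: "'a measure"
    and w \<eta> :: "nat \<Rightarrow> real"
    and n :: "nat \<Rightarrow> nat"
    and M :: "'w measure"
    and x y :: "nat \<Rightarrow> 'w \<Rightarrow> 'a"
    and f g :: "nat \<Rightarrow> 'w \<Rightarrow> 'a \<Rightarrow> real"
    and f_opt g_opt :: "'a \<Rightarrow> real"
  assumes compact_space: "compact (UNIV :: 'a set)"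
    and cost_symmetric: "\<And>u v. C u v = C v u"
    and cost_lipschitz: "L-lipschitz_on UNIV (\<lambda>(u, v). C u v)"
    and alpha: "prob_space \<alpha>" "sets \<alpha> = sets borel"
    and beta: "prob_space \<beta>" "sets \<beta> = sets borel"
    and potentials: "optimal_potentials C \<alpha> \<beta> f_opt g_opt"
    and B_pos: "B > 0"
    and w_pos: "\<And>t. t \<ge> 1 \<Longrightarrow> w t > 0"
    and first_batch: "n 0 > 0"
    and batch_sizes: "\<And>t. t \<ge> 1 \<Longrightarrow> real (n t) = B / (w t)\<^sup>2"
    and step_sizes: "\<And>t. t \<ge> 1 \<Longrightarrow> 0 \<le> \<eta> t \<and> \<eta> t \<le> 1"
    and sum_w_eta: "summable (\<lambda>t. w (t + 1) * \<eta> (t + 1))"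
    and sum_eta: "filterlim (\<lambda>N. \<Sum>t = 1..N. \<eta> t) at_top sequentially"
    and prob_M: "prob_space M"
    and indep: "prob_space.indep_vars M (\<lambda>_. borel) (case_sum x y) ({1..} <+> {1..})"
    and distr_x: "\<And>i. i \<ge> 1 \<Longrightarrow> distr M borel (x i) = \<alpha>"
    and distr_y: "\<And>i. i \<ge> 1 \<Longrightarrow> distr M borel (y i) = \<beta>"
    and iterates: "\<And>\<omega>. \<omega> \<in> space M \<Longrightarrow>
      online_sinkhorn C n \<eta> (\<lambda>i. x i \<omega>) (\<lambda>i. y i \<omega>) (\<lambda>t. f t \<omega>) (\<lambda>t. g t \<omega>)"
  shows "AE \<omega> in M.
    (\<lambda>t. var_norm (\<lambda>z. f t \<omega> z - f_opt z) + var_norm (\<lambda>z. g t \<omega> z - g_opt z)) \<longlonglongrightarrow> 0"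
proof -
  define K where "K = (\<lambda>z y. exp (- C z y))"
  define R where "R = exp (2 * L * diameter (UNIV :: 'a set))"
  define astar where "astar = (\<lambda>z. exp (- f_opt z))"
  define bstar where "bstar = (\<lambda>z. exp (- g_opt z))"
  define \<eta>' where "\<eta>' = (\<lambda>k. \<eta> (Suc k))"
  have pot: "continuous_on UNIV f_opt" "continuous_on UNIV g_opt"
    "f_opt = soft_C_transform C \<beta> g_opt" "g_opt = soft_C_transform C \<alpha> f_opt"
    using potentials unfolding optimal_potentials_def by blast+
  interpret sinkhorn_kernel \<alpha> \<beta> K astar bstar L R
    unfolding K_def R_def astar_def bstar_def
    by (rule sinkhorn_kernel_of_potentials[OF compact_space cost_symmetric cost_lipschitz alpha beta pot])
  interpret sw: sinkhorn_kernel \<beta> \<alpha> K bstar astar L R by (rule swap)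
  interpret M: prob_space M by (rule prob_M)
  have n: "0 < n t" for t
  proof (cases "t = 0")
    case False
    then have "0 < real (n t)" using batch_sizes[of t] w_pos[of t] B_pos by simp
    then show ?thesis by simp
  qed (use first_batch in simp)
  \<comment> \<open>The expected error of a batch is a multiple of \<open>w\<close>, by the choice of the batch sizes.\<close>
  have sqrt_n: "R / sqrt (n (Suc k)) = (R / sqrt B) * w (Suc k)" for k
    using batch_sizes[of "Suc k"] w_pos[of "Suc k"] B_pos by (simp add: real_sqrt_divide)
  have "summable (\<lambda>k. (R / sqrt B) * (w (k + 1) * \<eta> (k + 1)))" by (intro summable_mult sum_w_eta)
  then have sum: "summable (\<lambda>k. \<eta> (Suc k) * (R / sqrt (n (Suc k))))"
    unfolding sqrt_n by (simp only: Suc_eq_plus1 mult.commute mult.left_commute)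
  obtain D :: "'a set" where D: "countable D" "\<And>z e. 0 < e \<Longrightarrow> \<exists>d\<in>D. dist z d < e"
    using compact_countable_dense[OF compact_space] by blast
  let ?I = "{1..} <+> {1..} :: (nat + nat) set"
  have y_errors: "AE \<omega> in M. summable (\<lambda>k. \<eta>' k * (\<integral>z. \<bar>sampling_error n \<eta> k (\<lambda>i. x i \<omega>) (\<lambda>i. y i \<omega>) z\<bar> \<partial>\<nu>))"
    if "prob_space \<nu>" "sets \<nu> = sets borel" for \<nu>
    using sampling_errors_summable[OF prob_M indep, of Inl Inr, OF _ _ _ _ _ _ n step_sizes sum that] distr_y
    by (simp add: \<eta>'_def InlI InrI)
  have x_errors: "AE \<omega> in M. summable (\<lambda>k. \<eta>' k * (\<integral>z. \<bar>sw.sampling_error n \<eta> k (\<lambda>i. y i \<omega>) (\<lambda>i. x i \<omega>) z\<bar> \<partial>\<nu>))"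
    if "prob_space \<nu>" "sets \<nu> = sets borel" for \<nu>
    using sw.sampling_errors_summable[OF prob_M indep, of Inr Inl, OF _ _ _ _ _ _ n step_sizes sum that] distr_x
    by (simp add: \<eta>'_def InlI InrI)
  have W: "log_lipschitz L (sinkhorn_weight K n \<eta> k X Y)" for k X Y
    by (intro sinkhorn_weight_log_lipschitz K_log_lipschitz n step_sizes)
  have avg: "log_lipschitz L (\<lambda>z. batch_average n Y (Suc k) (\<lambda>y. K z y / sinkhorn_weight K n \<eta> k' X X' y))" for Y X X' k k'
    by (intro batch_average_log_lipschitz K_log_lipschitz log_lipschitzD(1)[OF W] n)
  have err_cont: "continuous_on UNIV (sampling_error n \<eta> k X Y)" "continuous_on UNIV (sw.sampling_error n \<eta> k X Y)" for k X Y
    unfolding sampling_error_def sw.sampling_error_def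
    by (intro continuous_relative_error sw.continuous_relative_error avg W)+
  \<comment> \<open>The measure \<open>\<nu> = return borel d\<close> turns mean errors into errors at \<open>d\<close>; countably many \<open>d\<close> suffice.\<close>
  have point_mass: "(\<integral>z. \<bar>h z\<bar> \<partial>return borel d) = \<bar>h d\<bar>" if "continuous_on UNIV h" for h :: "'a \<Rightarrow> real" and d
    by (rule integral_return) (auto intro!: borel_measurable_continuous_onI continuous_intros that)
  have return: "prob_space (return borel d)" "sets (return borel d) = sets borel" for d :: 'a
    by (auto intro: prob_space_return)
  have "AE \<omega> in M. \<forall>d\<in>D. summable (\<lambda>k. \<eta>' k * \<bar>sampling_error n \<eta> k (\<lambda>i. x i \<omega>) (\<lambda>i. y i \<omega>) d\<bar>)"
    unfolding AE_ball_countable[OF D(1)] using y_errors[OF return] by (simp add: point_mass err_cont)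
  moreover have "AE \<omega> in M. \<forall>d\<in>D. summable (\<lambda>k. \<eta>' k * \<bar>sw.sampling_error n \<eta> k (\<lambda>i. y i \<omega>) (\<lambda>i. x i \<omega>) d\<bar>)"
    unfolding AE_ball_countable[OF D(1)] using x_errors[OF return] by (simp add: point_mass err_cont)
  ultimately show ?thesis
    using y_errors[OF alpha] x_errors[OF beta] AE_space
  proof eventually_elim
    case (elim \<omega>)
    define X where "X = (\<lambda>i. x i \<omega>)"
    define Y where "Y = (\<lambda>i. y i \<omega>)"
    define a where "a = (\<lambda>k. sinkhorn_weight K n \<eta> k Y X)"
    define b where "b = (\<lambda>k. sinkhorn_weight K n \<eta> k X Y)"
    define ahat where "ahat = (\<lambda>k z. batch_average n Y (Suc k) (\<lambda>y. K z y / b k y))"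
    define bhat where "bhat = (\<lambda>k z. batch_average n X (Suc k) (\<lambda>y. K z y / a k y))"
    have err: "relative_error (ahat k) (b k) = sampling_error n \<eta> k X Y"
      "sw.relative_error (bhat k) (a k) = sw.sampling_error n \<eta> k Y X" for k
      by (simp_all add: sampling_error_def sw.sampling_error_def ahat_def bhat_def a_def b_def)
    have \<eta>'_diverges: "filterlim (\<lambda>N. \<Sum>k<N. \<eta>' k) at_top sequentially"
      using sum_eta unfolding \<eta>'_def by (simp add: sum.atLeast1_atMost_eq)
    have ll: "log_lipschitz L (a k)" "log_lipschitz L (b k)" "log_lipschitz L (ahat k)" "log_lipschitz L (bhat k)" for k
      unfolding ahat_def bhat_def a_def b_def by (intro W avg)+
    have steps: "a (Suc k) z = (1 - \<eta>' k) * a k z + \<eta>' k * ahat k z"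
      "b (Suc k) z = (1 - \<eta>' k) * b k z + \<eta>' k * bhat k z" for k z
      by (simp_all add: a_def b_def ahat_def bhat_def \<eta>'_def)
    have \<eta>': "0 \<le> \<eta>' k" "\<eta>' k \<le> 1" for k
      using step_sizes[of "Suc k"] by (simp_all add: \<eta>'_def)
    have err_ge: "1 / R \<le> 1 + relative_error (ahat k) (b k) z" "1 / R \<le> 1 + sw.relative_error (bhat k) (a k) z" for k z
      unfolding ahat_def bhat_def a_def b_def
      by (intro relative_error_ge sw.relative_error_ge W n)+
    have mean_err: "summable (\<lambda>k. \<eta>' k * (\<integral>z. \<bar>relative_error (ahat k) (b k) z\<bar> \<partial>\<alpha>))"
      "summable (\<lambda>k. \<eta>' k * (\<integral>z. \<bar>sw.relative_error (bhat k) (a k) z\<bar> \<partial>\<beta>))"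
      using elim(3,4) unfolding err X_def Y_def .
    have D_err: "summable (\<lambda>k. \<eta>' k * \<bar>relative_error (ahat k) (b k) d\<bar>)"
      "summable (\<lambda>k. \<eta>' k * \<bar>sw.relative_error (bhat k) (a k) d\<bar>)" if "d \<in> D" for d
      using elim(1,2)[rule_format, OF that] unfolding err X_def Y_def .
    note conv = deterministic_convergence[where a = a and b = b and ahat = ahat and bhat = bhat
        and \<eta> = \<eta>' and D = D, OF ll steps \<eta>' \<eta>'_diverges err_ge mean_err D(2) D_err]
    have "exp (- f (Suc k) \<omega> z) = a k z \<and> exp (- g (Suc k) \<omega> z) = b k z" for k z
      unfolding a_def b_def X_def Y_def K_def
      by (rule online_sinkhorn_weights[OF iterates[OF elim(5)] cost_symmetric
            Gibbs_kernel_log_lipschitz(2)[OF cost_lipschitz] L_nonneg n step_sizes])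
    then have weights: "a k z = exp (- f (Suc k) \<omega> z)" "b k z = exp (- g (Suc k) \<omega> z)" for k z by metis+
    have ln_ratio: "ln (exp (- p) / exp (- q)) = - (p - q)" for p q :: real
      unfolding exp_diff[symmetric] by simp
    have "(\<lambda>k. var_norm (\<lambda>z. f (Suc k) \<omega> z - f_opt z)) \<longlonglongrightarrow> 0"
      "(\<lambda>k. var_norm (\<lambda>z. g (Suc k) \<omega> z - g_opt z)) \<longlonglongrightarrow> 0"
      using conv unfolding weights astar_def bstar_def ln_ratio var_norm_uminus by simp_all
    from tendsto_add[OF this]
    have "(\<lambda>k. var_norm (\<lambda>z. f (Suc k) \<omega> z - f_opt z) + var_norm (\<lambda>z. g (Suc k) \<omega> z - g_opt z)) \<longlonglongrightarrow> 0"
      by simp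
    then show ?case by (rule LIMSEQ_imp_Suc)
  qed
qed

end
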